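(* Let $A$ be an ISP-domain. Then: (a) $A$ is a strongly discrete Prüfer domain; and (b) every nonzero prime ideal of $A$ is contained in a unique maximal ideal of $A$. In particular, a local domain is an ISP-domain if and only if it is a strongly discrete valuation domain.
   Context: All rings are commutative and unitary; "ideal" of a domain means integral ideal. "Local" means having a unique maximal ideal (no Noetherian hypothesis). A domain $A$ is an ISP-domain (invertible semiprime domain) if every proper nonzero ideal $I$ of $A$ can be written as $I=JQ_1\cdots Q_n$ where $n\geq 1$, $J$ is an invertible ideal of $A$ and each $Q_i$ is a proper radical ideal of $A$. A domain is a Prüfer domain if all its nonzero finitely generated ideals are invertible. A Prüfer domain (in particular, a valuation domain) is strongly discrete if it has no idempotent prime ideal except zero, i.e. $P\neq P^2$ for every nonzero prime ideal $P$. *)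

theory Defs
  imports "HOL-Algebra.Ideal_Product" "HOL-Algebra.RingHom"
begin

section \<open>The quotient field of a domain\<close>

definition quot_rel :: "('a, 'm) ring_scheme \<Rightarrow> (('a \<times> 'a) \<times> ('a \<times> 'a)) set"
  where "quot_rel R = {((a, b), (c, d)). a \<in> carrier R \<and> c \<in> carrier R
    \<and> b \<in> carrier R - {\<zero>\<^bsub>R\<^esub>} \<and> d \<in> carrier R - {\<zero>\<^bsub>R\<^esub>} \<and> a \<otimes>\<^bsub>R\<^esub> d = c \<otimes>\<^bsub>R\<^esub> b}"

definition quot_frac :: "('a, 'm) ring_scheme \<Rightarrow> 'a \<Rightarrow> 'a \<Rightarrow> ('a \<times> 'a) set"
  where "quot_frac R a b = quot_rel R `` {(a, b)}"

text \<open>Sums and products are computed on representatives; the results do not depend on the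
  chosen representatives, see \<open>quot_frac_mult\<close> and \<open>quot_frac_add\<close> below.\<close>

definition quot_field :: "('a, 'm) ring_scheme \<Rightarrow> ('a \<times> 'a) set ring"
  where "quot_field R =
    \<lparr>carrier = {quot_frac R a b | a b. a \<in> carrier R \<and> b \<in> carrier R - {\<zero>\<^bsub>R\<^esub>}},
     mult = (\<lambda>x y. \<Union>p\<in>x. \<Union>q\<in>y. quot_frac R (fst p \<otimes>\<^bsub>R\<^esub> fst q) (snd p \<otimes>\<^bsub>R\<^esub> snd q)),
     one = quot_frac R \<one>\<^bsub>R\<^esub> \<one>\<^bsub>R\<^esub>,
     zero = quot_frac R \<zero>\<^bsub>R\<^esub> \<one>\<^bsub>R\<^esub>,
     add = (\<lambda>x y. \<Union>p\<in>x. \<Union>q\<in>y.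
              quot_frac R ((fst p \<otimes>\<^bsub>R\<^esub> snd q) \<oplus>\<^bsub>R\<^esub> (fst q \<otimes>\<^bsub>R\<^esub> snd p))
                (snd p \<otimes>\<^bsub>R\<^esub> snd q))\<rparr>"

definition quot_emb :: "('a, 'm) ring_scheme \<Rightarrow> 'a \<Rightarrow> ('a \<times> 'a) set"
  where "quot_emb R a = quot_frac R a \<one>\<^bsub>R\<^esub>"

context "domain"
begin

lemma quot_rel_iff:
  "((a, b), (c, d)) \<in> quot_rel R \<longleftrightarrow> a \<in> carrier R \<and> c \<in> carrier R
    \<and> b \<in> carrier R - {\<zero>} \<and> d \<in> carrier R - {\<zero>} \<and> a \<otimes> d = c \<otimes> b"
  by (simp add: quot_rel_def)

lemma equiv_quot_rel: "equiv (carrier R \<times> (carrier R - {\<zero>})) (quot_rel R)"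
proof (rule equivI)
  show "quot_rel R \<subseteq> (carrier R \<times> (carrier R - {\<zero>})) \<times> (carrier R \<times> (carrier R - {\<zero>}))"
    by (auto simp: quot_rel_def)
  show "refl_on (carrier R \<times> (carrier R - {\<zero>})) (quot_rel R)"
    by (auto simp: refl_on_def quot_rel_def)
  show "sym (quot_rel R)"
    by (auto simp: sym_def quot_rel_def)
  show "trans (quot_rel R)"
  proof (rule transI, clarify)
    fix a b c d e f
    assume "((a, b), (c, d)) \<in> quot_rel R" "((c, d), (e, f)) \<in> quot_rel R"
    then have cl: "a \<in> carrier R" "b \<in> carrier R" "c \<in> carrier R" "d \<in> carrier R"
      "e \<in> carrier R" "f \<in> carrier R" and nz: "b \<noteq> \<zero>" "d \<noteq> \<zero>" "f \<noteq> \<zero>"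
      and e1: "a \<otimes> d = c \<otimes> b" and e2: "c \<otimes> f = e \<otimes> d"
      by (auto simp: quot_rel_iff)
    have "d \<otimes> (a \<otimes> f) = (a \<otimes> d) \<otimes> f"
      using cl by (simp add: m_ac)
    also have "\<dots> = (c \<otimes> f) \<otimes> b"
      unfolding e1 using cl by (simp add: m_ac)
    also have "\<dots> = d \<otimes> (e \<otimes> b)"
      unfolding e2 using cl by (simp add: m_ac)
    finally have "a \<otimes> f = e \<otimes> b"
      using cl nz by (simp add: m_lcancel)
    then show "((a, b), (e, f)) \<in> quot_rel R"
      using cl nz by (simp add: quot_rel_iff)
  qed
qed

lemma quot_frac_eq_iff:
  assumes "a \<in> carrier R" "b \<in> carrier R - {\<zero>}" "c \<in> carrier R" "d \<in> carrier R - {\<zero>}"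
  shows "quot_frac R a b = quot_frac R c d \<longleftrightarrow> a \<otimes> d = c \<otimes> b"
  using eq_equiv_class_iff[OF equiv_quot_rel, of "(a, b)" "(c, d)"] assms
  by (simp add: quot_frac_def quot_rel_iff)

lemma quot_frac_mult:
  assumes "a \<in> carrier R" "b \<in> carrier R - {\<zero>}" "c \<in> carrier R" "d \<in> carrier R - {\<zero>}"
  shows "quot_frac R a b \<otimes>\<^bsub>quot_field R\<^esub> quot_frac R c d = quot_frac R (a \<otimes> c) (b \<otimes> d)"
proof -
  have "quot_frac R (a' \<otimes> c') (b' \<otimes> d') = quot_frac R (a \<otimes> c) (b \<otimes> d)"
    if h: "(a', b') \<in> quot_frac R a b" "(c', d') \<in> quot_frac R c d" for a' b' c' d'
  proof -
    have cl: "a' \<in> carrier R" "b' \<in> carrier R - {\<zero>}" "c' \<in> carrier R" "d' \<in> carrier R - {\<zero>}"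
      and e: "a \<otimes> b' = a' \<otimes> b" "c \<otimes> d' = c' \<otimes> d"
      using h by (auto simp: quot_frac_def quot_rel_iff)
    have "(a' \<otimes> c') \<otimes> (b \<otimes> d) = (a' \<otimes> b) \<otimes> (c' \<otimes> d)"
      using cl assms by (simp add: m_ac)
    also have "\<dots> = (a \<otimes> c) \<otimes> (b' \<otimes> d')"
      unfolding e[symmetric] using cl assms by (simp add: m_ac)
    finally show ?thesis
      using cl assms by (subst quot_frac_eq_iff) (auto simp: integral_iff)
  qed
  then have indep: "quot_frac R (fst p \<otimes> fst q) (snd p \<otimes> snd q) = quot_frac R (a \<otimes> c) (b \<otimes> d)"
    if "p \<in> quot_frac R a b" "q \<in> quot_frac R c d" for p q
    using that by (cases p; cases q) simp
  have mem: "(a, b) \<in> quot_frac R a b" "(c, d) \<in> quot_frac R c d"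
    using assms by (auto simp: quot_frac_def quot_rel_iff)
  have "quot_frac R a b \<otimes>\<^bsub>quot_field R\<^esub> quot_frac R c d
      = (\<Union>p\<in>quot_frac R a b. \<Union>q\<in>quot_frac R c d. quot_frac R (a \<otimes> c) (b \<otimes> d))"
    unfolding quot_field_def monoid.simps ring.simps
    by (intro SUP_cong refl) (simp add: indep)
  also have "\<dots> = quot_frac R (a \<otimes> c) (b \<otimes> d)"
    using mem by blast
  finally show ?thesis .
qed

lemma quot_frac_add:
  assumes "a \<in> carrier R" "b \<in> carrier R - {\<zero>}" "c \<in> carrier R" "d \<in> carrier R - {\<zero>}"
  shows "quot_frac R a b \<oplus>\<^bsub>quot_field R\<^esub> quot_frac R c d = quot_frac R ((a \<otimes> d) \<oplus> (c \<otimes> b)) (b \<otimes> d)"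
proof -
  have "quot_frac R ((a' \<otimes> d') \<oplus> (c' \<otimes> b')) (b' \<otimes> d') = quot_frac R ((a \<otimes> d) \<oplus> (c \<otimes> b)) (b \<otimes> d)"
    if h: "(a', b') \<in> quot_frac R a b" "(c', d') \<in> quot_frac R c d" for a' b' c' d'
  proof -
    have cl: "a' \<in> carrier R" "b' \<in> carrier R - {\<zero>}" "c' \<in> carrier R" "d' \<in> carrier R - {\<zero>}"
      and e: "a \<otimes> b' = a' \<otimes> b" "c \<otimes> d' = c' \<otimes> d"
      using h by (auto simp: quot_frac_def quot_rel_iff)
    have "((a' \<otimes> d') \<oplus> (c' \<otimes> b')) \<otimes> (b \<otimes> d)
        = (a' \<otimes> b) \<otimes> (d' \<otimes> d) \<oplus> (c' \<otimes> d) \<otimes> (b' \<otimes> b)"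
      using cl assms by (simp add: l_distr r_distr m_ac)
    also have "\<dots> = ((a \<otimes> d) \<oplus> (c \<otimes> b)) \<otimes> (b' \<otimes> d')"
      unfolding e[symmetric] using cl assms by (simp add: l_distr r_distr m_ac)
    finally show ?thesis
      using cl assms by (subst quot_frac_eq_iff) (auto simp: integral_iff)
  qed
  then have indep: "quot_frac R (fst p \<otimes> snd q \<oplus> fst q \<otimes> snd p) (snd p \<otimes> snd q)
      = quot_frac R ((a \<otimes> d) \<oplus> (c \<otimes> b)) (b \<otimes> d)"
    if "p \<in> quot_frac R a b" "q \<in> quot_frac R c d" for p q
    using that by (cases p; cases q) simp
  have mem: "(a, b) \<in> quot_frac R a b" "(c, d) \<in> quot_frac R c d"
    using assms by (auto simp: quot_frac_def quot_rel_iff)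
  have "quot_frac R a b \<oplus>\<^bsub>quot_field R\<^esub> quot_frac R c d
      = (\<Union>p\<in>quot_frac R a b. \<Union>q\<in>quot_frac R c d. quot_frac R ((a \<otimes> d) \<oplus> (c \<otimes> b)) (b \<otimes> d))"
    unfolding quot_field_def monoid.simps ring.simps
    by (intro SUP_cong refl) (simp add: indep)
  also have "\<dots> = quot_frac R ((a \<otimes> d) \<oplus> (c \<otimes> b)) (b \<otimes> d)"
    using mem by blast
  finally show ?thesis .
qed

lemma carrier_quot_field:
  "x \<in> carrier (quot_field R) \<longleftrightarrow> (\<exists>a b. a \<in> carrier R \<and> b \<in> carrier R - {\<zero>} \<and> x = quot_frac R a b)"
  by (auto simp: quot_field_def)

lemma quot_frac_closed:
  "a \<in> carrier R \<Longrightarrow> b \<in> carrier R - {\<zero>} \<Longrightarrow> quot_frac R a b \<in> carrier (quot_field R)"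
  by (auto simp: carrier_quot_field)

lemma quot_field_one: "\<one>\<^bsub>quot_field R\<^esub> = quot_frac R \<one> \<one>"
  and quot_field_zero: "\<zero>\<^bsub>quot_field R\<^esub> = quot_frac R \<zero> \<one>"
  by (simp_all add: quot_field_def)

lemma cring_quot_field: "cring (quot_field R)"
proof (rule cringI)
  let ?K = "quot_field R"
  have nz: "b \<otimes> d \<in> carrier R - {\<zero>}" if "b \<in> carrier R - {\<zero>}" "d \<in> carrier R - {\<zero>}" for b d
    using that by (auto simp: integral_iff)
  show "abelian_group ?K"
  proof (rule abelian_groupI)
    fix x y assume "x \<in> carrier ?K" "y \<in> carrier ?K"
    then obtain a b c d where h: "a \<in> carrier R" "b \<in> carrier R - {\<zero>}" "x = quot_frac R a b"
      "c \<in> carrier R" "d \<in> carrier R - {\<zero>}" "y = quot_frac R c d"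
      by (auto simp: carrier_quot_field)
    show "x \<oplus>\<^bsub>?K\<^esub> y \<in> carrier ?K"
      using h nz by (auto simp: quot_frac_add intro!: quot_frac_closed)
    show "x \<oplus>\<^bsub>?K\<^esub> y = y \<oplus>\<^bsub>?K\<^esub> x"
      using h by (simp add: quot_frac_add a_comm m_comm)
  next
    fix x y z assume "x \<in> carrier ?K" "y \<in> carrier ?K" "z \<in> carrier ?K"
    then obtain a b c d e f where h: "a \<in> carrier R" "b \<in> carrier R - {\<zero>}" "x = quot_frac R a b"
      "c \<in> carrier R" "d \<in> carrier R - {\<zero>}" "y = quot_frac R c d"
      "e \<in> carrier R" "f \<in> carrier R - {\<zero>}" "z = quot_frac R e f"
      by (auto simp: carrier_quot_field)
    have "x \<oplus>\<^bsub>?K\<^esub> y \<oplus>\<^bsub>?K\<^esub> z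
        = quot_frac R ((a \<otimes> d \<oplus> c \<otimes> b) \<otimes> f \<oplus> e \<otimes> (b \<otimes> d)) (b \<otimes> d \<otimes> f)"
      using h nz[OF h(2) h(5)] by (simp add: quot_frac_add)
    moreover have "x \<oplus>\<^bsub>?K\<^esub> (y \<oplus>\<^bsub>?K\<^esub> z)
        = quot_frac R (a \<otimes> (d \<otimes> f) \<oplus> (c \<otimes> f \<oplus> e \<otimes> d) \<otimes> b) (b \<otimes> (d \<otimes> f))"
      using h nz[OF h(5) h(8)] by (simp add: quot_frac_add)
    ultimately show "x \<oplus>\<^bsub>?K\<^esub> y \<oplus>\<^bsub>?K\<^esub> z = x \<oplus>\<^bsub>?K\<^esub> (y \<oplus>\<^bsub>?K\<^esub> z)"
      using h by (simp add: l_distr r_distr m_ac a_ac)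
  next
    fix x assume "x \<in> carrier ?K"
    then obtain a b where h: "a \<in> carrier R" "b \<in> carrier R - {\<zero>}" "x = quot_frac R a b"
      by (auto simp: carrier_quot_field)
    show "\<zero>\<^bsub>?K\<^esub> \<oplus>\<^bsub>?K\<^esub> x = x"
      using h by (simp add: quot_field_zero quot_frac_add)
    have "quot_frac R (\<ominus> a) b \<oplus>\<^bsub>?K\<^esub> x = quot_frac R (\<ominus> a \<otimes> b \<oplus> a \<otimes> b) (b \<otimes> b)"
      using h by (simp add: quot_frac_add)
    also have "\<dots> = \<zero>\<^bsub>?K\<^esub>"
      unfolding quot_field_zero using h nz[OF h(2) h(2)]
      by (subst quot_frac_eq_iff) (simp_all add: l_minus l_neg)
    finally show "\<exists>y\<in>carrier ?K. y \<oplus>\<^bsub>?K\<^esub> x = \<zero>\<^bsub>?K\<^esub>"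
      using h by (intro bexI[of _ "quot_frac R (\<ominus> a) b"]) (auto intro!: quot_frac_closed)
  qed (auto simp: quot_field_zero intro!: quot_frac_closed)
  show "comm_monoid ?K"
  proof (rule comm_monoidI)
    fix x y assume "x \<in> carrier ?K" "y \<in> carrier ?K"
    then obtain a b c d where h: "a \<in> carrier R" "b \<in> carrier R - {\<zero>}" "x = quot_frac R a b"
      "c \<in> carrier R" "d \<in> carrier R - {\<zero>}" "y = quot_frac R c d"
      by (auto simp: carrier_quot_field)
    show "x \<otimes>\<^bsub>?K\<^esub> y \<in> carrier ?K"
      using h nz by (auto simp: quot_frac_mult intro!: quot_frac_closed)
    show "x \<otimes>\<^bsub>?K\<^esub> y = y \<otimes>\<^bsub>?K\<^esub> x"
      using h by (simp add: quot_frac_mult m_comm)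
  next
    fix x y z assume "x \<in> carrier ?K" "y \<in> carrier ?K" "z \<in> carrier ?K"
    then obtain a b c d e f where h: "a \<in> carrier R" "b \<in> carrier R - {\<zero>}" "x = quot_frac R a b"
      "c \<in> carrier R" "d \<in> carrier R - {\<zero>}" "y = quot_frac R c d"
      "e \<in> carrier R" "f \<in> carrier R - {\<zero>}" "z = quot_frac R e f"
      by (auto simp: carrier_quot_field)
    show "x \<otimes>\<^bsub>?K\<^esub> y \<otimes>\<^bsub>?K\<^esub> z = x \<otimes>\<^bsub>?K\<^esub> (y \<otimes>\<^bsub>?K\<^esub> z)"
      using h nz[OF h(2) h(5)] nz[OF h(5) h(8)] by (simp add: quot_frac_mult m_assoc)
  next
    fix x assume "x \<in> carrier ?K"
    then obtain a b where h: "a \<in> carrier R" "b \<in> carrier R - {\<zero>}" "x = quot_frac R a b"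
      by (auto simp: carrier_quot_field)
    show "\<one>\<^bsub>?K\<^esub> \<otimes>\<^bsub>?K\<^esub> x = x"
      using h by (simp add: quot_field_one quot_frac_mult)
  qed (auto simp: quot_field_one intro!: quot_frac_closed)
  fix x y z assume "x \<in> carrier ?K" "y \<in> carrier ?K" "z \<in> carrier ?K"
  then obtain a b c d e f where h: "a \<in> carrier R" "b \<in> carrier R - {\<zero>}" "x = quot_frac R a b"
    "c \<in> carrier R" "d \<in> carrier R - {\<zero>}" "y = quot_frac R c d"
    "e \<in> carrier R" "f \<in> carrier R - {\<zero>}" "z = quot_frac R e f"
    by (auto simp: carrier_quot_field)
  have "(x \<oplus>\<^bsub>?K\<^esub> y) \<otimes>\<^bsub>?K\<^esub> z = quot_frac R ((a \<otimes> d \<oplus> c \<otimes> b) \<otimes> e) (b \<otimes> d \<otimes> f)"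
    using h nz[OF h(2) h(5)] by (simp add: quot_frac_add quot_frac_mult)
  moreover have "x \<otimes>\<^bsub>?K\<^esub> z \<oplus>\<^bsub>?K\<^esub> y \<otimes>\<^bsub>?K\<^esub> z
      = quot_frac R (a \<otimes> e \<otimes> (d \<otimes> f) \<oplus> c \<otimes> e \<otimes> (b \<otimes> f)) (b \<otimes> f \<otimes> (d \<otimes> f))"
    using h nz[OF h(2) h(8)] nz[OF h(5) h(8)] by (simp add: quot_frac_add quot_frac_mult)
  moreover have "quot_frac R ((a \<otimes> d \<oplus> c \<otimes> b) \<otimes> e) (b \<otimes> d \<otimes> f)
      = quot_frac R (a \<otimes> e \<otimes> (d \<otimes> f) \<oplus> c \<otimes> e \<otimes> (b \<otimes> f)) (b \<otimes> f \<otimes> (d \<otimes> f))"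
    using h nz[OF nz[OF h(2) h(5)] h(8)] nz[OF nz[OF h(2) h(8)] nz[OF h(5) h(8)]]
    by (subst quot_frac_eq_iff) (simp_all add: l_distr r_distr m_ac)
  ultimately show "(x \<oplus>\<^bsub>?K\<^esub> y) \<otimes>\<^bsub>?K\<^esub> z = x \<otimes>\<^bsub>?K\<^esub> z \<oplus>\<^bsub>?K\<^esub> y \<otimes>\<^bsub>?K\<^esub> z"
    by simp
qed

theorem field_quot_field: "field (quot_field R)"
proof (rule cring.cring_fieldI2[OF cring_quot_field])
  show "\<zero>\<^bsub>quot_field R\<^esub> \<noteq> \<one>\<^bsub>quot_field R\<^esub>"
    unfolding quot_field_zero quot_field_one by (subst quot_frac_eq_iff) simp_all
  fix x assume x: "x \<in> carrier (quot_field R)" "x \<noteq> \<zero>\<^bsub>quot_field R\<^esub>"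
  then obtain a b where h: "a \<in> carrier R" "b \<in> carrier R - {\<zero>}" "x = quot_frac R a b"
    by (auto simp: carrier_quot_field)
  then have a: "a \<in> carrier R - {\<zero>}"
    using x(2) by (auto simp: quot_field_zero quot_frac_eq_iff)
  have "x \<otimes>\<^bsub>quot_field R\<^esub> quot_frac R b a = quot_frac R (a \<otimes> b) (b \<otimes> a)"
    using h a by (simp add: quot_frac_mult)
  also have "\<dots> = \<one>\<^bsub>quot_field R\<^esub>"
    unfolding quot_field_one using h a by (subst quot_frac_eq_iff) (auto simp: integral_iff m_comm)
  finally show "\<exists>y\<in>carrier (quot_field R). x \<otimes>\<^bsub>quot_field R\<^esub> y = \<one>\<^bsub>quot_field R\<^esub>"
    using h a by (intro bexI[of _ "quot_frac R b a"]) (auto intro!: quot_frac_closed)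
qed

theorem quot_emb_ring_hom: "quot_emb R \<in> ring_hom R (quot_field R)"
  by (rule ring_hom_memI)
     (auto simp: quot_emb_def quot_field_one quot_frac_mult quot_frac_add intro!: quot_frac_closed)

theorem inj_on_quot_emb: "inj_on (quot_emb R) (carrier R)"
  by (rule inj_onI) (auto simp: quot_emb_def quot_frac_eq_iff)

theorem quot_field_eq_quotient:
  assumes "x \<in> carrier (quot_field R)"
  shows "\<exists>a\<in>carrier R. \<exists>b\<in>carrier R - {\<zero>}. x \<otimes>\<^bsub>quot_field R\<^esub> quot_emb R b = quot_emb R a"
proof -
  obtain a b where h: "a \<in> carrier R" "b \<in> carrier R - {\<zero>}" "x = quot_frac R a b"
    using assms by (auto simp: carrier_quot_field)
  have "x \<otimes>\<^bsub>quot_field R\<^esub> quot_emb R b = quot_emb R a"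
    using h by (simp add: quot_emb_def quot_frac_mult quot_frac_eq_iff)
  then show ?thesis
    using h by blast
qed

end


section \<open>Invertible and radical ideals\<close>

definition fractional_ideal :: "('a, 'm) ring_scheme \<Rightarrow> ('a \<times> 'a) set set \<Rightarrow> bool"
  where "fractional_ideal R F \<longleftrightarrow>
    additive_subgroup F (quot_field R)
    \<and> (\<forall>a\<in>carrier R. \<forall>x\<in>F. quot_emb R a \<otimes>\<^bsub>quot_field R\<^esub> x \<in> F)
    \<and> (\<exists>d\<in>carrier R - {\<zero>\<^bsub>R\<^esub>}. \<forall>x\<in>F.
          quot_emb R d \<otimes>\<^bsub>quot_field R\<^esub> x \<in> quot_emb R ` carrier R)"

text \<open>\<open>ideal_prod K X Y\<close> only closes the products \<open>x \<otimes> y\<close> with \<open>x \<in> X\<close>, \<open>y \<in> Y\<close> under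
  addition in \<open>K\<close>, so over the quotient field it is the product of fractional ideals.\<close>

definition invertible_ideal :: "('a, 'm) ring_scheme \<Rightarrow> 'a set \<Rightarrow> bool"
  where "invertible_ideal R I \<longleftrightarrow> ideal I R \<and>
    (\<exists>F. fractional_ideal R F
       \<and> ideal_prod (quot_field R) (quot_emb R ` I) F = quot_emb R ` carrier R)"

definition ideal_radical :: "('a, 'm) ring_scheme \<Rightarrow> 'a set \<Rightarrow> 'a set"
  where "ideal_radical R I = {a \<in> carrier R. \<exists>n::nat. n \<ge> 1 \<and> a [^]\<^bsub>R\<^esub> n \<in> I}"

definition radical_ideal :: "('a, 'm) ring_scheme \<Rightarrow> 'a set \<Rightarrow> bool"
  where "radical_ideal R I \<longleftrightarrow> ideal I R \<and> ideal_radical R I = I"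


section \<open>Classes of domains\<close>

locale isp_domain = "domain" +
  assumes isp_factorization:
    "\<lbrakk>ideal I R; I \<noteq> {\<zero>}; I \<noteq> carrier R\<rbrakk> \<Longrightarrow>
      \<exists>J Qs. invertible_ideal R J \<and> Qs \<noteq> []
        \<and> (\<forall>Q\<in>set Qs. radical_ideal R Q \<and> Q \<noteq> carrier R)
        \<and> I = foldl (ideal_prod R) J Qs"

locale pruefer_domain = "domain" +
  assumes fin_gen_invertible:
    "\<lbrakk>S \<subseteq> carrier R; finite S; Idl S \<noteq> {\<zero>}\<rbrakk> \<Longrightarrow> invertible_ideal R (Idl S)"

locale valuation_domain = "domain" +
  assumes valuation:
    "\<lbrakk>x \<in> carrier (quot_field R); x \<noteq> \<zero>\<^bsub>quot_field R\<^esub>\<rbrakk> \<Longrightarrow>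
      x \<in> quot_emb R ` carrier R \<or> inv\<^bsub>quot_field R\<^esub> x \<in> quot_emb R ` carrier R"

locale local_domain = "domain" +
  assumes unique_maximal: "\<exists>!M. maximalideal M R"

definition strongly_discrete :: "('a, 'm) ring_scheme \<Rightarrow> bool"
  where "strongly_discrete R \<longleftrightarrow>
    (\<forall>P. primeideal P R \<and> P \<noteq> {\<zero>\<^bsub>R\<^esub>} \<longrightarrow> ideal_prod R P P \<noteq> P)"

end

theory Submission
  imports Defs "HOL-Algebra.Divisibility" "HOL-Algebra.Subrings"
begin

text \<open>The heart of the matter is a domain \<open>L\<close> with a unique maximal ideal in which every
  proper nonzero ideal is a principal ideal times at least one proper radical ideal. If a
  two-generated ideal \<open>(a, b) = UV\<close> of \<open>L\<close> is not principal, then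
  \<open>(a, b) = uV\<close> with \<open>u \<in> U\<close> or \<open>(a, b) = vU\<close> with \<open>v \<in> V\<close>; peeling off the factors one at a
  time, \<open>(a, b) = gQ\<close> with \<open>Q\<close> radical. A factorization of a principal ideal yields a nonunit \<open>q\<close>
  with \<open>(q)\<close> radical, and \<open>(q, y\<^sup>2) = gQ\<close> forces \<open>q\<close> to divide every nonunit \<open>y\<close>, so \<open>(q)\<close> is
  maximal. Now \<open>(a, b) = gQ\<close> with \<open>q \<notin> Q\<close> gives \<open>Q = qQ\<close>, which contradicts Nakayama's lemma; hence
  \<open>L\<close> is a valuation domain with principal maximal ideal.

  This applies to the localizations of an ISP-domain at its primes. The factors of a \<open>P\<close>-saturated
  ideal that are not contained in \<open>P\<close> can be dropped, and some factor remains, since otherwise the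
  invertible factor \<open>J\<close> would satisfy \<open>J = JQ\<close> for a proper ideal \<open>Q\<close>. The Pruefer property and strong
  discreteness follow locally. If a nonzero prime lay below two maximal ideals \<open>M1\<close> and \<open>M2\<close>, let \<open>P'\<close>
  be the largest prime below both and \<open>q\<close> a local generator of \<open>P'\<close>; then the \<open>M1\<close>-saturation of \<open>(q)\<close>
  is locally principal at \<open>M1\<close> and equals \<open>P'\<close> locally at \<open>M2\<close>, so neither its invertible factor nor
  one of its radical factors can be contained in \<open>P'\<close>.\<close>

section \<open>Ideals of a commutative ring: products, colon ideals and ideals with two
  generators\<close>

context cring begin

text \<open>The ideal generated by \<open>a\<close> and \<open>b\<close>, with its coefficients kept
  explicit because generators are exchanged below by computing determinants.\<close>

definition idl2 :: "'a \<Rightarrow> 'a \<Rightarrow> 'a set" where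
  "idl2 a b = {a \<otimes> r \<oplus> b \<otimes> s | r s. r \<in> carrier R \<and> s \<in> carrier R}"

text \<open>Negation is multiplication by \<open>\<ominus> \<one>\<close>, so closure under sums and
  multiples is all that remains to be checked for the ideals built below.\<close>

lemma ideal_of_closed:
  assumes "I \<subseteq> carrier R" "\<zero> \<in> I"
    and add: "\<And>x y. x \<in> I \<Longrightarrow> y \<in> I \<Longrightarrow> x \<oplus> y \<in> I"
    and mult: "\<And>x r. x \<in> I \<Longrightarrow> r \<in> carrier R \<Longrightarrow> x \<otimes> r \<in> I"
  shows "ideal I R"
proof (rule idealI)
  show "ring R" by (rule ring_axioms)
  show "subgroup I (add_monoid R)"
  proof (rule group.subgroupI[OF a_group])
    show "I \<subseteq> carrier (add_monoid R)" using assms(1) by simp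
    show "I \<noteq> {}" using assms(2) by blast
    fix x assume x: "x \<in> I"
    then have "x \<in> carrier R" using assms(1) by blast
    then have "x \<otimes> (\<ominus> \<one>) = \<ominus> x" by (simp add: r_minus)
    then show "inv\<^bsub>add_monoid R\<^esub> x \<in> I"
      using mult[OF x, of "\<ominus> \<one>"] by (simp add: a_inv_def)
    fix y assume "y \<in> I"
    then show "x \<otimes>\<^bsub>add_monoid R\<^esub> y \<in> I" using add[OF x] by simp
  qed
  fix x r assume h: "x \<in> I" "r \<in> carrier R"
  then show "x \<otimes> r \<in> I" by (rule mult)
  then show "r \<otimes> x \<in> I" using h assms(1) m_comm[of r x] by auto
qed

lemma ideal_add_closed: "ideal I R \<Longrightarrow> x \<in> I \<Longrightarrow> y \<in> I \<Longrightarrow> x \<oplus> y \<in> I"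
  by (simp add: additive_subgroup.a_closed ideal.axioms(1))

lemma ideal_zero: "ideal I R \<Longrightarrow> \<zero> \<in> I"
  by (simp add: additive_subgroup.zero_closed ideal.axioms(1))

lemma ideal_unit_eq_carrier:
  assumes "ideal I R" "u \<in> I" "u \<in> Units R"
  shows "I = carrier R"
  using ideal.I_r_closed[OF assms(1,2) Units_inv_closed[OF assms(3)]] assms
  by (simp add: ideal.one_imp_carrier)

lemma ideal_prod_minimal:
  assumes "ideal K R" "\<And>i j. i \<in> I \<Longrightarrow> j \<in> J \<Longrightarrow> i \<otimes> j \<in> K"
  shows "I \<cdot> J \<subseteq> K"
proof
  fix x assume "x \<in> I \<cdot> J"
  then show "x \<in> K"
    by induction (simp_all add: assms ideal_add_closed)
qed

text \<open>Combined with the minimality of products and generated ideals, this allows a condition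
  \<open>c \<otimes> x \<in> K\<close> to be checked on generators only.\<close>

lemma ideal_colon:
  assumes "ideal K R" "c \<in> carrier R"
  shows "ideal {x \<in> carrier R. c \<otimes> x \<in> K} R"
proof (rule ideal_of_closed)
  fix x r assume "x \<in> {x \<in> carrier R. c \<otimes> x \<in> K}" "r \<in> carrier R"
  then show "x \<otimes> r \<in> {x \<in> carrier R. c \<otimes> x \<in> K}"
    using ideal.I_r_closed[OF assms(1), of "c \<otimes> x" r] assms(2) by (simp add: m_assoc)
qed (use assms in \<open>auto simp: ideal_zero r_distr ideal_add_closed\<close>)

lemma ideal_image_mult:
  assumes "ideal V R" "u \<in> carrier R"
  shows "ideal ((\<otimes>) u ` V) R"
proof (rule ideal_of_closed)
  note V = ideal.Icarr[OF assms(1)]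
  show "(\<otimes>) u ` V \<subseteq> carrier R" using V assms(2) by auto
  show "\<zero> \<in> (\<otimes>) u ` V" using ideal_zero[OF assms(1)] assms(2) by (auto intro!: image_eqI[of _ _ \<zero>])
  fix x assume "x \<in> (\<otimes>) u ` V"
  then obtain v where v: "v \<in> V" "x = u \<otimes> v" by auto
  {
    fix y assume "y \<in> (\<otimes>) u ` V"
    then obtain w where "w \<in> V" "y = u \<otimes> w" by auto
    then show "x \<oplus> y \<in> (\<otimes>) u ` V"
      using v V assms(2) by (intro image_eqI[of _ _ "v \<oplus> w"]) (auto simp: r_distr ideal_add_closed[OF assms(1)])
  next
    fix r assume "r \<in> carrier R"
    then show "x \<otimes> r \<in> (\<otimes>) u ` V"
      using v V assms(2) ideal.I_r_closed[OF assms(1)]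
      by (intro image_eqI[of _ _ "v \<otimes> r"]) (auto simp: m_assoc)
  }
qed

lemma foldl_ideal_prod_ideal:
  assumes "ideal J R" "\<forall>Q\<in>set Qs. ideal Q R"
  shows "ideal (foldl (ideal_prod R) J Qs) R"
  using assms by (induction Qs arbitrary: J) (auto intro: ideal_prod_is_ideal)

lemma foldl_ideal_prod_subset:
  assumes "ideal J R" "\<forall>Q\<in>set Qs. ideal Q R"
  shows "foldl (ideal_prod R) J Qs \<subseteq> J"
  using assms
proof (induction Qs rule: rev_induct)
  case (snoc Q Qs)
  then show ?case
    using ideal_prod_inter[OF foldl_ideal_prod_ideal[of J Qs], of Q] by auto
qed simp

lemma mem_PIdl_iff: "a \<in> carrier R \<Longrightarrow> x \<in> PIdl a \<longleftrightarrow> (\<exists>r\<in>carrier R. x = a \<otimes> r)"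
  by (auto simp: cgenideal_def m_comm)

lemma image_mult_PIdl:
  assumes "u \<in> carrier R" "d \<in> carrier R"
  shows "(\<otimes>) u ` (PIdl d) = PIdl (u \<otimes> d)"
proof -
  have PIdl: "PIdl c = (\<otimes>) c ` carrier R" if "c \<in> carrier R" for c
    using that by (auto simp: mem_PIdl_iff)
  show ?thesis
    using assms unfolding PIdl[OF assms(2)] PIdl[OF m_closed[OF assms]] image_image
    by (intro image_cong) (auto simp: m_assoc)
qed

lemma PIdl_zero: "PIdl \<zero> = {\<zero>}"
  by (auto simp: cgenideal_def intro!: exI[of _ \<zero>])

lemma radical_ideal_ideal: "radical_ideal R Q \<Longrightarrow> ideal Q R"
  by (simp add: radical_ideal_def)

lemma radical_ideal_square:
  assumes "radical_ideal R Q" "a \<in> carrier R" "a \<otimes> a \<in> Q"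
  shows "a \<in> Q"
proof -
  have "a [^] (2::nat) \<in> Q" using assms by (simp add: numeral_2_eq_2)
  then have "a \<in> ideal_radical R Q"
    unfolding ideal_radical_def using assms(2) by (auto intro!: exI[of _ "2::nat"])
  then show ?thesis using assms(1) by (simp add: radical_ideal_def)
qed

lemma mem_idl2: "r \<in> carrier R \<Longrightarrow> s \<in> carrier R \<Longrightarrow> a \<otimes> r \<oplus> b \<otimes> s \<in> idl2 a b"
  by (auto simp: idl2_def)

lemma idl2_ideal:
  assumes "a \<in> carrier R" "b \<in> carrier R"
  shows "ideal (idl2 a b) R"
proof (rule ideal_of_closed)
  show "idl2 a b \<subseteq> carrier R" using assms by (auto simp: idl2_def)
  show "\<zero> \<in> idl2 a b" using mem_idl2[of \<zero> \<zero> a b] assms by simp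
  fix x assume "x \<in> idl2 a b"
  then obtain r s where x: "r \<in> carrier R" "s \<in> carrier R" "x = a \<otimes> r \<oplus> b \<otimes> s"
    by (auto simp: idl2_def)
  {
    fix y assume "y \<in> idl2 a b"
    then obtain t w where y: "t \<in> carrier R" "w \<in> carrier R" "y = a \<otimes> t \<oplus> b \<otimes> w"
      by (auto simp: idl2_def)
    have "x \<oplus> y = a \<otimes> (r \<oplus> t) \<oplus> b \<otimes> (s \<oplus> w)"
      using x y assms by (simp add: r_distr a_ac)
    then show "x \<oplus> y \<in> idl2 a b" using x y by (simp add: mem_idl2)
  next
    fix t assume t: "t \<in> carrier R"
    have "x \<otimes> t = a \<otimes> (r \<otimes> t) \<oplus> b \<otimes> (s \<otimes> t)"
      using x t assms by (simp add: l_distr m_assoc)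
    then show "x \<otimes> t \<in> idl2 a b" using x t by (simp add: mem_idl2)
  }
qed

lemma idl2_self:
  assumes "a \<in> carrier R" "b \<in> carrier R"
  shows "a \<in> idl2 a b" "b \<in> idl2 a b"
  using mem_idl2[of \<one> \<zero> a b] mem_idl2[of \<zero> \<one> a b] assms by simp_all

lemma idl2_minimal:
  assumes "ideal I R" "a \<in> I" "b \<in> I"
  shows "idl2 a b \<subseteq> I"
  using assms by (auto simp: idl2_def intro!: ideal_add_closed ideal.I_r_closed)

lemma idl2_commute: "a \<in> carrier R \<Longrightarrow> b \<in> carrier R \<Longrightarrow> idl2 a b = idl2 b a"
  by (intro subset_antisym idl2_minimal idl2_ideal idl2_self)

lemma idl2_eq_PIdl:
  assumes "a \<in> carrier R" "b \<in> PIdl a"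
  shows "idl2 a b = PIdl a"
proof -
  have b: "b \<in> carrier R" using assms by (auto simp: mem_PIdl_iff)
  show ?thesis
    using assms b
    by (intro subset_antisym idl2_minimal cgenideal_minimal cgenideal_ideal idl2_ideal idl2_self cgenideal_self)
qed

text \<open>Cramer's rule: the adjugate of the coefficient matrix produces \<open>a\<close> and
  \<open>b\<close> multiplied by the determinant, which is a unit.\<close>

lemma idl2_subset_if_det_unit:
  assumes c: "a \<in> carrier R" "b \<in> carrier R" "r \<in> carrier R" "s \<in> carrier R"
    "t \<in> carrier R" "w \<in> carrier R"
    and J: "ideal J R" "a \<otimes> r \<oplus> b \<otimes> s \<in> J" "a \<otimes> t \<oplus> b \<otimes> w \<in> J"
    and det: "r \<otimes> w \<ominus> s \<otimes> t \<in> Units R"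
  shows "idl2 a b \<subseteq> J"
proof (rule idl2_minimal[OF J(1)])
  let ?d = "r \<otimes> w \<ominus> s \<otimes> t"
  have d: "?d \<in> carrier R" "inv ?d \<in> carrier R" "?d \<otimes> inv ?d = \<one>" using det by auto
  have m: "z \<in> J \<Longrightarrow> k \<in> carrier R \<Longrightarrow> z \<otimes> k \<in> J" for z k
    using ideal.I_r_closed[OF J(1)] by blast
  have "a \<otimes> ?d = (a \<otimes> r \<oplus> b \<otimes> s) \<otimes> w \<oplus> (a \<otimes> t \<oplus> b \<otimes> w) \<otimes> (\<ominus> s)"
    using c by algebra
  moreover have "b \<otimes> ?d = (a \<otimes> t \<oplus> b \<otimes> w) \<otimes> r \<oplus> (a \<otimes> r \<oplus> b \<otimes> s) \<otimes> (\<ominus> t)"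
    using c by algebra
  ultimately have "a \<otimes> ?d \<in> J" "b \<otimes> ?d \<in> J"
    using c J by (auto intro!: m ideal_add_closed[OF J(1)])
  then have "a \<otimes> ?d \<otimes> inv ?d \<in> J" "b \<otimes> ?d \<otimes> inv ?d \<in> J"
    using m d by blast+
  moreover have "a \<otimes> ?d \<otimes> inv ?d = a" "b \<otimes> ?d \<otimes> inv ?d = b"
    using c d by (simp_all add: m_assoc del: minus_eq)
  ultimately show "a \<in> J" "b \<in> J" by simp_all
qed

end

section \<open>Local domains with factorization\<close>

text \<open>\<open>add_Units\<close> makes the nonunits an ideal, which is how uniqueness of the
  maximal ideal enters. Over a local domain invertible ideals are principal, so
  \<open>PIdl z\<close> stands where an ISP-factorization has its invertible factor.\<close>

locale local_factorization = "domain" +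
  assumes add_Units: "\<lbrakk>a \<in> carrier R; b \<in> carrier R; a \<oplus> b \<in> Units R\<rbrakk> \<Longrightarrow> a \<in> Units R \<or> b \<in> Units R"
    and factorization: "\<lbrakk>ideal I R; I \<noteq> {\<zero>}; I \<noteq> carrier R\<rbrakk> \<Longrightarrow>
      \<exists>z\<in>carrier R. \<exists>Qs. Qs \<noteq> [] \<and> (\<forall>Q\<in>set Qs. radical_ideal R Q \<and> Q \<noteq> carrier R)
        \<and> I = foldl (ideal_prod R) (PIdl z) Qs"
begin

definition principal2 :: "'a \<Rightarrow> 'a \<Rightarrow> bool" where
  "principal2 a b \<longleftrightarrow> (\<exists>d\<in>carrier R. idl2 a b = PIdl d)"

lemma nonunit_mult:
  assumes "a \<in> carrier R" "r \<in> carrier R" "a \<notin> Units R"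
  shows "a \<otimes> r \<notin> Units R"
  using unit_factor[of a r] assms by blast

lemma Units_add_nonunit:
  assumes "a \<in> Units R" "m \<in> carrier R" "m \<notin> Units R"
  shows "a \<oplus> m \<in> Units R"
proof -
  have a: "a \<in> carrier R" using assms(1) by (rule Units_closed)
  have "a = (a \<oplus> m) \<oplus> m \<otimes> (\<ominus> \<one>)" using a assms(2) by algebra
  moreover have "m \<otimes> (\<ominus> \<one>) \<notin> Units R" using nonunit_mult assms by simp
  ultimately show ?thesis using add_Units[of "a \<oplus> m" "m \<otimes> (\<ominus> \<one>)"] a assms by auto
qed

lemma Units_minus_nonunit:
  assumes "a \<in> Units R" "m \<in> carrier R" "m \<notin> Units R"
  shows "a \<ominus> m \<in> Units R"
proof -
  have "\<ominus> m = m \<otimes> (\<ominus> \<one>)" using assms(2) by algebra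
  then have "\<ominus> m \<notin> Units R" using nonunit_mult[of m "\<ominus> \<one>"] assms by simp
  then show ?thesis using Units_add_nonunit[of a "\<ominus> m"] assms by (simp add: a_minus_def)
qed

lemma mult_unit_PIdl:
  assumes "a \<in> carrier R" "u \<in> Units R" "a \<otimes> u \<in> PIdl d" "d \<in> carrier R"
  shows "a \<in> PIdl d"
proof -
  have "a \<otimes> u \<otimes> inv u \<in> PIdl d"
    using assms ideal.I_r_closed[OF cgenideal_ideal[OF assms(4)]] by auto
  then show ?thesis using assms by (simp add: m_assoc Units_closed)
qed

text \<open>Nakayama's lemma in the form needed here: \<open>\<one> \<ominus> m\<close> is a unit,
  so the equation can be solved for \<open>a\<close> as a multiple of \<open>b\<close>.\<close>

lemma mem_PIdl_if_absorb:
  assumes "a \<in> carrier R" "b \<in> carrier R" "m \<in> carrier R" "s \<in> carrier R" "m \<notin> Units R"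
    and e: "a = a \<otimes> m \<oplus> b \<otimes> s"
  shows "a \<in> PIdl b"
proof -
  have "a \<otimes> (\<one> \<ominus> m) = (a \<otimes> m \<oplus> b \<otimes> s) \<ominus> a \<otimes> m"
    unfolding e[symmetric] using assms(1,3) by algebra
  also have "\<dots> = b \<otimes> s" using assms(1-4) by algebra
  finally have "a \<otimes> (\<one> \<ominus> m) \<in> PIdl b" using assms by (auto simp: mem_PIdl_iff)
  then show ?thesis using mult_unit_PIdl Units_minus_nonunit assms by blast
qed

text \<open>This is the sum of \<open>PIdl b\<close> and the multiples of \<open>a\<close> by the
  maximal ideal; \<open>add_Units\<close> gives closure under sums. If it contains \<open>a\<close>,
  then Nakayama's lemma puts \<open>a\<close> into \<open>PIdl b\<close>.\<close>

lemma nonunit_combination_ideal: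
  assumes "a \<in> carrier R" "b \<in> carrier R"
  shows "ideal {a \<otimes> m \<oplus> b \<otimes> s | m s. m \<in> carrier R - Units R \<and> s \<in> carrier R} R" (is "ideal ?I R")
proof (rule ideal_of_closed)
  show "?I \<subseteq> carrier R" using assms by auto
  have "\<zero> \<notin> Units R" using zero_not_one by (auto simp: Units_def)
  then show "\<zero> \<in> ?I" using assms by (auto intro!: exI[of _ \<zero>])
  fix x assume "x \<in> ?I"
  then obtain r s where x: "r \<in> carrier R" "r \<notin> Units R" "s \<in> carrier R" "x = a \<otimes> r \<oplus> b \<otimes> s"
    by auto
  {
    fix y assume "y \<in> ?I"
    then obtain t w where y: "t \<in> carrier R" "t \<notin> Units R" "w \<in> carrier R" "y = a \<otimes> t \<oplus> b \<otimes> w"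
      by auto
    have "x \<oplus> y = a \<otimes> (r \<oplus> t) \<oplus> b \<otimes> (s \<oplus> w)"
      using x y assms by (simp add: r_distr a_ac)
    moreover have "r \<oplus> t \<notin> Units R" using x y add_Units by blast
    ultimately show "x \<oplus> y \<in> ?I" using x y by blast
  next
    fix t assume t: "t \<in> carrier R"
    have "x \<otimes> t = a \<otimes> (r \<otimes> t) \<oplus> b \<otimes> (s \<otimes> t)"
      using x t assms by (simp add: l_distr m_assoc)
    moreover have "r \<otimes> t \<notin> Units R" using x t nonunit_mult by blast
    ultimately show "x \<otimes> t \<in> ?I" using x t by blast
  }
qed

text \<open>Some product \<open>u \<otimes> v\<close> has a unit as its coefficient at
  \<open>a\<close> and can replace \<open>a\<close> as a generator. Otherwise all products, hence
  the whole ideal, would lie in \<open>?I\<close>, and \<open>a\<close> would be a multiple of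
  \<open>b\<close>.\<close>

lemma exchange_product:
  assumes c: "a \<in> carrier R" "b \<in> carrier R"
    and e: "idl2 a b = U \<cdot> V" and np: "\<not> principal2 a b"
  shows "\<exists>u\<in>U. \<exists>v\<in>V. idl2 a b = idl2 (u \<otimes> v) b"
proof (rule ccontr)
  assume neg: "\<not> ?thesis"
  let ?I = "{a \<otimes> m \<oplus> b \<otimes> s | m s. m \<in> carrier R - Units R \<and> s \<in> carrier R}"
  have "u \<otimes> v \<in> ?I" if uv: "u \<in> U" "v \<in> V" for u v
  proof -
    have "u \<otimes> v \<in> idl2 a b" unfolding e using uv by (rule ideal_prod.prod)
    then obtain r s where rs: "r \<in> carrier R" "s \<in> carrier R" "u \<otimes> v = a \<otimes> r \<oplus> b \<otimes> s"
      by (auto simp: idl2_def)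
    have uvc: "u \<otimes> v \<in> carrier R" using rs c by simp
    have "r \<notin> Units R"
    proof
      assume r: "r \<in> Units R"
      let ?J = "idl2 (u \<otimes> v) b"
      have J: "ideal ?J R" "u \<otimes> v \<in> ?J" "b \<in> ?J" using idl2_ideal idl2_self uvc c by auto
      \<comment> \<open>The coefficient matrix of \<open>u \<otimes> v\<close> and \<open>b\<close>
        is triangular with determinant \<open>r\<close>.\<close>
      have "idl2 a b \<subseteq> ?J"
        by (rule idl2_subset_if_det_unit[of a b r s \<zero> \<one>]) (use J rs r c in \<open>simp_all add: a_minus_def\<close>)
      moreover have "?J \<subseteq> idl2 a b"
        by (rule idl2_minimal) (use c idl2_ideal idl2_self \<open>u \<otimes> v \<in> idl2 a b\<close> in auto)
      ultimately show False using neg uv by blast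
    qed
    then show ?thesis using rs by blast
  qed
  then have "idl2 a b \<subseteq> ?I"
    unfolding e using nonunit_combination_ideal[OF c] by (rule_tac ideal_prod_minimal) auto
  then obtain m s where "m \<in> carrier R" "m \<notin> Units R" "s \<in> carrier R" "a = a \<otimes> m \<oplus> b \<otimes> s"
    using idl2_self(1)[OF c] by auto
  then have "a \<in> PIdl b" using mem_PIdl_if_absorb c by blast
  then show False
    using np c idl2_eq_PIdl[of b a] idl2_commute[of a b] by (auto simp: principal2_def)
qed

text \<open>Multiplication is a bilinear map from \<open>U\<close> and \<open>V\<close> onto the two-dimensional space
  \<open>idl2 a b\<close> modulo its multiples by nonunits; such a map is onto already
  after fixing one of its two arguments suitably.\<close>

lemma idl2_eq_prod:
  assumes c: "a \<in> carrier R" "b \<in> carrier R" and I: "ideal U R" "ideal V R"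
    and e: "idl2 a b = U \<cdot> V" and np: "\<not> principal2 a b"
  shows "(\<exists>u\<in>U. idl2 a b = (\<otimes>) u ` V) \<or> (\<exists>v\<in>V. idl2 a b = (\<otimes>) v ` U)"
proof -
  note UV = ideal.Icarr[OF I(1)] ideal.Icarr[OF I(2)]
  obtain u1 v1 where 1: "u1 \<in> U" "v1 \<in> V" "idl2 a b = idl2 (u1 \<otimes> v1) b"
    using exchange_product[OF c e np] by blast
  have u1v1: "u1 \<otimes> v1 \<in> carrier R" using 1 UV by simp
  \<comment> \<open>The generators trade places, so that the second exchange replaces
    \<open>b\<close> and keeps \<open>u1 \<otimes> v1\<close>.\<close>
  have e': "idl2 b (u1 \<otimes> v1) = U \<cdot> V" using 1 e idl2_commute[OF c(2) u1v1] by simp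
  have np': "\<not> principal2 b (u1 \<otimes> v1)"
    using np e e' by (simp add: principal2_def)
  obtain u2 v2 where 2: "u2 \<in> U" "v2 \<in> V" "U \<cdot> V = idl2 (u2 \<otimes> v2) (u1 \<otimes> v1)"
    using exchange_product[OF c(2) u1v1 e' np'] e' by auto
  define p q where pq: "p = u1 \<otimes> v1" "q = u2 \<otimes> v2"
  have car: "u1 \<in> carrier R" "u2 \<in> carrier R" "v1 \<in> carrier R" "v2 \<in> carrier R"
    "p \<in> carrier R" "q \<in> carrier R"
    using 1 2 UV pq by auto
  have UVpq: "U \<cdot> V = idl2 p q" using 2 pq idl2_commute car by simp
  have uV: ?thesis if "u \<in> U" "idl2 p q \<subseteq> (\<otimes>) u ` V" for u
  proof -
    have "(\<otimes>) u ` V \<subseteq> U \<cdot> V" using that by (auto intro: ideal_prod.prod)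
    then have "idl2 a b = (\<otimes>) u ` V" using that UVpq e by auto
    then show ?thesis using that by blast
  qed
  have vU: ?thesis if "v \<in> V" "idl2 p q \<subseteq> (\<otimes>) v ` U" for v
  proof -
    have "(\<otimes>) v ` U \<subseteq> U \<cdot> V"
    proof
      fix x assume "x \<in> (\<otimes>) v ` U"
      then obtain u where "u \<in> U" "x = v \<otimes> u" by auto
      then show "x \<in> U \<cdot> V" using that UV m_comm[of v u] ideal_prod.prod[of u U v V R] by auto
    qed
    then have "idl2 a b = (\<otimes>) v ` U" using that UVpq e by auto
    then show ?thesis using that by blast
  qed
  \<comment> \<open>The mixed products are expanded in the generators \<open>p\<close> and
    \<open>q\<close>; their four coefficients decide which argument is to be fixed.\<close>
  have "u1 \<otimes> v2 \<in> idl2 p q" "u2 \<otimes> v1 \<in> idl2 p q"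
    unfolding UVpq[symmetric] using 1 2 by (auto intro: ideal_prod.prod)
  then obtain r s t w where rs: "r \<in> carrier R" "s \<in> carrier R" "u1 \<otimes> v2 = p \<otimes> r \<oplus> q \<otimes> s"
    and tw: "t \<in> carrier R" "w \<in> carrier R" "u2 \<otimes> v1 = p \<otimes> t \<oplus> q \<otimes> w"
    by (auto simp: idl2_def)
  have first: "idl2 p q \<subseteq> J" if "ideal J R" "p \<in> J" "p \<otimes> x \<oplus> q \<otimes> y \<in> J"
    "x \<in> carrier R" "y \<in> Units R" for J x y
    using that car Units_closed[OF that(5)]
    by (intro idl2_subset_if_det_unit[of p q \<one> \<zero> x y]) (simp_all add: a_minus_def)
  have second: "idl2 p q \<subseteq> J" if "ideal J R" "q \<in> J" "p \<otimes> x \<oplus> q \<otimes> y \<in> J"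
    "x \<in> Units R" "y \<in> carrier R" for J x y
    using that car Units_closed[OF that(4)]
    by (intro idl2_subset_if_det_unit[of p q x y \<zero> \<one>]) (simp_all add: a_minus_def)
  have im: "p \<in> (\<otimes>) u1 ` V" "p \<in> (\<otimes>) v1 ` U" "q \<in> (\<otimes>) u2 ` V" "q \<in> (\<otimes>) v2 ` U"
    "u1 \<otimes> v2 \<in> (\<otimes>) u1 ` V" "u1 \<otimes> v2 \<in> (\<otimes>) v2 ` U"
    "u2 \<otimes> v1 \<in> (\<otimes>) u2 ` V" "u2 \<otimes> v1 \<in> (\<otimes>) v1 ` U"
    using 1 2 car m_comm pq by (blast intro: image_eqI)+
  note im = im[unfolded rs(3) tw(3)]
  show ?thesis
  proof (cases "s \<in> Units R \<or> t \<in> Units R \<or> r \<in> Units R \<or> w \<in> Units R")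
    \<comment> \<open>One unit coefficient suffices: for instance, the multiples of
      \<open>u1\<close> by \<open>V\<close> contain \<open>p\<close> and
      \<open>p \<otimes> r \<oplus> q \<otimes> s\<close>, whose coefficient matrix has determinant
      \<open>s\<close>.\<close>
    case True
    then consider "s \<in> Units R" | "t \<in> Units R" | "r \<in> Units R" | "w \<in> Units R" by blast
    then show ?thesis
    proof cases
      case 1
      show ?thesis using uV[OF \<open>u1 \<in> U\<close> first] ideal_image_mult[OF I(2)] car im rs 1 by blast
    next
      case 2
      show ?thesis using uV[OF \<open>u2 \<in> U\<close> second] ideal_image_mult[OF I(2)] car im tw 2 by blast
    next
      case 3
      show ?thesis using vU[OF \<open>v2 \<in> V\<close> second] ideal_image_mult[OF I(1)] car im rs 3 by blast
    next
      case 4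
      show ?thesis using vU[OF \<open>v1 \<in> V\<close> first] ideal_image_mult[OF I(1)] car im tw 4 by blast
    qed
  next
    case False
    then have nu: "s \<notin> Units R" "t \<notin> Units R" "r \<notin> Units R" "w \<notin> Units R" by auto
    \<comment> \<open>When all four coefficients are nonunits, multiplication by
      \<open>u1 \<oplus> u2\<close> sends \<open>v1\<close> to \<open>p\<close> and
      \<open>v2\<close> to \<open>q\<close> up to nonunit coefficients, so the determinant is
      congruent to \<open>\<one>\<close> modulo the maximal ideal.\<close>
    let ?u = "u1 \<oplus> u2"
    have u: "?u \<in> U" using 1 2 ideal_add_closed[OF I(1)] by blast
    have "?u \<otimes> v1 = u1 \<otimes> v1 \<oplus> u2 \<otimes> v1" using car by (simp add: l_distr)
    also have "\<dots> = p \<oplus> (p \<otimes> t \<oplus> q \<otimes> w)" by (simp only: tw(3) pq(1)[symmetric])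
    also have "\<dots> = p \<otimes> (\<one> \<oplus> t) \<oplus> q \<otimes> w"
      using car tw by (simp add: r_distr a_ac)
    finally have a: "p \<otimes> (\<one> \<oplus> t) \<oplus> q \<otimes> w \<in> (\<otimes>) ?u ` V" using 1 by (metis imageI)
    have "?u \<otimes> v2 = u1 \<otimes> v2 \<oplus> u2 \<otimes> v2" using car by (simp add: l_distr)
    also have "\<dots> = (p \<otimes> r \<oplus> q \<otimes> s) \<oplus> q" by (simp only: rs(3) pq(2)[symmetric])
    also have "\<dots> = p \<otimes> r \<oplus> q \<otimes> (\<one> \<oplus> s)"
      using car rs by (simp add: r_distr a_ac)
    finally have b: "p \<otimes> r \<oplus> q \<otimes> (\<one> \<oplus> s) \<in> (\<otimes>) ?u ` V" using 2 by (metis imageI)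
    have "(\<one> \<oplus> t) \<otimes> (\<one> \<oplus> s) \<in> Units R" using nu rs tw Units_add_nonunit by simp
    then have "(\<one> \<oplus> t) \<otimes> (\<one> \<oplus> s) \<ominus> w \<otimes> r \<in> Units R"
      using Units_minus_nonunit nonunit_mult nu rs tw by simp
    then show ?thesis
      using a b car rs tw by (intro uV[OF u] idl2_subset_if_det_unit[of p q "\<one> \<oplus> t" w r "\<one> \<oplus> s"])
        (auto intro!: ideal_image_mult I)
  qed
qed

lemma principal2_scale:
  assumes c: "u \<in> carrier R" "a \<in> carrier R" "b \<in> carrier R" and p: "principal2 a b"
  shows "principal2 (u \<otimes> a) (u \<otimes> b)"
proof -
  obtain d where d: "d \<in> carrier R" "idl2 a b = PIdl d" using p by (auto simp: principal2_def)
  have "idl2 (u \<otimes> a) (u \<otimes> b) = (\<otimes>) u ` idl2 a b"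
  proof (rule subset_antisym)
    show "idl2 (u \<otimes> a) (u \<otimes> b) \<subseteq> (\<otimes>) u ` idl2 a b"
      using c by (intro idl2_minimal ideal_image_mult idl2_ideal imageI idl2_self)
    show "(\<otimes>) u ` idl2 a b \<subseteq> idl2 (u \<otimes> a) (u \<otimes> b)"
    proof
      fix x assume "x \<in> (\<otimes>) u ` idl2 a b"
      then obtain r s where "r \<in> carrier R" "s \<in> carrier R" "x = u \<otimes> (a \<otimes> r \<oplus> b \<otimes> s)"
        by (auto simp: idl2_def)
      moreover from this have "x = u \<otimes> a \<otimes> r \<oplus> u \<otimes> b \<otimes> s" using c by (simp add: r_distr m_assoc)
      ultimately show "x \<in> idl2 (u \<otimes> a) (u \<otimes> b)" using mem_idl2 by metis
    qed
  qed
  also have "\<dots> = PIdl (u \<otimes> d)"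
    using c(1) d image_mult_PIdl by simp
  finally show ?thesis using c d by (auto simp: principal2_def)
qed

text \<open>Induction from the last factor by \<open>idl2_eq_prod\<close>: either this factor
  survives up to a multiplier, or the ideal is a multiple of the product of the other factors, which
  is then again two-generated and not principal. The list cannot be exhausted, as
  \<open>PIdl z\<close> is principal.\<close>

lemma idl2_eq_foldl_prod:
  assumes "z \<in> carrier R" "\<forall>Q\<in>set Qs. ideal Q R" "a \<in> carrier R" "b \<in> carrier R"
    and "idl2 a b = foldl (ideal_prod R) (PIdl z) Qs" "\<not> principal2 a b"
  shows "\<exists>g\<in>carrier R. \<exists>Q\<in>set Qs. idl2 a b = (\<otimes>) g ` Q"
  using assms
proof (induction Qs arbitrary: a b rule: rev_induct)
  case Nil
  then show ?case by (auto simp: principal2_def)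
next
  case (snoc U Qs)
  let ?V = "foldl (ideal_prod R) (PIdl z) Qs"
  have V: "ideal ?V R" and U: "ideal U R"
    using snoc.prems cgenideal_ideal foldl_ideal_prod_ideal by auto
  have "idl2 a b = ?V \<cdot> U" using snoc.prems by simp
  from idl2_eq_prod[OF snoc.prems(3,4) V U this snoc.prems(6)] consider
    u where "u \<in> U" "idl2 a b = (\<otimes>) u ` ?V" | v where "v \<in> ?V" "idl2 a b = (\<otimes>) v ` U"
    by blast
  then show ?case
  proof cases
    case 1
    have u: "u \<in> carrier R" using 1 ideal.Icarr[OF U] by blast
    obtain a' b' where ab: "a' \<in> ?V" "a = u \<otimes> a'" "b' \<in> ?V" "b = u \<otimes> b'"
      using idl2_self[OF snoc.prems(3,4)] 1 by auto
    have c: "a' \<in> carrier R" "b' \<in> carrier R" using ab ideal.Icarr[OF V] by auto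
    have "u \<noteq> \<zero>"
    proof
      assume "u = \<zero>"
      then have "a = \<zero>" "b = \<zero>" using ab c by simp_all
      then show False
        using snoc.prems(6) idl2_eq_PIdl[of \<zero> \<zero>] cgenideal_self[of \<zero>] zero_closed
        unfolding principal2_def by blast
    qed
    \<comment> \<open>Cancelling \<open>u\<close> turns the generators of \<open>idl2 a b\<close>
      into generators of \<open>?V\<close>.\<close>
    have "?V \<subseteq> idl2 a' b'"
    proof
      fix v assume v: "v \<in> ?V"
      then have "u \<otimes> v \<in> idl2 a b" using 1 by auto
      then obtain r s where rs: "r \<in> carrier R" "s \<in> carrier R" "u \<otimes> v = a \<otimes> r \<oplus> b \<otimes> s"
        by (auto simp: idl2_def)
      then have "u \<otimes> v = u \<otimes> (a' \<otimes> r \<oplus> b' \<otimes> s)"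
        using ab c u by (simp add: r_distr m_assoc)
      then have "v = a' \<otimes> r \<oplus> b' \<otimes> s"
        using rs c u v \<open>u \<noteq> \<zero>\<close> ideal.Icarr[OF V v] by (simp add: m_lcancel)
      then show "v \<in> idl2 a' b'" using rs by (simp add: mem_idl2)
    qed
    then have "idl2 a' b' = ?V" using idl2_minimal[OF V] ab by blast
    moreover have "\<not> principal2 a' b'" using principal2_scale[OF u c] ab snoc.prems(6) by blast
    ultimately obtain g Q where g: "g \<in> carrier R" "Q \<in> set Qs" "?V = (\<otimes>) g ` Q"
      using snoc.IH[OF snoc.prems(1) _ c] snoc.prems(2) by auto
    have "(\<otimes>) u ` (\<otimes>) g ` Q = (\<otimes>) (u \<otimes> g) ` Q"
      using g u snoc.prems(2) ideal.Icarr[of Q R] unfolding image_image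
      by (intro image_cong) (auto simp: m_assoc)
    then show ?thesis using 1 g u by (intro bexI[of _ "u \<otimes> g"] bexI[of _ Q]) auto
  next
    case 2
    then show ?thesis using ideal.Icarr[OF V] by auto
  qed
qed

text \<open>The zero ideal and the whole ring are principal, so the factorization axiom applies to
  \<open>idl2 a b\<close>.\<close>

lemma idl2_eq_radical:
  assumes c: "a \<in> carrier R" "b \<in> carrier R" and np: "\<not> principal2 a b"
  shows "\<exists>g\<in>carrier R. \<exists>Q. radical_ideal R Q \<and> Q \<noteq> carrier R \<and> idl2 a b = (\<otimes>) g ` Q"
proof -
  have "idl2 a b \<noteq> {\<zero>}" using np PIdl_zero zero_closed unfolding principal2_def by metis
  moreover have "PIdl \<one> = carrier R"
    using cgenideal_ideal cgenideal_self by (intro ideal.one_imp_carrier) auto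
  then have "idl2 a b \<noteq> carrier R" using np one_closed unfolding principal2_def by metis
  ultimately obtain z Qs where "z \<in> carrier R" "\<forall>Q\<in>set Qs. radical_ideal R Q \<and> Q \<noteq> carrier R"
    "idl2 a b = foldl (ideal_prod R) (PIdl z) Qs"
    using factorization[OF idl2_ideal[OF c]] by blast
  with idl2_eq_foldl_prod[of z Qs a b] c np show ?thesis
    by (metis radical_ideal_ideal)
qed

text \<open>A factor of a nonzero principal ideal is invertible, hence principal over a local
  domain. Concretely, some product \<open>v \<otimes> u\<close> is a unit multiple of
  \<open>x\<close>; every \<open>v \<otimes> w\<close> is then a multiple of
  \<open>v \<otimes> u\<close>, and \<open>v\<close> can be cancelled.\<close>

lemma prod_eq_PIdl:
  assumes I: "ideal V R" "ideal U R" and x: "x \<in> carrier R" "x \<noteq> \<zero>" and e: "V \<cdot> U = PIdl x"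
  shows "\<exists>u\<in>U. U = PIdl u"
proof -
  note UV = ideal.Icarr[OF I(1)] ideal.Icarr[OF I(2)]
  \<comment> \<open>With second generator \<open>\<zero>\<close>, only the multiples of
    \<open>x\<close> by nonunits remain.\<close>
  let ?I = "{x \<otimes> m \<oplus> \<zero> \<otimes> s | m s. m \<in> carrier R - Units R \<and> s \<in> carrier R}"
  have "\<exists>v\<in>V. \<exists>u\<in>U. v \<otimes> u \<notin> ?I"
  proof (rule ccontr)
    assume "\<not> ?thesis"
    then have "V \<cdot> U \<subseteq> ?I"
      using ideal_prod_minimal[OF nonunit_combination_ideal[OF x(1) zero_closed]] by blast
    then obtain m where "m \<in> carrier R" "m \<notin> Units R" "x = x \<otimes> m"
      using e x cgenideal_self[of x] by auto
    then show False using m_lcancel[of x m \<one>] x by simp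
  qed
  then obtain v u where vu: "v \<in> V" "u \<in> U" "v \<otimes> u \<notin> ?I" by blast
  have "v \<otimes> u \<in> PIdl x" using e vu ideal_prod.prod[of v V u U R] by auto
  then obtain c where c: "c \<in> carrier R" "v \<otimes> u = x \<otimes> c" using x by (auto simp: mem_PIdl_iff)
  have cU: "c \<in> Units R"
  proof (rule ccontr)
    assume "c \<notin> Units R"
    moreover have "v \<otimes> u = x \<otimes> c \<oplus> \<zero> \<otimes> \<one>" using c x by simp
    ultimately show False using vu(3) c(1) by blast
  qed
  have car: "u \<in> carrier R" "v \<in> carrier R" using vu UV by auto
  have "v \<noteq> \<zero>"
    using c cU x car integral_iff[of x c] zero_not_one by (auto simp: Units_def)
  have "U \<subseteq> PIdl u"
  proof
    fix w assume w: "w \<in> U"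
    then have wc: "w \<in> carrier R" using UV by auto
    have "v \<otimes> w \<in> PIdl x" using e vu w ideal_prod.prod[of v V w U R] by auto
    then obtain d where d: "d \<in> carrier R" "v \<otimes> w = x \<otimes> d" using x by (auto simp: mem_PIdl_iff)
    have "v \<otimes> (w \<otimes> c) = (v \<otimes> w) \<otimes> c" using car wc c by (simp add: m_assoc)
    also have "\<dots> = (v \<otimes> u) \<otimes> d" using c d x by (simp add: m_ac)
    also have "\<dots> = v \<otimes> (u \<otimes> d)" using car d by (simp add: m_assoc)
    finally have "w \<otimes> c = u \<otimes> d" using \<open>v \<noteq> \<zero>\<close> car wc c d by (simp add: m_lcancel)
    then have "w \<otimes> c \<in> PIdl u" using car d by (auto simp: mem_PIdl_iff)
    then show "w \<in> PIdl u" using mult_unit_PIdl wc cU car by blast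
  qed
  then show ?thesis using cgenideal_minimal[OF I(2) vu(2)] vu by auto
qed

text \<open>This makes \<open>PIdl q\<close> a nonzero proper radical ideal. Squares suffice: if a
  power of \<open>a\<close> with exponent at least 2 lies in an ideal, then so does the square of a
  lower power.\<close>

definition radical_elt :: "'a \<Rightarrow> bool" where
  "radical_elt q \<longleftrightarrow> q \<in> carrier R \<and> q \<noteq> \<zero> \<and> q \<notin> Units R
    \<and> (\<forall>a\<in>carrier R. a \<otimes> a \<in> PIdl q \<longrightarrow> a \<in> PIdl q)"

lemma radical_elt_square: "radical_elt q \<Longrightarrow> a \<in> carrier R \<Longrightarrow> a \<otimes> a \<in> PIdl q \<Longrightarrow> a \<in> PIdl q"
  unfolding radical_elt_def by blast

lemma radical_eltD:
  assumes "radical_elt q"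
  shows "q \<in> carrier R" "q \<noteq> \<zero>" "q \<notin> Units R"
  using assms unfolding radical_elt_def by blast+

text \<open>A factorization of \<open>PIdl x\<close> has at least one radical factor. The last one
  divides a principal ideal, so it is principal by \<open>prod_eq_PIdl\<close>, and its generator is
  the desired element.\<close>

lemma ex_radical_elt:
  assumes x: "x \<in> carrier R" "x \<noteq> \<zero>" "x \<notin> Units R"
  shows "\<exists>q. radical_elt q"
proof -
  have "PIdl x \<noteq> {\<zero>}" using cgenideal_self[of x] x by auto
  moreover have "PIdl x \<noteq> carrier R"
  proof
    assume "PIdl x = carrier R"
    then obtain r where "r \<in> carrier R" "\<one> = x \<otimes> r" using x by (metis mem_PIdl_iff one_closed)
    then show False using x unit_factor[of x r] Units_one_closed by metis
  qed
  ultimately obtain z Qs where z: "z \<in> carrier R" "Qs \<noteq> []"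
    "\<forall>Q\<in>set Qs. radical_ideal R Q \<and> Q \<noteq> carrier R" "PIdl x = foldl (ideal_prod R) (PIdl z) Qs"
    using factorization[OF cgenideal_ideal[OF x(1)]] by blast
  obtain Qs' U where Qs: "Qs = Qs' @ [U]" using z(2) by (metis append_butlast_last_id)
  let ?V = "foldl (ideal_prod R) (PIdl z) Qs'"
  have U: "radical_ideal R U" "U \<noteq> carrier R" "ideal U R"
    using z Qs radical_ideal_ideal by auto
  have V: "ideal ?V R"
    using z Qs radical_ideal_ideal cgenideal_ideal by (intro foldl_ideal_prod_ideal) auto
  have e: "?V \<cdot> U = PIdl x" using z Qs by simp
  then obtain q where q: "q \<in> U" "U = PIdl q" using prod_eq_PIdl[OF V U(3) x(1,2)] by blast
  have qc: "q \<in> carrier R" using q ideal.Icarr[OF U(3)] by blast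
  have "q \<noteq> \<zero>"
    using e q(2) ideal_prod_zero[OF V] \<open>PIdl x \<noteq> {\<zero>}\<close> by (auto simp: PIdl_zero)
  moreover have "q \<notin> Units R" using ideal_unit_eq_carrier U q by blast
  ultimately show ?thesis
    using qc radical_ideal_square[OF U(1)] q(2) unfolding radical_elt_def by blast
qed

text \<open>If \<open>a\<close> divides the square of \<open>c\<close>, then
  \<open>a \<otimes> b\<close> divides the square of \<open>c \<otimes> b\<close>, hence
  \<open>c \<otimes> b\<close> itself, and \<open>b\<close> can be cancelled.\<close>

lemma radical_elt_factor:
  assumes "radical_elt (a \<otimes> b)" "a \<in> carrier R" "b \<in> carrier R" "a \<notin> Units R"
  shows "radical_elt a"
proof -
  have "a \<otimes> b \<noteq> \<zero>" using assms(1) radical_eltD by blast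
  then have nz: "a \<noteq> \<zero>" "b \<noteq> \<zero>" using assms(2,3) by auto
  have "c \<in> PIdl a" if c: "c \<in> carrier R" "c \<otimes> c \<in> PIdl a" for c
  proof -
    obtain r where r: "r \<in> carrier R" "c \<otimes> c = a \<otimes> r" using c(1) assms(2) c(2) by (auto simp: mem_PIdl_iff)
    have "(c \<otimes> b) \<otimes> (c \<otimes> b) = (c \<otimes> c) \<otimes> (b \<otimes> b)" using c assms(2,3) by (simp add: m_ac)
    also have "\<dots> = (a \<otimes> b) \<otimes> (r \<otimes> b)" using r assms(2,3) by (simp add: m_ac)
    finally have "(c \<otimes> b) \<otimes> (c \<otimes> b) \<in> PIdl (a \<otimes> b)" using assms(2,3) r by (auto simp: mem_PIdl_iff)
    then have "c \<otimes> b \<in> PIdl (a \<otimes> b)" using radical_elt_square[OF assms(1)] assms(3) c by blast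
    then obtain s where s: "s \<in> carrier R" "c \<otimes> b = (a \<otimes> b) \<otimes> s" using assms(2,3) by (auto simp: mem_PIdl_iff)
    then have "b \<otimes> c = b \<otimes> (a \<otimes> s)" using assms(2,3) c by (simp add: m_ac)
    then have "c = a \<otimes> s" using nz assms(2,3) c s by (simp add: m_lcancel)
    then show ?thesis using s assms(2,3) by (auto simp: mem_PIdl_iff)
  qed
  then show ?thesis using assms(2,4) nz unfolding radical_elt_def by blast
qed

text \<open>The square of \<open>y \<otimes> r\<close> is divisible by
  \<open>y \<otimes> y \<otimes> r\<close>, hence so is \<open>y \<otimes> r\<close>, and cancelling
  it leaves an inverse of \<open>y\<close>.\<close>

lemma radical_elt_squarefree:
  assumes "radical_elt (y \<otimes> y \<otimes> r)" "y \<in> carrier R" "r \<in> carrier R"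
  shows "y \<in> Units R"
proof -
  let ?q = "y \<otimes> y \<otimes> r"
  have "?q \<noteq> \<zero>" using assms(1) radical_eltD by blast
  then have nz: "y \<noteq> \<zero>" "r \<noteq> \<zero>" using assms(2,3) by auto
  have "(y \<otimes> r) \<otimes> (y \<otimes> r) = ?q \<otimes> r" using assms(2,3) by (simp add: m_ac)
  then have "(y \<otimes> r) \<otimes> (y \<otimes> r) \<in> PIdl ?q" using assms(2,3) by (auto simp: mem_PIdl_iff)
  then have "y \<otimes> r \<in> PIdl ?q" using radical_elt_square[OF assms(1)] assms(2,3) by blast
  then obtain s where s: "s \<in> carrier R" "y \<otimes> r = ?q \<otimes> s" using assms(2,3) by (auto simp: mem_PIdl_iff)
  have "(y \<otimes> r) \<otimes> (y \<otimes> s) = ?q \<otimes> s" using assms(2,3) s(1) by (simp add: m_ac)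
  then have "(y \<otimes> r) \<otimes> (y \<otimes> s) = (y \<otimes> r) \<otimes> \<one>" unfolding s(2)[symmetric] using assms(2,3) by simp
  moreover have "y \<otimes> r \<noteq> \<zero>" using nz assms(2,3) by (simp add: integral_iff)
  ultimately have "y \<otimes> s = \<one>" using m_lcancel[of "y \<otimes> r" "y \<otimes> s" \<one>] assms(2,3) s(1) by simp
  then show ?thesis using assms(2) s(1) unit_factor[of y s] by simp
qed

text \<open>With \<open>a = d t\<close>, \<open>b = d w\<close> and \<open>d = a r + b s\<close>,
  cancelling \<open>d\<close> gives \<open>t r + w s = 1\<close>. Locality makes \<open>t\<close> or
  \<open>w\<close> a unit, so \<open>a\<close> or \<open>b\<close> generates the ideal.\<close>

lemma principal2_comparable:
  assumes c: "a \<in> carrier R" "b \<in> carrier R" and "principal2 a b"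
  shows "a \<in> PIdl b \<or> b \<in> PIdl a"
proof -
  obtain d where d: "d \<in> carrier R" "idl2 a b = PIdl d" using assms by (auto simp: principal2_def)
  show ?thesis
  proof (cases "d = \<zero>")
    case True
    then show ?thesis using d idl2_self[OF c] c cgenideal_self by (auto simp: PIdl_zero)
  next
    case False
    obtain r s where rs: "r \<in> carrier R" "s \<in> carrier R" "d = a \<otimes> r \<oplus> b \<otimes> s"
      using cgenideal_self[OF d(1)] unfolding d(2)[symmetric] by (auto simp: idl2_def)
    obtain t w where tw: "t \<in> carrier R" "w \<in> carrier R" "a = d \<otimes> t" "b = d \<otimes> w"
      using idl2_self[OF c] d by (auto simp: mem_PIdl_iff)
    have "d \<otimes> (t \<otimes> r \<oplus> w \<otimes> s) = d \<otimes> t \<otimes> r \<oplus> d \<otimes> w \<otimes> s"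
      using d(1) rs(1,2) tw(1,2) by (simp add: r_distr m_assoc)
    also have "\<dots> = d \<otimes> \<one>" unfolding tw(3,4)[symmetric] rs(3)[symmetric] using d(1) by simp
    finally have "t \<otimes> r \<oplus> w \<otimes> s = \<one>" using m_lcancel[of d "t \<otimes> r \<oplus> w \<otimes> s" \<one>] d(1) rs(1,2) tw(1,2) False by simp
    then have "t \<otimes> r \<in> Units R \<or> w \<otimes> s \<in> Units R" using add_Units rs(1,2) tw(1,2) by simp
    then have "t \<in> Units R \<or> w \<in> Units R" using nonunit_mult rs(1,2) tw(1,2) by blast
    moreover have "d \<in> PIdl a" if "t \<in> Units R"
      using mult_unit_PIdl[OF d(1) that _ c(1)] cgenideal_self[OF c(1)] unfolding tw(3)[symmetric] by blast
    moreover have "d \<in> PIdl b" if "w \<in> Units R"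
      using mult_unit_PIdl[OF d(1) that _ c(2)] cgenideal_self[OF c(2)] unfolding tw(4)[symmetric] by blast
    moreover have "d \<in> PIdl x \<Longrightarrow> d \<otimes> k \<in> PIdl x" if "k \<in> carrier R" "x \<in> carrier R" for x k
      using ideal.I_r_closed[OF cgenideal_ideal] that by blast
    ultimately show ?thesis using tw c by metis
  qed
qed

text \<open>\<open>main\<close> excludes that \<open>q\<close> and \<open>y\<close> are
  incomparable, by inspecting the ideal \<open>(q, y^2)\<close>. What remains is
  \<open>q = y \<otimes> r\<close> with \<open>r\<close> a nonunit; as \<open>q\<close> is
  squarefree, \<open>r\<close> and \<open>y\<close> are incomparable, and \<open>main\<close>
  applies to \<open>r\<close> in place of \<open>q\<close>.\<close>

lemma radical_elt_dvd:
  assumes q: "radical_elt q" and y: "y \<in> carrier R" "y \<notin> Units R"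
  shows "y \<in> PIdl q"
proof -
  have main: False if q: "radical_elt q" and nqy: "y \<notin> PIdl q" and nyq: "q \<notin> PIdl y" for q
  proof -
    have qc: "q \<in> carrier R" "q \<noteq> \<zero>" using radical_eltD[OF q] by blast+
    \<comment> \<open>A principal ideal would make \<open>q\<close> and \<open>y \<otimes> y\<close>
      comparable, against squarefreeness of \<open>q\<close> or against
      \<open>y \<notin> PIdl q\<close>.\<close>
    have np: "\<not> principal2 q (y \<otimes> y)"
    proof
      assume "principal2 q (y \<otimes> y)"
      then consider "q \<in> PIdl (y \<otimes> y)" | "y \<otimes> y \<in> PIdl q"
        using principal2_comparable qc y by blast
      then show False
      proof cases
        case 1
        then obtain r where "r \<in> carrier R" "q = y \<otimes> y \<otimes> r" using y by (auto simp: mem_PIdl_iff)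
        then show False using radical_elt_squarefree[of y r] q y by blast
      next
        case 2
        then show False using radical_elt_square[OF q] y nqy by blast
      qed
    qed
    obtain g Q where g: "g \<in> carrier R" and Q: "radical_ideal R Q" and e: "idl2 q (y \<otimes> y) = (\<otimes>) g ` Q"
      using idl2_eq_radical[of q "y \<otimes> y"] np qc y by auto
    note Qi = radical_ideal_ideal[OF Q]
    obtain q' where q': "q' \<in> Q" "q = g \<otimes> q'" using idl2_self(1)[of q "y \<otimes> y"] e qc y by auto
    obtain w where w: "w \<in> Q" "y \<otimes> y = g \<otimes> w" using idl2_self(2)[of q "y \<otimes> y"] e qc y by auto
    have c: "q' \<in> carrier R" "w \<in> carrier R" using q' w ideal.Icarr[OF Qi] by auto
    \<comment> \<open>\<open>g\<close> divides the radical element \<open>q\<close>, so it is a unit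
      or itself a radical element; either way it divides \<open>y\<close>.\<close>
    have "y \<otimes> y \<in> PIdl g" using w g c by (auto simp: mem_PIdl_iff)
    moreover have "y \<in> PIdl g" if "g \<in> Units R"
      using ideal_unit_eq_carrier[OF cgenideal_ideal[OF g] cgenideal_self[OF g] that] y by simp
    ultimately have "y \<in> PIdl g"
      using radical_elt_factor[of g q'] radical_elt_square[of g y] q q' g c y by blast
    then obtain y' where y': "y' \<in> carrier R" "y = g \<otimes> y'" using g by (auto simp: mem_PIdl_iff)
    have nz: "g \<noteq> \<zero>" using q'(2) qc c by auto
    have y'U: "y' \<notin> Units R"
    proof
      assume u: "y' \<in> Units R"
      have "g \<otimes> y' \<in> PIdl y" unfolding y'(2)[symmetric] by (rule cgenideal_self[OF y(1)])
      then have "g \<in> PIdl y" using mult_unit_PIdl[OF g u] y by simp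
      then show False
        using nyq q' c ideal.I_r_closed[OF cgenideal_ideal[OF y(1)]] by auto
    qed
    have "g \<otimes> w = (g \<otimes> y') \<otimes> y" unfolding y'(2)[symmetric] by (simp add: w(2))
    also have "\<dots> = g \<otimes> (y' \<otimes> y)" using y'(1) g y by (simp add: m_assoc)
    finally have "g \<otimes> w = g \<otimes> (y' \<otimes> y)" .
    then have w': "w = y' \<otimes> y" using nz g c y(1) y'(1) by (simp add: m_lcancel)
    \<comment> \<open>Radicality of \<open>Q\<close> enters here: the square of \<open>y\<close> is
      a multiple of \<open>w \<in> Q\<close>, so \<open>y \<in> Q\<close>, and therefore
      \<open>g \<otimes> y\<close> lies in \<open>(q, y^2)\<close>.\<close>
    have "y \<otimes> y = w \<otimes> g" using w c g by (simp add: m_comm)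
    then have "y \<in> Q"
      using radical_ideal_square[OF Q y(1)] ideal.I_r_closed[OF Qi w(1) g] by simp
    then have "g \<otimes> y \<in> idl2 q (y \<otimes> y)" using e by auto
    then obtain a b where ab: "a \<in> carrier R" "b \<in> carrier R" "g \<otimes> y = q \<otimes> a \<oplus> y \<otimes> y \<otimes> b"
      by (auto simp: idl2_def)
    have "y \<otimes> y \<otimes> b = g \<otimes> (y \<otimes> (y' \<otimes> b))"
      unfolding w(2) w' using g y(1) y'(1) ab(2) by (simp add: m_ac)
    then have "g \<otimes> y = g \<otimes> q' \<otimes> a \<oplus> g \<otimes> (y \<otimes> (y' \<otimes> b))"
      unfolding q'(2)[symmetric] using ab(3) by simp
    also have "\<dots> = g \<otimes> (y \<otimes> (y' \<otimes> b) \<oplus> q' \<otimes> a)"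
      using ab(1,2) c g y(1) y'(1) by (simp add: r_distr m_assoc a_comm)
    finally have "y = y \<otimes> (y' \<otimes> b) \<oplus> q' \<otimes> a"
      using nz g c y(1) y'(1) ab(1,2) m_lcancel[of g y "y \<otimes> (y' \<otimes> b) \<oplus> q' \<otimes> a"] by simp
    \<comment> \<open>After division by \<open>g\<close>, \<open>y\<close> recurs on the right with
      the nonunit coefficient \<open>y' \<otimes> b\<close>, so it can be absorbed.\<close>
    then have "y \<in> PIdl q'"
      using mem_PIdl_if_absorb[of y q' "y' \<otimes> b" a] nonunit_mult[of y' b] y'U y(1) y'(1) c ab(1,2) m_closed by blast
    then obtain d where d: "d \<in> carrier R" "y = q' \<otimes> d" using c by (auto simp: mem_PIdl_iff)
    have "y \<otimes> y = (q' \<otimes> d) \<otimes> (g \<otimes> y')" by (simp flip: d(2) y'(2))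
    also have "\<dots> = q \<otimes> (d \<otimes> y')" unfolding q'(2) using c d(1) g y'(1) by (simp add: m_ac)
    finally have "y \<otimes> y \<in> PIdl q" using qc d(1) y'(1) by (auto simp: mem_PIdl_iff)
    then show False using radical_elt_square[OF q] y nqy by blast
  qed
  show ?thesis
  proof (rule ccontr)
    assume neg: "y \<notin> PIdl q"
    have qc: "q \<in> carrier R" "q \<noteq> \<zero>" using radical_eltD[OF q] by blast+
    have "q \<in> PIdl y" using main[OF q neg] by blast
    then obtain r where r: "r \<in> carrier R" "q = y \<otimes> r" using y by (auto simp: mem_PIdl_iff)
    have "r \<notin> Units R"
    proof
      assume "r \<in> Units R"
      then have "y \<in> PIdl q"
        using mult_unit_PIdl[OF y(1)] r qc cgenideal_self by simp
      then show False using neg by blast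
    qed
    then have rr: "radical_elt r"
      using radical_elt_factor[of r y] q r y m_comm by simp
    have "r \<notin> PIdl y"
    proof
      assume "r \<in> PIdl y"
      then obtain t where "t \<in> carrier R" "r = y \<otimes> t" using y by (auto simp: mem_PIdl_iff)
      then show False using radical_elt_squarefree[of y t] q y r by (simp add: m_assoc)
    qed
    moreover have "y \<notin> PIdl r"
    proof
      assume "y \<in> PIdl r"
      then obtain s where s: "s \<in> carrier R" "y = r \<otimes> s" using r by (auto simp: mem_PIdl_iff)
      then have "q = r \<otimes> r \<otimes> s" using r by (simp add: m_ac)
      then show False using radical_elt_squarefree[of r s] q r s \<open>r \<notin> Units R\<close> by simp
    qed
    ultimately show False using main[OF rr] by blast
  qed
qed

text \<open>A nonprincipal \<open>(x, y)\<close> equals \<open>gQ\<close> with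
  \<open>Q = (a, b)\<close> radical. The generator \<open>q\<close> of the maximal ideal is not in
  \<open>Q\<close>, which forces \<open>Q = qQ\<close>; Nakayama's lemma then makes
  \<open>(a, b)\<close> principal.\<close>

theorem local_factorization_comparable:
  assumes x: "x \<in> carrier R" "y \<in> carrier R"
  shows "x \<in> PIdl y \<or> y \<in> PIdl x"
proof (rule principal2_comparable[OF x], rule ccontr)
  assume np: "\<not> principal2 x y"
  obtain g Q where g: "g \<in> carrier R" and Q: "radical_ideal R Q" "Q \<noteq> carrier R"
    and e: "idl2 x y = (\<otimes>) g ` Q"
    using idl2_eq_radical[OF x np] by blast
  note Qi = radical_ideal_ideal[OF Q(1)]
  obtain a b where ab: "a \<in> Q" "x = g \<otimes> a" "b \<in> Q" "y = g \<otimes> b"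
    using idl2_self[OF x] e by auto
  have c: "a \<in> carrier R" "b \<in> carrier R" using ab ideal.Icarr[OF Qi] by auto
  have np': "\<not> principal2 a b" using principal2_scale[OF g c] np ab by blast
  have "g \<noteq> \<zero>"
  proof
    assume "g = \<zero>"
    then have "x = \<zero>" "y = \<zero>" using ab c by auto
    then show False
      using np idl2_eq_PIdl[of \<zero> \<zero>] cgenideal_self[of \<zero>] zero_closed
      unfolding principal2_def by blast
  qed
  have Qab: "Q = idl2 a b"
  proof (rule subset_antisym)
    show "idl2 a b \<subseteq> Q" using idl2_minimal[OF Qi] ab by blast
    show "Q \<subseteq> idl2 a b"
    proof
      fix v assume v: "v \<in> Q"
      then have "g \<otimes> v \<in> idl2 x y" using e by auto
      then obtain r s where rs: "r \<in> carrier R" "s \<in> carrier R" "g \<otimes> v = x \<otimes> r \<oplus> y \<otimes> s"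
        by (auto simp: idl2_def)
      then have "g \<otimes> v = g \<otimes> (a \<otimes> r \<oplus> b \<otimes> s)"
        using ab c g by (simp add: r_distr m_assoc)
      then have "v = a \<otimes> r \<oplus> b \<otimes> s"
        using rs c g v \<open>g \<noteq> \<zero>\<close> ideal.Icarr[OF Qi v] by (simp add: m_lcancel)
      then show "v \<in> idl2 a b" using rs by (simp add: mem_idl2)
    qed
  qed
  have nu: "z \<notin> Units R" if "z \<in> Q" for z using that ideal_unit_eq_carrier Q Qi by blast
  have "a \<noteq> \<zero>"
  proof
    assume "a = \<zero>"
    then have "idl2 a b = PIdl b"
      using c idl2_commute[of a b] idl2_eq_PIdl[of b a] ideal_zero[OF cgenideal_ideal] by simp
    then show False using np' c by (auto simp: principal2_def)
  qed
  then obtain q where q: "radical_elt q" using ex_radical_elt[of a] nu ab c by blast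
  have qc: "q \<in> carrier R" "q \<notin> Units R" using radical_eltD[OF q] by blast+
  have sub: "z \<in> PIdl q" if "z \<in> Q" for z
    using radical_elt_dvd[OF q] nu that ideal.Icarr[OF Qi] by blast
  have "q \<notin> Q"
  proof
    assume "q \<in> Q"
    then have "Q = PIdl q" using sub cgenideal_minimal[OF Qi] by blast
    then show False using Qab np' qc by (auto simp: principal2_def)
  qed
  \<comment> \<open>The quotient \<open>d\<close> of \<open>z\<close> by \<open>q\<close> is a
    nonunit because \<open>q \<notin> Q\<close>, so \<open>q\<close> divides it once more. Hence
    \<open>d \<otimes> d\<close> is a multiple of \<open>z\<close>, and radicality puts
    \<open>d\<close> into \<open>Q\<close>.\<close>
  have divQ: "\<exists>d\<in>Q. z = q \<otimes> d" if z: "z \<in> Q" for z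
  proof -
    obtain d where d: "d \<in> carrier R" "z = q \<otimes> d" using sub[OF z] qc by (auto simp: mem_PIdl_iff)
    have "d \<notin> Units R"
    proof
      assume "d \<in> Units R"
      then have "q \<otimes> d \<otimes> inv d \<in> Q" using ideal.I_r_closed[OF Qi z] d by simp
      then show False using \<open>q \<notin> Q\<close> \<open>d \<in> Units R\<close> qc d by (simp add: m_assoc)
    qed
    then obtain f where f: "f \<in> carrier R" "d = q \<otimes> f"
      using radical_elt_dvd[OF q d(1)] qc by (auto simp: mem_PIdl_iff)
    have "d \<otimes> d = z \<otimes> f" using d f qc by (simp add: m_ac)
    then have "d \<in> Q"
      using radical_ideal_square[OF Q(1) d(1)] ideal.I_r_closed[OF Qi z f(1)] by simp
    then show ?thesis using d by blast
  qed
  obtain d where d: "d \<in> Q" "a = q \<otimes> d" using divQ ab by blast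
  then obtain r s where rs: "r \<in> carrier R" "s \<in> carrier R" "d = a \<otimes> r \<oplus> b \<otimes> s"
    unfolding Qab by (auto simp: idl2_def)
  have "q \<otimes> (a \<otimes> r \<oplus> b \<otimes> s) = a \<otimes> (q \<otimes> r) \<oplus> b \<otimes> (q \<otimes> s)"
    using qc c rs(1,2) by (simp add: r_distr m_lcomm)
  then have "a = a \<otimes> (q \<otimes> r) \<oplus> b \<otimes> (q \<otimes> s)"
    unfolding rs(3)[symmetric] d(2)[symmetric] .
  then have "a \<in> PIdl b"
    using mem_PIdl_if_absorb[of a b "q \<otimes> r" "q \<otimes> s"] nonunit_mult[of q r] qc c rs(1,2) m_closed by blast
  then show False
    using np' c idl2_eq_PIdl[of b a] idl2_commute[of a b] by (auto simp: principal2_def)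
qed

theorem local_factorization_generator:
  assumes "x \<in> carrier R" "x \<noteq> \<zero>" "x \<notin> Units R"
  shows "\<exists>q\<in>carrier R. q \<noteq> \<zero> \<and> q \<notin> Units R \<and> (\<forall>y\<in>carrier R - Units R. y \<in> PIdl q)"
  using ex_radical_elt[OF assms] radical_elt_dvd unfolding radical_elt_def by blast

end

section \<open>Invertible and saturated ideals\<close>

text \<open>Zorn's lemma: the union of a chain of proper ideals is proper because it avoids
  \<open>\<one>\<close>.\<close>

lemma (in cring) ex_maximalideal:
  assumes "ideal I R" "I \<noteq> carrier R"
  shows "\<exists>M. maximalideal M R \<and> I \<subseteq> M"
proof -
  let ?A = "{J. ideal J R \<and> J \<noteq> carrier R \<and> I \<subseteq> J}"
  have "\<exists>M\<in>?A. \<forall>X\<in>?A. M \<subseteq> X \<longrightarrow> X = M"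
  proof (rule subset_Zorn_nonempty)
    show "?A \<noteq> {}" using assms by blast
    fix C assume C: "C \<noteq> {}" "subset.chain ?A C"
    have mem: "ideal J R" "J \<noteq> carrier R" "I \<subseteq> J" if "J \<in> C" for J
      using C that by (auto simp: subset.chain_def)
    have lin: "X \<subseteq> Y \<or> Y \<subseteq> X" if "X \<in> C" "Y \<in> C" for X Y
      using C(2) that by (auto simp: subset.chain_def)
    have "ideal (\<Union>C) R"
    proof (rule ideal_of_closed)
      show "\<Union>C \<subseteq> carrier R" using mem(1) by (auto dest: ideal.Icarr)
      show "\<zero> \<in> \<Union>C" using C(1) mem(1) by (auto dest: ideal_zero)
      show "x \<otimes> r \<in> \<Union>C" if "x \<in> \<Union>C" "r \<in> carrier R" for x r
        using that mem(1) by (auto dest: ideal.I_r_closed)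
      show "x \<oplus> y \<in> \<Union>C" if xy: "x \<in> \<Union>C" "y \<in> \<Union>C" for x y
      proof -
        obtain X Y where XY: "X \<in> C" "x \<in> X" "Y \<in> C" "y \<in> Y" using xy by blast
        then obtain Z where "Z \<in> C" "x \<in> Z" "y \<in> Z" using lin[OF XY(1,3)] by blast
        then show ?thesis using ideal_add_closed[OF mem(1)] by blast
      qed
    qed
    moreover have "\<one> \<notin> \<Union>C" using mem(1,2) by (auto dest: ideal.one_imp_carrier)
    moreover have "I \<subseteq> \<Union>C" using C(1) mem(3) by blast
    ultimately show "\<Union>C \<in> ?A" using one_closed by blast
  qed
  then obtain M where "M \<in> ?A" and max: "\<forall>X\<in>?A. M \<subseteq> X \<longrightarrow> X = M" ..
  then have M: "ideal M R" "M \<noteq> carrier R" "I \<subseteq> M" by simp_all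
  have "maximalideal M R"
  proof (rule maximalidealI[OF M(1)])
    show "carrier R \<noteq> M" using M(2) by simp
    fix X assume X: "ideal X R" "M \<subseteq> X"
    then have "I \<subseteq> X" using M(3) by simp
    then show "X = M \<or> X = carrier R" using max X by blast
  qed
  then show ?thesis using M by blast
qed

context "domain" begin

lemma quot_emb_eq_iff: "a \<in> carrier R \<Longrightarrow> b \<in> carrier R \<Longrightarrow> quot_emb R a = quot_emb R b \<longleftrightarrow> a = b"
  using inj_on_quot_emb by (auto simp: inj_on_def)

lemma quot_emb_mult:
  "a \<in> carrier R \<Longrightarrow> b \<in> carrier R \<Longrightarrow> quot_emb R (a \<otimes> b) = quot_emb R a \<otimes>\<^bsub>quot_field R\<^esub> quot_emb R b"
  by (rule ring_hom_mult[OF quot_emb_ring_hom])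

lemma quot_emb_add:
  "a \<in> carrier R \<Longrightarrow> b \<in> carrier R \<Longrightarrow> quot_emb R (a \<oplus> b) = quot_emb R a \<oplus>\<^bsub>quot_field R\<^esub> quot_emb R b"
  by (rule ring_hom_add[OF quot_emb_ring_hom])

lemma quot_emb_closed: "a \<in> carrier R \<Longrightarrow> quot_emb R a \<in> carrier (quot_field R)"
  by (rule ring_hom_closed[OF quot_emb_ring_hom])

lemma invertible_ideal_ideal: "invertible_ideal R J \<Longrightarrow> ideal J R"
  by (simp add: invertible_ideal_def)

text \<open>As the product of \<open>J\<close> and its inverse \<open>F\<close> is the whole ring,
  some \<open>j f\<close> is an element \<open>s\<close> outside \<open>P\<close>. Then
  \<open>s x = j (x f)\<close> with \<open>x f\<close> in the ring for all \<open>x\<close> in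
  \<open>J\<close>, so \<open>j\<close> generates \<open>J\<close> locally at \<open>P\<close> with
  one multiplier \<open>s\<close>.\<close>

lemma invertible_ideal_locally_principal:
  assumes J: "invertible_ideal R J" and P: "primeideal P R"
  shows "\<exists>j\<in>J. \<exists>s\<in>carrier R - P. \<forall>x\<in>J. s \<otimes> x \<in> PIdl j"
proof -
  let ?K = "quot_field R"
  interpret K: field ?K by (rule field_quot_field)
  interpret P: primeideal P R by (rule P)
  obtain F where F: "fractional_ideal R F" and e: "ideal_prod ?K (quot_emb R ` J) F = quot_emb R ` carrier R"
    using J by (auto simp: invertible_ideal_def)
  have Fc: "x \<in> carrier ?K" if "x \<in> F" for x
    using F that by (auto simp: fractional_ideal_def dest: additive_subgroup.a_Hcarr)
  have Jc: "x \<in> carrier R" if "x \<in> J" for x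
    using ideal.Icarr[OF invertible_ideal_ideal[OF J]] that by blast
  have prod: "\<exists>s\<in>carrier R. quot_emb R j \<otimes>\<^bsub>?K\<^esub> f = quot_emb R s" if "j \<in> J" "f \<in> F" for j f
  proof -
    have "quot_emb R j \<otimes>\<^bsub>?K\<^esub> f \<in> quot_emb R ` carrier R"
      unfolding e[symmetric] using that by (intro ideal_prod.prod) auto
    then show ?thesis by auto
  qed
  have "\<exists>j\<in>J. \<exists>f\<in>F. quot_emb R j \<otimes>\<^bsub>?K\<^esub> f \<notin> quot_emb R ` P"
  proof (rule ccontr)
    assume neg: "\<not> ?thesis"
    have "x \<in> quot_emb R ` P" if "x \<in> ideal_prod ?K (quot_emb R ` J) F" for x
      using that
    proof induction
      case (prod i j)
      then show ?case using neg by auto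
    next
      case (sum x y)
      then obtain a b where "a \<in> P" "b \<in> P" "x = quot_emb R a" "y = quot_emb R b" by auto
      then show ?case
        by (intro image_eqI[of _ _ "a \<oplus> b"]) (auto simp: quot_emb_add)
    qed
    then have "quot_emb R \<one> \<in> quot_emb R ` P" unfolding e by auto
    then have "\<one> \<in> P" using quot_emb_eq_iff P.Icarr by auto
    then show False using P.one_imp_carrier P.I_notcarr by blast
  qed
  then obtain j f where jf: "j \<in> J" "f \<in> F" "quot_emb R j \<otimes>\<^bsub>?K\<^esub> f \<notin> quot_emb R ` P" by blast
  then obtain s where s: "s \<in> carrier R" "quot_emb R j \<otimes>\<^bsub>?K\<^esub> f = quot_emb R s" using prod by blast
  have "s \<otimes> x \<in> PIdl j" if x: "x \<in> J" for x
  proof -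
    obtain c where c: "c \<in> carrier R" "quot_emb R x \<otimes>\<^bsub>?K\<^esub> f = quot_emb R c" using prod x jf by blast
    have "quot_emb R (s \<otimes> x) = (quot_emb R j \<otimes>\<^bsub>?K\<^esub> f) \<otimes>\<^bsub>?K\<^esub> quot_emb R x"
      using s x Jc by (simp add: quot_emb_mult)
    also have "\<dots> = quot_emb R j \<otimes>\<^bsub>?K\<^esub> (quot_emb R x \<otimes>\<^bsub>?K\<^esub> f)"
      using jf x Jc Fc quot_emb_closed by (simp add: K.m_ac)
    also have "\<dots> = quot_emb R (j \<otimes> c)" using c jf Jc by (simp add: quot_emb_mult)
    finally have "s \<otimes> x = j \<otimes> c" using s x c jf Jc quot_emb_eq_iff by simp
    then show ?thesis using c jf Jc by (auto simp: mem_PIdl_iff)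
  qed
  moreover have "s \<notin> P" using jf(3) s(2) by auto
  ultimately show ?thesis using s(1) jf(1) by blast
qed

text \<open>At a maximal ideal \<open>M\<close> above \<open>T\<close>, \<open>J\<close> is
  generated by \<open>j\<close> up to a multiplier \<open>s \<notin> M\<close>. Then
  \<open>s \<otimes> j\<close> is \<open>j\<close> times an element of \<open>T\<close>, and
  cancelling \<open>j\<close> puts \<open>s\<close> into \<open>T\<close>, hence into
  \<open>M\<close>.\<close>

lemma invertible_ideal_cancel:
  assumes J: "invertible_ideal R J" "J \<noteq> {\<zero>}" and T: "ideal T R" and sub: "J \<subseteq> J \<cdot> T"
  shows "T = carrier R"
proof (rule ccontr)
  assume "T \<noteq> carrier R"
  then obtain M where M: "maximalideal M R" "T \<subseteq> M" using ex_maximalideal T by blast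
  have P: "primeideal M R" using M maximalideal_prime by blast
  obtain j s where js: "j \<in> J" "s \<in> carrier R - M" "\<And>x. x \<in> J \<Longrightarrow> s \<otimes> x \<in> PIdl j"
    using invertible_ideal_locally_principal[OF J(1) P] by blast
  note Ji = invertible_ideal_ideal[OF J(1)]
  have c: "j \<in> carrier R" "s \<in> carrier R" using js ideal.Icarr[OF Ji] by auto
  have "s \<noteq> \<zero>" using js ideal_zero P by (auto simp: primeideal_def)
  have "j \<noteq> \<zero>"
  proof
    assume "j = \<zero>"
    then have "s \<otimes> x = \<zero>" if "x \<in> J" for x using js that by (simp add: PIdl_zero)
    then have "x = \<zero>" if "x \<in> J" for x
      using that \<open>s \<noteq> \<zero>\<close> ideal.Icarr[OF Ji that] c integral[of s x] by blast
    then show False using J(2) ideal_zero[OF Ji] by blast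
  qed
  have "J \<cdot> T \<subseteq> {x \<in> carrier R. s \<otimes> x \<in> (\<otimes>) j ` T}"
  proof (rule ideal_prod_minimal)
    show "ideal {x \<in> carrier R. s \<otimes> x \<in> (\<otimes>) j ` T} R"
      using ideal_colon ideal_image_mult T c by simp
    fix x t assume xt: "x \<in> J" "t \<in> T"
    have xt': "x \<in> carrier R" "t \<in> carrier R" using xt ideal.Icarr[OF Ji] ideal.Icarr[OF T] by auto
    obtain r where r: "r \<in> carrier R" "s \<otimes> x = j \<otimes> r" using js xt c by (auto simp: mem_PIdl_iff)
    have "s \<otimes> (x \<otimes> t) = (s \<otimes> x) \<otimes> t" using c xt' by (simp add: m_assoc)
    also have "\<dots> = j \<otimes> (r \<otimes> t)" unfolding r(2) using c r(1) xt' by (simp add: m_assoc)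
    finally show "x \<otimes> t \<in> {x \<in> carrier R. s \<otimes> x \<in> (\<otimes>) j ` T}"
      using xt' r ideal.I_l_closed[OF T xt(2)] by auto
  qed
  then obtain t where t: "t \<in> T" "s \<otimes> j = j \<otimes> t" using js(1) sub by auto
  then have "s = t"
    using c \<open>j \<noteq> \<zero>\<close> ideal.Icarr[OF T] m_comm[of s j] by (simp add: m_lcancel)
  then show False using t M js by blast
qed

text \<open>For a prime \<open>P\<close>, the ideals with this property are the contractions of
  ideals of the localization at \<open>P\<close>.\<close>

definition saturated :: "'a set \<Rightarrow> 'a set \<Rightarrow> bool" where
  "saturated P I \<longleftrightarrow> (\<forall>s\<in>carrier R - P. \<forall>a\<in>carrier R. s \<otimes> a \<in> I \<longrightarrow> a \<in> I)"

text \<open>Locally at \<open>P\<close>, a factor not contained in \<open>P\<close> is the unit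
  ideal. Each such factor contributes an element outside \<open>P\<close>, and the product of these
  elements is the uniform multiplier \<open>s\<close>.\<close>

lemma foldl_filter_prod:
  assumes P: "primeideal P R" and J: "ideal J R" and Qs: "\<forall>Q\<in>set Qs. ideal Q R"
  shows "foldl (ideal_prod R) J Qs \<subseteq> foldl (ideal_prod R) J (filter (\<lambda>Q. Q \<subseteq> P) Qs)
    \<and> (\<exists>s\<in>carrier R - P. \<forall>x\<in>foldl (ideal_prod R) J (filter (\<lambda>Q. Q \<subseteq> P) Qs). s \<otimes> x \<in> foldl (ideal_prod R) J Qs)"
  using Qs
proof (induction Qs rule: rev_induct)
  case Nil
  have "\<one> \<notin> P" using P ideal.one_imp_carrier primeideal.I_notcarr by (auto simp: primeideal_def)
  then show ?case using ideal.Icarr[OF J] by (auto intro!: bexI[of _ \<one>])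
next
  case (snoc Q Qs)
  let ?V = "foldl (ideal_prod R) J Qs" and ?V' = "foldl (ideal_prod R) J (filter (\<lambda>Q. Q \<subseteq> P) Qs)"
  have Q: "ideal Q R" using snoc.prems by simp
  have V: "ideal ?V R" "ideal ?V' R" using snoc.prems J by (auto intro!: foldl_ideal_prod_ideal)
  have VQ: "ideal (?V \<cdot> Q) R" "ideal (?V' \<cdot> Q) R" using V Q ideal_prod_is_ideal by auto
  obtain s where sub: "?V \<subseteq> ?V'" and s: "s \<in> carrier R - P" "\<And>x. x \<in> ?V' \<Longrightarrow> s \<otimes> x \<in> ?V"
    using snoc by auto
  show ?case
  proof (cases "Q \<subseteq> P")
    case True
    have "?V \<cdot> Q \<subseteq> ?V' \<cdot> Q"
      using sub by (intro ideal_prod_minimal[OF VQ(2)]) (auto intro: ideal_prod.prod)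
    moreover have "?V' \<cdot> Q \<subseteq> {x \<in> carrier R. s \<otimes> x \<in> ?V \<cdot> Q}"
    proof (rule ideal_prod_minimal)
      show "ideal {x \<in> carrier R. s \<otimes> x \<in> ?V \<cdot> Q} R" using ideal_colon[OF VQ(1)] s by blast
      fix x q assume x: "x \<in> ?V'" "q \<in> Q"
      have "x \<in> carrier R" "q \<in> carrier R" using x ideal.Icarr[OF V(2)] ideal.Icarr[OF Q] by auto
      moreover have "(s \<otimes> x) \<otimes> q \<in> ?V \<cdot> Q" using s x by (intro ideal_prod.prod) auto
      ultimately show "x \<otimes> q \<in> {x \<in> carrier R. s \<otimes> x \<in> ?V \<cdot> Q}" using s by (simp add: m_assoc)
    qed
    ultimately show ?thesis using s True by auto
  next
    case False
    then obtain q where q: "q \<in> Q" "q \<notin> P" by blast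
    have qc: "q \<in> carrier R" using q ideal.Icarr[OF Q] by blast
    have "s \<otimes> q \<in> carrier R - P"
      using s q qc primeideal.I_prime[OF P, of s q] by auto
    moreover have "(s \<otimes> q) \<otimes> x \<in> ?V \<cdot> Q" if x: "x \<in> ?V'" for x
    proof -
      have "(s \<otimes> x) \<otimes> q \<in> ?V \<cdot> Q" using s x q by (intro ideal_prod.prod) auto
      moreover have "(s \<otimes> x) \<otimes> q = (s \<otimes> q) \<otimes> x" using s qc ideal.Icarr[OF V(2) x] by (simp add: m_ac)
      ultimately show ?thesis by simp
    qed
    moreover have "?V \<cdot> Q \<subseteq> ?V'" using ideal_prod_inter[OF V(1) Q] sub by blast
    ultimately show ?thesis using False by auto
  qed
qed

end

text \<open>Dropping the factors that are not contained in \<open>P\<close> changes the product only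
  by a multiplier outside \<open>P\<close>, which saturation absorbs.\<close>

lemma (in isp_domain) saturated_factorization:
  assumes P: "primeideal P R" and I: "ideal I R" "I \<noteq> {\<zero>}" "I \<subseteq> P" "saturated P I"
  shows "\<exists>J Qs. invertible_ideal R J \<and> Qs \<noteq> [] \<and> (\<forall>Q\<in>set Qs. radical_ideal R Q \<and> Q \<subseteq> P)
    \<and> I = foldl (ideal_prod R) J Qs"
proof -
  have "I \<noteq> carrier R" using I P primeideal.I_notcarr by (metis primeideal.axioms(1) ideal.Icarr subsetI subset_antisym)
  then obtain J Qs where J: "invertible_ideal R J" "Qs \<noteq> []"
    and Qs: "\<forall>Q\<in>set Qs. radical_ideal R Q \<and> Q \<noteq> carrier R" and e: "I = foldl (ideal_prod R) J Qs"
    using isp_factorization[OF I(1,2)] by blast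
  note Ji = invertible_ideal_ideal[OF J(1)]
  have Qi: "\<forall>Q\<in>set Qs. ideal Q R" using Qs radical_ideal_ideal by blast
  let ?Qs = "filter (\<lambda>Q. Q \<subseteq> P) Qs"
  let ?V = "foldl (ideal_prod R) J ?Qs"
  obtain s where sub: "I \<subseteq> ?V" and s: "s \<in> carrier R - P" "\<And>x. x \<in> ?V \<Longrightarrow> s \<otimes> x \<in> I"
    using foldl_filter_prod[OF P Ji Qi] e by blast
  have V: "ideal ?V R" using Ji Qi by (intro foldl_ideal_prod_ideal) auto
  have "?V \<subseteq> I"
  proof
    fix x assume x: "x \<in> ?V"
    show "x \<in> I" using I(4) s(1) ideal.Icarr[OF V x] s(2)[OF x] unfolding saturated_def by blast
  qed
  then have eV: "I = ?V" using sub by blast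
  \<comment> \<open>If every factor were dropped, then \<open>I = J\<close>, while the original
    factorization has a proper last factor \<open>U\<close>; this gives
    \<open>J \<subseteq> J \<cdot> U\<close>, against
    \<open>invertible_ideal_cancel\<close>.\<close>
  have "?Qs \<noteq> []"
  proof
    assume "?Qs = []"
    then have IJ: "I = J" using eV by simp
    obtain Qs' U where U: "Qs = Qs' @ [U]" using J(2) by (metis append_butlast_last_id)
    have Ui: "ideal U R" "ideal (foldl (ideal_prod R) J Qs') R" "foldl (ideal_prod R) J Qs' \<subseteq> J"
      using Qi U foldl_ideal_prod_ideal[OF Ji, of Qs'] foldl_ideal_prod_subset[OF Ji, of Qs'] by simp_all
    have "foldl (ideal_prod R) J Qs' \<cdot> U \<subseteq> J \<cdot> U"
      using Ui(3) by (intro ideal_prod_minimal ideal_prod_is_ideal Ji Ui) (auto intro: ideal_prod.prod)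
    then have "J \<subseteq> J \<cdot> U" using e U IJ by simp
    then show False using invertible_ideal_cancel[OF J(1) _ Ui(1)] I IJ Qs U by simp
  qed
  then show ?thesis using J eV Qs by (intro exI[of _ J] exI[of _ ?Qs]) auto
qed

section \<open>Localization at a prime ideal\<close>

text \<open>Taken inside the quotient field, so that the operations are inherited and being a domain
  follows from being a subring of a field.\<close>

definition localization :: "('a, 'm) ring_scheme \<Rightarrow> 'a set \<Rightarrow> ('a \<times> 'a) set ring"
  where "localization R P = (quot_field R)\<lparr>carrier :=
    {quot_frac R a s | a s. a \<in> carrier R \<and> s \<in> carrier R - P}\<rparr>"

locale prime_localization = "domain" R + primeideal P R for P and R (structure)
begin

abbreviation "L \<equiv> localization R P"

lemma S_mult: "s \<in> carrier R - P \<Longrightarrow> t \<in> carrier R - P \<Longrightarrow> s \<otimes> t \<in> carrier R - P"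
  using I_prime by auto

lemma S_one: "\<one> \<in> carrier R - P"
  using one_imp_carrier I_notcarr by auto

lemma S_nonzero: "s \<in> carrier R - P \<Longrightarrow> s \<in> carrier R - {\<zero>}"
  using zero_closed by auto

lemma frac_eq_iff:
  "a \<in> carrier R \<Longrightarrow> s \<in> carrier R - P \<Longrightarrow> b \<in> carrier R \<Longrightarrow> t \<in> carrier R - P \<Longrightarrow>
    quot_frac R a s = quot_frac R b t \<longleftrightarrow> a \<otimes> t = b \<otimes> s"
  using quot_frac_eq_iff[OF _ S_nonzero _ S_nonzero] .

lemma carrier_L: "x \<in> carrier L \<longleftrightarrow> (\<exists>a\<in>carrier R. \<exists>s\<in>carrier R - P. x = quot_frac R a s)"
  by (auto simp: localization_def)

lemma frac_closed: "a \<in> carrier R \<Longrightarrow> s \<in> carrier R - P \<Longrightarrow> quot_frac R a s \<in> carrier L"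
  unfolding carrier_L by blast

lemma mult_L:
  "a \<in> carrier R \<Longrightarrow> s \<in> carrier R - P \<Longrightarrow> b \<in> carrier R \<Longrightarrow> t \<in> carrier R - P \<Longrightarrow>
    quot_frac R a s \<otimes>\<^bsub>L\<^esub> quot_frac R b t = quot_frac R (a \<otimes> b) (s \<otimes> t)"
  using quot_frac_mult[OF _ S_nonzero _ S_nonzero] by (simp add: localization_def)

lemma add_L:
  "a \<in> carrier R \<Longrightarrow> s \<in> carrier R - P \<Longrightarrow> b \<in> carrier R \<Longrightarrow> t \<in> carrier R - P \<Longrightarrow>
    quot_frac R a s \<oplus>\<^bsub>L\<^esub> quot_frac R b t = quot_frac R (a \<otimes> t \<oplus> b \<otimes> s) (s \<otimes> t)"
  using quot_frac_add[OF _ S_nonzero _ S_nonzero] by (simp add: localization_def)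

lemma one_L: "\<one>\<^bsub>L\<^esub> = quot_frac R \<one> \<one>" and zero_L: "\<zero>\<^bsub>L\<^esub> = quot_frac R \<zero> \<one>"
  by (simp_all add: localization_def quot_field_one quot_field_zero)

lemma frac_cancel:
  "a \<in> carrier R \<Longrightarrow> s \<in> carrier R - P \<Longrightarrow> t \<in> carrier R - P \<Longrightarrow>
    quot_frac R (a \<otimes> t) (s \<otimes> t) = quot_frac R a s"
  using S_mult by (subst frac_eq_iff) (auto simp: m_ac)

lemma add_L_same:
  "a \<in> carrier R \<Longrightarrow> b \<in> carrier R \<Longrightarrow> s \<in> carrier R - P \<Longrightarrow>
    quot_frac R (a \<oplus> b) s = quot_frac R a s \<oplus>\<^bsub>L\<^esub> quot_frac R b s"
  using frac_cancel[of "a \<oplus> b" s s] by (simp add: add_L l_distr)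

lemma domain_L: "domain L"
proof -
  interpret K: field "quot_field R" by (rule field_quot_field)
  let ?H = "{quot_frac R a s | a s. a \<in> carrier R \<and> s \<in> carrier R - P}"
  have "subring ?H (quot_field R)"
  proof (rule K.subringI)
    show "?H \<subseteq> carrier (quot_field R)" using S_nonzero quot_frac_closed by blast
    show "\<one>\<^bsub>quot_field R\<^esub> \<in> ?H" unfolding quot_field_one using S_one by blast
    fix x assume "x \<in> ?H"
    then obtain a s where x: "x = quot_frac R a s" "a \<in> carrier R" "s \<in> carrier R - P" by blast
    have s: "s \<in> carrier R - {\<zero>}" using x S_nonzero by blast
    have "quot_frac R (\<ominus> a) s \<oplus>\<^bsub>quot_field R\<^esub> x = \<zero>\<^bsub>quot_field R\<^esub>"
      using x s unfolding quot_field_zero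
      by (simp add: quot_frac_add, subst quot_frac_eq_iff) (auto simp: l_minus l_neg integral_iff)
    then have "\<ominus>\<^bsub>quot_field R\<^esub> x = quot_frac R (\<ominus> a) s"
      using x s quot_frac_closed by (intro K.minus_equality) auto
    then show "\<ominus>\<^bsub>quot_field R\<^esub> x \<in> ?H" using x by blast
    fix y assume "y \<in> ?H"
    then obtain b t where y: "y = quot_frac R b t" "b \<in> carrier R" "t \<in> carrier R - P" by blast
    have t: "t \<in> carrier R - {\<zero>}" using y S_nonzero by blast
    have st: "s \<otimes> t \<in> carrier R - P" using x y S_mult by blast
    show "x \<otimes>\<^bsub>quot_field R\<^esub> y \<in> ?H"
      unfolding x(1) y(1) quot_frac_mult[OF x(2) s y(2) t] using st x(2) y(2) m_closed by blast
    show "x \<oplus>\<^bsub>quot_field R\<^esub> y \<in> ?H"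
      unfolding x(1) y(1) quot_frac_add[OF x(2) s y(2) t]
      using st x(2,3) y(2,3) m_closed a_closed by blast
  qed
  then show ?thesis unfolding localization_def by (rule K.subring_is_domain)
qed

sublocale L: "domain" L by (rule domain_L)

lemma frac_Units:
  assumes "a \<in> carrier R" "s \<in> carrier R - P"
  shows "quot_frac R a s \<in> Units L \<longleftrightarrow> a \<notin> P"
proof
  assume "quot_frac R a s \<in> Units L"
  then obtain y where y: "y \<in> carrier L" "quot_frac R a s \<otimes>\<^bsub>L\<^esub> y = \<one>\<^bsub>L\<^esub>"
    by (meson L.Units_closed L.Units_inv_closed L.Units_r_inv)
  obtain b t where b: "b \<in> carrier R" "t \<in> carrier R - P" "y = quot_frac R b t"
    using y(1) unfolding carrier_L by blast
  have "quot_frac R (a \<otimes> b) (s \<otimes> t) = quot_frac R \<one> \<one>"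
    using y(2) b assms by (simp add: mult_L one_L)
  then have "a \<otimes> b = s \<otimes> t"
    using frac_eq_iff[of "a \<otimes> b" "s \<otimes> t" \<one> \<one>] S_mult[OF assms(2) b(2)] S_one assms b by auto
  then have "a \<otimes> b \<notin> P" using S_mult[OF assms(2) b(2)] by auto
  then show "a \<notin> P" using I_r_closed b by blast
next
  assume a: "a \<notin> P"
  then have a': "a \<in> carrier R - P" using assms by blast
  have "quot_frac R a s \<otimes>\<^bsub>L\<^esub> quot_frac R s a = \<one>\<^bsub>L\<^esub>"
    using assms a' S_mult[OF a' assms(2)] S_mult[OF assms(2) a'] S_one unfolding one_L
    by (simp add: mult_L, subst frac_eq_iff) (auto simp: m_comm)
  moreover have "quot_frac R s a \<in> carrier L" "quot_frac R a s \<in> carrier L"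
    using frac_closed assms a' by auto
  ultimately show "quot_frac R a s \<in> Units L"
    using L.unit_factor[of "quot_frac R a s" "quot_frac R s a"] L.Units_one_closed by simp
qed

text \<open>For an ideal \<open>I\<close> this is the ideal generated by \<open>I\<close> in the
  localization: common denominators make the set closed under sums.\<close>

definition ext :: "'a set \<Rightarrow> ('a \<times> 'a) set set" where
  "ext I = {quot_frac R a s | a s. a \<in> I \<and> s \<in> carrier R - P}"

lemma mem_ext: "a \<in> I \<Longrightarrow> s \<in> carrier R - P \<Longrightarrow> quot_frac R a s \<in> ext I"
  by (auto simp: ext_def)

lemma ideal_ext:
  assumes I: "ideal I R"
  shows "ideal (ext I) L"
proof (rule L.ideal_of_closed)
  note Ic = ideal.Icarr[OF I]
  show "ext I \<subseteq> carrier L" using Ic frac_closed by (auto simp: ext_def)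
  show "\<zero>\<^bsub>L\<^esub> \<in> ext I" unfolding zero_L using ideal_zero[OF I] S_one by (rule mem_ext)
  fix x assume "x \<in> ext I"
  then obtain a s where x: "a \<in> I" "s \<in> carrier R - P" "x = quot_frac R a s" by (auto simp: ext_def)
  {
    fix y assume "y \<in> ext I"
    then obtain b t where y: "b \<in> I" "t \<in> carrier R - P" "y = quot_frac R b t" by (auto simp: ext_def)
    have "a \<otimes> t \<in> I" "b \<otimes> s \<in> I" using x y ideal.I_r_closed[OF I] by auto
    then show "x \<oplus>\<^bsub>L\<^esub> y \<in> ext I"
      using x y Ic S_mult by (simp add: add_L mem_ext ideal_add_closed[OF I])
  next
    fix y assume "y \<in> carrier L"
    then obtain b t where y: "b \<in> carrier R" "t \<in> carrier R - P" "y = quot_frac R b t"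
      unfolding carrier_L by blast
    have "a \<otimes> b \<in> I" using x y ideal.I_r_closed[OF I] by auto
    then show "x \<otimes>\<^bsub>L\<^esub> y \<in> ext I"
      using x y Ic S_mult by (simp add: mult_L mem_ext)
  }
qed

lemma ext_prod:
  assumes I: "ideal U R" "ideal V R"
  shows "ext (U \<cdot> V) = ideal_prod L (ext U) (ext V)"
proof (rule subset_antisym)
  note UV = ideal.Icarr[OF I(1)] ideal.Icarr[OF I(2)]
  note UVi = ideal_prod_is_ideal[OF I]
  show "ideal_prod L (ext U) (ext V) \<subseteq> ext (U \<cdot> V)"
  proof (rule L.ideal_prod_minimal[OF ideal_ext[OF UVi]])
    fix x y assume "x \<in> ext U" "y \<in> ext V"
    then obtain a s b t where xy: "a \<in> U" "s \<in> carrier R - P" "x = quot_frac R a s"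
      "b \<in> V" "t \<in> carrier R - P" "y = quot_frac R b t" by (auto simp: ext_def)
    have "x \<otimes>\<^bsub>L\<^esub> y = quot_frac R (a \<otimes> b) (s \<otimes> t)" using xy UV by (simp add: mult_L)
    then show "x \<otimes>\<^bsub>L\<^esub> y \<in> ext (U \<cdot> V)"
      using mem_ext[OF ideal_prod.prod[OF xy(1,4), of R] S_mult[OF xy(2,5)]] by simp
  qed
  \<comment> \<open>The denominator stays fixed during the induction, so a sum of numerators splits
    into fractions with that same denominator.\<close>
  have "quot_frac R c s \<in> ideal_prod L (ext U) (ext V)" if "c \<in> U \<cdot> V" "s \<in> carrier R - P" for c s
    using that
  proof (induction c)
    case (prod u v)
    have "quot_frac R (u \<otimes> v) s = quot_frac R u s \<otimes>\<^bsub>L\<^esub> quot_frac R v \<one>"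
      using prod UV S_one by (simp add: mult_L)
    also have "\<dots> \<in> ideal_prod L (ext U) (ext V)"
      by (intro ideal_prod.prod mem_ext prod S_one)
    finally show ?case .
  next
    case (sum c d)
    have "c \<in> carrier R" "d \<in> carrier R" using sum.hyps ideal.Icarr[OF UVi] by auto
    then show ?case
      using sum add_L_same by (simp add: ideal_prod.sum)
  qed
  then show "ext (U \<cdot> V) \<subseteq> ideal_prod L (ext U) (ext V)" by (auto simp: ext_def)
qed

lemma ext_foldl:
  assumes "ideal J R" "\<forall>Q\<in>set Qs. ideal Q R"
  shows "ext (foldl (ideal_prod R) J Qs) = foldl (ideal_prod L) (ext J) (map ext Qs)"
  using assms
  by (induction Qs arbitrary: J) (auto simp: ext_prod ideal_prod_is_ideal)

lemma ext_proper:
  assumes "I \<subseteq> P"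
  shows "ext I \<noteq> carrier L"
proof
  assume "ext I = carrier L"
  then have "\<one>\<^bsub>L\<^esub> \<in> ext I" by simp
  then obtain a s where a: "a \<in> I" "s \<in> carrier R - P" "\<one>\<^bsub>L\<^esub> = quot_frac R a s" by (auto simp: ext_def)
  then have "quot_frac R a s \<in> Units L" by (metis L.Units_one_closed)
  then show False using frac_Units[of a s] a assms Icarr by auto
qed

lemma pow_L:
  assumes "a \<in> carrier R" "s \<in> carrier R - P"
  shows "quot_frac R a s [^]\<^bsub>L\<^esub> (n::nat) = quot_frac R (a [^] n) (s [^] n) \<and> s [^] n \<in> carrier R - P"
proof (induction n)
  case 0
  then show ?case using S_one by (simp add: one_L)
next
  case (Suc n)
  then show ?case using assms mult_L[of "a [^] n" "s [^] n" a s] S_mult[of "s [^] n" s] by simp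
qed

text \<open>If the n-th power of \<open>a/s\<close> lies in the extension, then \<open>a^n t\<close>
  lies in \<open>Q\<close> for some \<open>t\<close> outside \<open>P\<close>. Enlarging
  \<open>t\<close> to \<open>t^n\<close> gives a power of \<open>a t\<close> in \<open>Q\<close>, so
  \<open>a t\<close> lies in \<open>Q\<close>, and \<open>a/s\<close> is \<open>a t\<close> over
  \<open>s t\<close>.\<close>

lemma radical_ext:
  assumes Q: "radical_ideal R Q"
  shows "radical_ideal L (ext Q)"
proof -
  note Qi = radical_ideal_ideal[OF Q]
  have "x \<in> ext Q" if x: "x \<in> carrier L" and n: "(n::nat) \<ge> 1" "x [^]\<^bsub>L\<^esub> n \<in> ext Q" for x n
  proof -
    obtain a s where a: "a \<in> carrier R" "s \<in> carrier R - P" "x = quot_frac R a s"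
      using x unfolding carrier_L by blast
    note p = pow_L[OF a(1,2), of n]
    obtain b t where b: "b \<in> Q" "t \<in> carrier R - P" "quot_frac R (a [^] n) (s [^] n) = quot_frac R b t"
      using n(2) p unfolding a(3) by (auto simp: ext_def)
    have bc: "b \<in> carrier R" using b ideal.Icarr[OF Qi] by blast
    have "a [^] n \<otimes> t = b \<otimes> s [^] n"
      using b bc a p frac_eq_iff[of "a [^] n" "s [^] n" b t] by simp
    then have atQ: "a [^] n \<otimes> t \<in> Q" using ideal.I_r_closed[OF Qi b(1)] p by auto
    obtain m where m: "n = Suc m" using n(1) by (cases n) auto
    have "(a \<otimes> t) [^] n = a [^] n \<otimes> t \<otimes> t [^] m"
      using a b by (simp add: nat_pow_distrib m m_ac)
    then have "(a \<otimes> t) [^] n \<in> Q" using ideal.I_r_closed[OF Qi atQ] b by auto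
    then have "a \<otimes> t \<in> ideal_radical R Q" using n(1) a b by (auto simp: ideal_radical_def)
    then have "a \<otimes> t \<in> Q" using Q by (simp add: radical_ideal_def)
    then have "quot_frac R (a \<otimes> t) (s \<otimes> t) \<in> ext Q" using a b S_mult by (intro mem_ext) auto
    then show ?thesis using frac_cancel a b by simp
  qed
  moreover have "x \<in> ideal_radical L (ext Q)" if "x \<in> ext Q" for x
    using that ideal.Icarr[OF ideal_ext[OF Qi] that] unfolding ideal_radical_def
    by (auto intro!: exI[of _ "1::nat"])
  ultimately show ?thesis
    using ideal_ext[OF Qi] by (auto simp: radical_ideal_def ideal_radical_def)
qed

text \<open>The local generator \<open>j\<close> generates the extension, since the multiplier
  \<open>s\<close> is invertible in the localization.\<close>

lemma ext_invertible:
  assumes J: "invertible_ideal R J"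
  shows "\<exists>z\<in>carrier L. ext J = PIdl\<^bsub>L\<^esub> z"
proof -
  note Ji = invertible_ideal_ideal[OF J]
  obtain j s where js: "j \<in> J" "s \<in> carrier R - P" "\<And>x. x \<in> J \<Longrightarrow> s \<otimes> x \<in> PIdl j"
    using invertible_ideal_locally_principal[OF J primeideal] by blast
  have jc: "j \<in> carrier R" using js ideal.Icarr[OF Ji] by blast
  let ?z = "quot_frac R j \<one>"
  have z: "?z \<in> carrier L" using jc S_one frac_closed by blast
  have "ext J \<subseteq> PIdl\<^bsub>L\<^esub> ?z"
  proof
    fix x assume "x \<in> ext J"
    then obtain a t where a: "a \<in> J" "t \<in> carrier R - P" "x = quot_frac R a t" by (auto simp: ext_def)
    have ac: "a \<in> carrier R" using a ideal.Icarr[OF Ji] by blast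
    obtain r where r: "r \<in> carrier R" "s \<otimes> a = j \<otimes> r" using js(3)[OF a(1)] jc by (auto simp: mem_PIdl_iff)
    have st: "s \<otimes> t \<in> carrier R - P" using S_mult js a by blast
    have "x = quot_frac R (a \<otimes> s) (t \<otimes> s)" using frac_cancel a ac js by simp
    also have "\<dots> = quot_frac R (j \<otimes> r) (s \<otimes> t)" using r ac a js by (simp add: m_comm)
    also have "\<dots> = ?z \<otimes>\<^bsub>L\<^esub> quot_frac R r (s \<otimes> t)" using jc r st S_one by (simp add: mult_L)
    finally show "x \<in> PIdl\<^bsub>L\<^esub> ?z" using L.mem_PIdl_iff[OF z] frac_closed[OF r(1) st] by blast
  qed
  moreover have "PIdl\<^bsub>L\<^esub> ?z \<subseteq> ext J"
    using L.cgenideal_minimal[OF ideal_ext[OF Ji]] mem_ext[OF js(1) S_one] by blast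
  ultimately show ?thesis using z by blast
qed

end

text \<open>Every ideal of the localization is extended from its contraction \<open>I\<close>, which
  is \<open>P\<close>-saturated. As the radical factors of \<open>I\<close> can be chosen inside
  \<open>P\<close>, their extensions stay proper and radical, and the invertible factor becomes
  principal.\<close>

theorem (in isp_domain) local_factorization_localization:
  assumes P: "primeideal P R"
  shows "local_factorization (localization R P)"
proof -
  interpret prime_localization P R
    using P domain_axioms by (intro prime_localization.intro)
  show ?thesis
  proof (intro local_factorization.intro local_factorization_axioms.intro domain_L)
    fix x y assume xy: "x \<in> carrier L" "y \<in> carrier L" "x \<oplus>\<^bsub>L\<^esub> y \<in> Units L"
    then obtain a s b t where a: "a \<in> carrier R" "s \<in> carrier R - P" "x = quot_frac R a s"
      and b: "b \<in> carrier R" "t \<in> carrier R - P" "y = quot_frac R b t"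
      unfolding carrier_L by blast
    have "a \<otimes> t \<oplus> b \<otimes> s \<notin> P"
      using xy(3) a b frac_Units[of "a \<otimes> t \<oplus> b \<otimes> s" "s \<otimes> t"] S_mult by (simp add: add_L)
    then have "a \<notin> P \<or> b \<notin> P" using I_r_closed a b a_closed by blast
    then show "x \<in> Units L \<or> y \<in> Units L" using frac_Units a b by blast
  next
    fix I' assume I': "ideal I' L" "I' \<noteq> {\<zero>\<^bsub>L\<^esub>}" "I' \<noteq> carrier L"
    define I where "I = {a \<in> carrier R. quot_frac R a \<one> \<in> I'}"
    have mult_unit: "quot_frac R (a \<otimes> r) (s \<otimes> t) \<in> I'"
      if "quot_frac R a s \<in> I'" "a \<in> carrier R" "r \<in> carrier R" "s \<in> carrier R - P" "t \<in> carrier R - P"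
      for a r s t
      using ideal.I_r_closed[OF I'(1) that(1) frac_closed[OF that(3,5)]] that by (simp add: mult_L)
    have Ii: "ideal I R"
    proof (rule ideal_of_closed)
      show "\<zero> \<in> I" using L.ideal_zero[OF I'(1)] by (simp add: I_def zero_L)
      show "x \<oplus> y \<in> I" if "x \<in> I" "y \<in> I" for x y
        using that S_one L.ideal_add_closed[OF I'(1)] by (simp add: I_def add_L_same)
      show "x \<otimes> r \<in> I" if "x \<in> I" "r \<in> carrier R" for x r
        using that mult_unit[of x \<one> r \<one>] S_one by (simp add: I_def)
    qed (auto simp: I_def)
    have frac_mem: "quot_frac R a s \<in> I' \<longleftrightarrow> a \<in> I" if as: "a \<in> carrier R" "s \<in> carrier R - P" for a s
    proof
      assume "quot_frac R a s \<in> I'"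
      then have "quot_frac R (a \<otimes> s) (s \<otimes> \<one>) \<in> I'" using mult_unit[of a s s \<one>] as S_one by simp
      moreover have "quot_frac R (a \<otimes> s) (s \<otimes> \<one>) = quot_frac R a \<one>"
        using frac_cancel[of a \<one> s] as S_one by simp
      ultimately show "a \<in> I" using as by (simp add: I_def)
    next
      assume "a \<in> I"
      then show "quot_frac R a s \<in> I'" using mult_unit[of a \<one> \<one> s] as S_one by (simp add: I_def)
    qed
    have ext_I: "ext I = I'"
    proof (rule subset_antisym)
      show "ext I \<subseteq> I'" using frac_mem by (auto simp: ext_def I_def)
      show "I' \<subseteq> ext I"
      proof
        fix x assume x: "x \<in> I'"
        then have "x \<in> carrier L" using ideal.Icarr[OF I'(1)] by blast
        then show "x \<in> ext I" using x frac_mem mem_ext unfolding carrier_L by blast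
      qed
    qed
    have "I \<noteq> {\<zero>}"
    proof
      assume I0: "I = {\<zero>}"
      have "x = \<zero>\<^bsub>L\<^esub>" if "x \<in> I'" for x
      proof -
        have "x \<in> ext I" using that ext_I by simp
        then obtain a s where "a \<in> I" "s \<in> carrier R - P" "x = quot_frac R a s"
          unfolding ext_def by blast
        then have s: "s \<in> carrier R - P" "x = quot_frac R \<zero> s" using I0 by simp_all
        then show ?thesis unfolding zero_L using frac_eq_iff[of \<zero> s \<zero> \<one>] S_one by simp
      qed
      then show False using I'(2) L.ideal_zero[OF I'(1)] by blast
    qed
    moreover have "I \<subseteq> P"
    proof
      fix a assume a: "a \<in> I"
      show "a \<in> P"
      proof (rule ccontr)
        assume "a \<notin> P"
        then have "quot_frac R a \<one> \<in> Units L" using a frac_Units S_one by (simp add: I_def)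
        then show False using L.ideal_unit_eq_carrier[OF I'(1)] a I'(3) by (auto simp: I_def)
      qed
    qed
    moreover have "saturated P I"
      unfolding saturated_def
    proof (intro ballI impI)
      fix s a assume s: "s \<in> carrier R - P" "a \<in> carrier R" "s \<otimes> a \<in> I"
      then have "quot_frac R (s \<otimes> a) s \<in> I'" using frac_mem by simp
      moreover have "quot_frac R (s \<otimes> a) s = quot_frac R a \<one>"
        using s S_one by (subst frac_eq_iff) (auto simp: m_comm)
      ultimately show "a \<in> I" using s by (simp add: I_def)
    qed
    ultimately obtain J Qs where J: "invertible_ideal R J" "Qs \<noteq> []"
      "\<forall>Q\<in>set Qs. radical_ideal R Q \<and> Q \<subseteq> P" "I = foldl (ideal_prod R) J Qs"
      using saturated_factorization[OF P Ii] by blast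
    obtain z where z: "z \<in> carrier L" "ext J = PIdl\<^bsub>L\<^esub> z" using ext_invertible[OF J(1)] by blast
    have "\<forall>Q\<in>set Qs. ideal Q R" using J(3) radical_ideal_ideal by blast
    then have "I' = foldl (ideal_prod L) (PIdl\<^bsub>L\<^esub> z) (map ext Qs)"
      using ext_foldl[OF invertible_ideal_ideal[OF J(1)]] ext_I J(4) z(2) by simp
    moreover have "\<forall>Q\<in>set (map ext Qs). radical_ideal L Q \<and> Q \<noteq> carrier L"
      using J(3) radical_ext ext_proper by auto
    ultimately show "\<exists>z\<in>carrier L. \<exists>Qs. Qs \<noteq> [] \<and> (\<forall>Q\<in>set Qs. radical_ideal L Q \<and> Q \<noteq> carrier L)
        \<and> I' = foldl (ideal_prod L) (PIdl\<^bsub>L\<^esub> z) Qs"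
      using z(1) J(2) by (intro bexI[of _ z] exI[of _ "map ext Qs"]) auto
  qed
qed

section \<open>Divisibility and generators at a prime of an ISP-domain, with denominators
  cleared\<close>

context isp_domain begin

lemma locally_comparable:
  assumes P: "primeideal P R" and x: "x \<in> carrier R" "y \<in> carrier R"
  shows "\<exists>s\<in>carrier R - P. s \<otimes> x \<in> PIdl y \<or> s \<otimes> y \<in> PIdl x"
proof -
  interpret prime_localization P R
    using P domain_axioms by (intro prime_localization.intro)
  interpret LF: local_factorization L by (rule local_factorization_localization[OF P])
  have *: "\<exists>s\<in>carrier R - P. s \<otimes> x \<in> PIdl y"
    if h: "x \<in> carrier R" "y \<in> carrier R" "quot_frac R x \<one> \<in> PIdl\<^bsub>L\<^esub> (quot_frac R y \<one>)" for x y
  proof -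
    obtain z where z: "z \<in> carrier L" "quot_frac R x \<one> = quot_frac R y \<one> \<otimes>\<^bsub>L\<^esub> z"
      using h(3) L.mem_PIdl_iff[OF frac_closed[OF h(2) S_one]] by blast
    obtain b t where b: "b \<in> carrier R" "t \<in> carrier R - P" "z = quot_frac R b t"
      using z(1) unfolding carrier_L by blast
    have "quot_frac R x \<one> = quot_frac R (y \<otimes> b) t"
      using z(2) b h S_one by (simp add: mult_L)
    then have "t \<otimes> x = y \<otimes> b" using frac_eq_iff[of x \<one> "y \<otimes> b" t] h b S_one m_comm[of t x] by simp
    then show ?thesis using b(1,2) mem_PIdl_iff[OF h(2)] by blast
  qed
  show ?thesis
    using LF.local_factorization_comparable[OF frac_closed[OF x(1) S_one] frac_closed[OF x(2) S_one]]
      *[OF x] *[OF x(2,1)] by blast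
qed

text \<open>\<open>q\<close> is the numerator of a generator of the maximal ideal of the
  localization. A nonzero element of \<open>P\<close> supplies the nonzero nonunit with which
  \<open>local_factorization_generator\<close> starts.\<close>

lemma local_generator:
  assumes P: "primeideal P R" "P \<noteq> {\<zero>}"
  shows "\<exists>q\<in>P. q \<noteq> \<zero> \<and> (\<forall>a\<in>P. \<exists>s\<in>carrier R - P. s \<otimes> a \<in> PIdl q)"
proof -
  interpret prime_localization P R
    using P domain_axioms by (intro prime_localization.intro)
  interpret LF: local_factorization L by (rule local_factorization_localization[OF P(1)])
  obtain p where p: "p \<in> P" "p \<noteq> \<zero>" using P(2) zero_closed by blast
  have "quot_frac R p \<one> \<noteq> \<zero>\<^bsub>L\<^esub>"
    unfolding zero_L using frac_eq_iff[of p \<one> \<zero> \<one>] p S_one Icarr by simp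
  then obtain z where z: "z \<in> carrier L" "z \<noteq> \<zero>\<^bsub>L\<^esub>" "z \<notin> Units L"
    "\<forall>y\<in>carrier L - Units L. y \<in> PIdl\<^bsub>L\<^esub> z"
    using LF.local_factorization_generator[of "quot_frac R p \<one>"] frac_closed[OF Icarr[OF p(1)] S_one]
      frac_Units[OF Icarr[OF p(1)] S_one] p(1) by blast
  obtain q s where q: "q \<in> carrier R" "s \<in> carrier R - P" "z = quot_frac R q s"
    using z(1) unfolding carrier_L by blast
  have "q \<in> P" using z(3) frac_Units[OF q(1,2)] q(3) by simp
  moreover have "q \<noteq> \<zero>"
  proof
    assume "q = \<zero>"
    then have "z = \<zero>\<^bsub>L\<^esub>" unfolding zero_L q(3) using frac_eq_iff[of \<zero> s \<zero> \<one>] q S_one by simp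
    then show False using z by blast
  qed
  moreover have "\<exists>s\<in>carrier R - P. s \<otimes> a \<in> PIdl q" if a: "a \<in> P" for a
  proof -
    have ac: "a \<in> carrier R" using a Icarr by blast
    have "quot_frac R a \<one> \<in> PIdl\<^bsub>L\<^esub> z" using z(4) frac_closed[OF ac S_one] frac_Units[OF ac S_one] a by blast
    then obtain w where w: "w \<in> carrier L" "quot_frac R a \<one> = z \<otimes>\<^bsub>L\<^esub> w"
      using L.mem_PIdl_iff[OF z(1)] by blast
    obtain b t where b: "b \<in> carrier R" "t \<in> carrier R - P" "w = quot_frac R b t"
      using w(1) unfolding carrier_L by blast
    have st: "s \<otimes> t \<in> carrier R - P" using S_mult q b by blast
    have "quot_frac R a \<one> = quot_frac R (q \<otimes> b) (s \<otimes> t)"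
      using w(2) b q by (simp add: mult_L)
    then have "a \<otimes> (s \<otimes> t) = q \<otimes> b"
      using frac_eq_iff[of a \<one> "q \<otimes> b" "s \<otimes> t"] ac b q st S_one by simp
    then have "(s \<otimes> t) \<otimes> a = q \<otimes> b" using m_comm[of "s \<otimes> t" a] ac st by simp
    then show ?thesis using st b(1) mem_PIdl_iff[OF q(1)] by blast
  qed
  ultimately show ?thesis by blast
qed

text \<open>Divisibility is total locally at \<open>P\<close>, so a finite set has a member dividing
  all the others; the multipliers of the single comparisons are multiplied together.\<close>

lemma locally_principal_finite:
  assumes P: "primeideal P R" and S: "finite S" "S \<noteq> {}" "S \<subseteq> carrier R"
  shows "\<exists>a\<in>S. \<exists>s\<in>carrier R - P. \<forall>b\<in>S. s \<otimes> b \<in> PIdl a"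
proof -
  interpret prime_localization P R
    using P domain_axioms by (intro prime_localization.intro)
  show ?thesis
    using S
  proof (induction S rule: finite_ne_induct)
    case (singleton x)
    then show ?case using S_one cgenideal_self by (intro bexI[of _ x] bexI[of _ \<one>]) auto
  next
    case (insert x F)
    then obtain a s where a: "a \<in> F" "s \<in> carrier R - P" "\<And>b. b \<in> F \<Longrightarrow> s \<otimes> b \<in> PIdl a" by auto
    have c: "x \<in> carrier R" "a \<in> carrier R" "F \<subseteq> carrier R" using insert a by auto
    obtain t where t: "t \<in> carrier R - P" "t \<otimes> x \<in> PIdl a \<or> t \<otimes> a \<in> PIdl x"
      using locally_comparable[OF P c(1,2)] by blast
    have st: "s \<otimes> t \<in> carrier R - P" using S_mult a t by blast
    note mulPIdl = ideal.I_l_closed[OF cgenideal_ideal]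
    show ?case
    proof (cases "t \<otimes> x \<in> PIdl a")
      case True
      have "s \<otimes> t \<otimes> b \<in> PIdl a" if b: "b \<in> insert x F" for b
      proof (cases "b = x")
        case True
        then show ?thesis using \<open>t \<otimes> x \<in> PIdl a\<close> mulPIdl[OF c(2)] a t c by (simp add: m_assoc)
      next
        case False
        then have "b \<in> F" "b \<in> carrier R" using b c by auto
        then have "t \<otimes> (s \<otimes> b) \<in> PIdl a" using a(3) mulPIdl[OF c(2)] t by simp
        then show ?thesis using a t \<open>b \<in> carrier R\<close> by (simp add: m_ac)
      qed
      then show ?thesis using a st by blast
    next
      case False
      then obtain r where r: "r \<in> carrier R" "t \<otimes> a = x \<otimes> r" using t c by (auto simp: mem_PIdl_iff)
      have "s \<otimes> t \<otimes> b \<in> PIdl x" if b: "b \<in> insert x F" for b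
      proof (cases "b = x")
        case True
        then show ?thesis using mulPIdl[OF c(1) cgenideal_self] c st by blast
      next
        case False
        then have bF: "b \<in> F" "b \<in> carrier R" using b c by auto
        obtain d where d: "d \<in> carrier R" "s \<otimes> b = a \<otimes> d" using a(3)[OF bF(1)] c by (auto simp: mem_PIdl_iff)
        have "s \<otimes> t \<otimes> b = t \<otimes> (s \<otimes> b)" using a t bF by (simp add: m_ac)
        also have "\<dots> = (t \<otimes> a) \<otimes> d" unfolding d(2) using t c d(1) by (simp add: m_assoc)
        also have "\<dots> = x \<otimes> (r \<otimes> d)" unfolding r(2) using c r(1) d(1) by (simp add: m_assoc)
        finally show ?thesis using c r(1) d(1) by (auto simp: mem_PIdl_iff)
      qed
      then show ?thesis using st by blast
    qed
  qed
qed

end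

section \<open>A local criterion for invertibility\<close>

context "domain" begin

text \<open>The inverse is the set \<open>F\<close> of all \<open>x\<close> in the quotient field
  that multiply \<open>I\<close> into the ring. The ideal \<open>T\<close> of ring elements in the
  product of \<open>I\<close> and \<open>F\<close> is contained in no maximal ideal, because the
  fraction \<open>s/a\<close> belongs to \<open>F\<close> and its product with \<open>a\<close> is
  \<open>s\<close>.\<close>

lemma invertible_ideal_if_locally_principal:
  assumes I: "ideal I R" "I \<noteq> {\<zero>}"
    and loc: "\<And>M. maximalideal M R \<Longrightarrow> \<exists>a\<in>I. \<exists>s\<in>carrier R - M. \<forall>x\<in>I. s \<otimes> x \<in> PIdl a"
  shows "invertible_ideal R I"
proof -
  let ?K = "quot_field R" and ?e = "quot_emb R"
  interpret K: field ?K by (rule field_quot_field)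
  note Ic = ideal.Icarr[OF I(1)]
  have e0: "?e \<zero> = \<zero>\<^bsub>?K\<^esub>" by (simp add: quot_emb_def quot_field_zero)
  have e_minus: "\<ominus>\<^bsub>?K\<^esub> ?e c = ?e (\<ominus> c)" if "c \<in> carrier R" for c
    using that quot_emb_closed quot_emb_add[of "\<ominus> c" c] e0 by (intro K.minus_equality) (auto simp: l_neg)
  define F where "F = {x \<in> carrier ?K. \<forall>i\<in>I. ?e i \<otimes>\<^bsub>?K\<^esub> x \<in> ?e ` carrier R}"
  have FE: "\<exists>a\<in>carrier R. ?e i \<otimes>\<^bsub>?K\<^esub> x = ?e a" if "x \<in> F" "i \<in> I" for x i
    using that unfolding F_def by blast
  have F0: "\<zero>\<^bsub>?K\<^esub> \<in> F"
    using Ic quot_emb_closed zero_closed e0 by (auto simp: F_def intro!: image_eqI[of _ _ \<zero>])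
  have Fadd: "x \<oplus>\<^bsub>?K\<^esub> y \<in> F" if xy: "x \<in> F" "y \<in> F" for x y
    unfolding F_def
  proof (intro CollectI conjI ballI)
    show "x \<oplus>\<^bsub>?K\<^esub> y \<in> carrier ?K" using xy by (simp add: F_def)
    fix i assume i: "i \<in> I"
    obtain a b where ab: "a \<in> carrier R" "b \<in> carrier R" "?e i \<otimes>\<^bsub>?K\<^esub> x = ?e a" "?e i \<otimes>\<^bsub>?K\<^esub> y = ?e b"
      using FE[OF xy(1) i] FE[OF xy(2) i] by blast
    have "?e i \<otimes>\<^bsub>?K\<^esub> (x \<oplus>\<^bsub>?K\<^esub> y) = ?e (a \<oplus> b)"
      using xy i Ic quot_emb_closed ab by (simp add: F_def K.r_distr quot_emb_add)
    then show "?e i \<otimes>\<^bsub>?K\<^esub> (x \<oplus>\<^bsub>?K\<^esub> y) \<in> ?e ` carrier R" using ab by simp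
  qed
  have Fneg: "\<ominus>\<^bsub>?K\<^esub> x \<in> F" if x: "x \<in> F" for x
    unfolding F_def
  proof (intro CollectI conjI ballI)
    show "\<ominus>\<^bsub>?K\<^esub> x \<in> carrier ?K" using x by (simp add: F_def)
    fix i assume i: "i \<in> I"
    obtain a where a: "a \<in> carrier R" "?e i \<otimes>\<^bsub>?K\<^esub> x = ?e a" using FE[OF _ i] x by blast
    have "?e i \<otimes>\<^bsub>?K\<^esub> (\<ominus>\<^bsub>?K\<^esub> x) = ?e (\<ominus> a)"
      using x i Ic quot_emb_closed a by (simp add: F_def K.r_minus e_minus)
    then show "?e i \<otimes>\<^bsub>?K\<^esub> (\<ominus>\<^bsub>?K\<^esub> x) \<in> ?e ` carrier R" using a by simp
  qed
  have Fmult: "?e r \<otimes>\<^bsub>?K\<^esub> x \<in> F" if x: "x \<in> F" "r \<in> carrier R" for x r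
    unfolding F_def
  proof (intro CollectI conjI ballI)
    show "?e r \<otimes>\<^bsub>?K\<^esub> x \<in> carrier ?K" using x quot_emb_closed by (simp add: F_def)
    fix i assume i: "i \<in> I"
    obtain a where a: "a \<in> carrier R" "?e i \<otimes>\<^bsub>?K\<^esub> x = ?e a" using FE[OF _ i] x by blast
    have "?e i \<otimes>\<^bsub>?K\<^esub> (?e r \<otimes>\<^bsub>?K\<^esub> x) = ?e r \<otimes>\<^bsub>?K\<^esub> (?e i \<otimes>\<^bsub>?K\<^esub> x)"
      using x i Ic quot_emb_closed by (simp add: F_def K.m_lcomm)
    also have "\<dots> = ?e (r \<otimes> a)" using a x by (simp add: quot_emb_mult)
    finally show "?e i \<otimes>\<^bsub>?K\<^esub> (?e r \<otimes>\<^bsub>?K\<^esub> x) \<in> ?e ` carrier R" using a x by simp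
  qed
  have "additive_subgroup F ?K"
  proof (rule additive_subgroup.intro, rule K.add.subgroupI)
    show "F \<subseteq> carrier ?K" by (auto simp: F_def)
    show "F \<noteq> {}" using F0 by blast
  qed (use Fneg Fadd in \<open>auto simp: a_inv_def\<close>)
  \<comment> \<open>Any nonzero element of \<open>I\<close> serves as a common denominator of
    \<open>F\<close>.\<close>
  moreover obtain d where d: "d \<in> I" "d \<noteq> \<zero>" using I(2) ideal_zero[OF I(1)] by blast
  then have "d \<in> carrier R - {\<zero>}" "\<forall>x\<in>F. ?e d \<otimes>\<^bsub>?K\<^esub> x \<in> ?e ` carrier R"
    using Ic by (auto simp: F_def)
  ultimately have F: "fractional_ideal R F"
    unfolding fractional_ideal_def using Fmult by blast
  let ?IF = "ideal_prod ?K (?e ` I) F"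
  have IF_sub: "?IF \<subseteq> ?e ` carrier R"
  proof
    fix x assume "x \<in> ?IF"
    then show "x \<in> ?e ` carrier R"
    proof induction
      case (prod i f)
      then show ?case by (auto simp: F_def)
    next
      case (sum x y)
      then obtain a b where "a \<in> carrier R" "b \<in> carrier R" "x = ?e a" "y = ?e b" by auto
      then show ?case by (intro image_eqI[of _ _ "a \<oplus> b"]) (auto simp: quot_emb_add)
    qed
  qed
  have IF_mult: "?e r \<otimes>\<^bsub>?K\<^esub> x \<in> ?IF" if "x \<in> ?IF" "r \<in> carrier R" for x r
    using that
  proof induction
    case (prod i f)
    then obtain j where j: "j \<in> I" "i = ?e j" by auto
    have "?e r \<otimes>\<^bsub>?K\<^esub> (i \<otimes>\<^bsub>?K\<^esub> f) = i \<otimes>\<^bsub>?K\<^esub> (?e r \<otimes>\<^bsub>?K\<^esub> f)"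
      using prod j Ic quot_emb_closed by (simp add: F_def K.m_lcomm)
    then show ?case using prod Fmult by (simp add: ideal_prod.prod)
  next
    case (sum x y)
    have "x \<in> carrier ?K" "y \<in> carrier ?K" using sum.hyps IF_sub quot_emb_closed by auto
    then show ?case using sum quot_emb_closed by (simp add: K.r_distr ideal_prod.sum)
  qed
  define T where "T = {t \<in> carrier R. ?e t \<in> ?IF}"
  have T: "ideal T R"
  proof (rule ideal_of_closed)
    have "?e \<zero> \<otimes>\<^bsub>?K\<^esub> \<zero>\<^bsub>?K\<^esub> \<in> ?IF" using ideal_zero[OF I(1)] F0 by (intro ideal_prod.prod) auto
    then show "\<zero> \<in> T" by (simp add: T_def e0)
    show "x \<oplus> y \<in> T" if "x \<in> T" "y \<in> T" for x y
      using that by (simp add: T_def quot_emb_add ideal_prod.sum)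
    show "x \<otimes> r \<in> T" if "x \<in> T" "r \<in> carrier R" for x r
      using that IF_mult[of "?e x" r] m_comm[of x r] by (simp add: T_def quot_emb_mult)
  qed (auto simp: T_def)
  have "T = carrier R"
  proof (rule ccontr)
    assume "T \<noteq> carrier R"
    then obtain M where M: "maximalideal M R" "T \<subseteq> M" using ex_maximalideal[OF T] by blast
    obtain a s where a: "a \<in> I" "s \<in> carrier R - M" "\<And>x. x \<in> I \<Longrightarrow> s \<otimes> x \<in> PIdl a"
      using loc[OF M(1)] by blast
    have c: "a \<in> carrier R" "s \<in> carrier R" using a Ic by auto
    have "\<zero> \<in> M" using ideal_zero[OF maximalideal.axioms(1)[OF M(1)]] .
    then have "s \<noteq> \<zero>" using a by auto
    have "a \<noteq> \<zero>"
    proof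
      assume "a = \<zero>"
      then have "s \<otimes> d = \<zero>" using a(3)[OF d(1)] by (simp add: PIdl_zero)
      then show False using \<open>s \<noteq> \<zero>\<close> d integral[of s d] c Ic by blast
    qed
    then have a': "a \<in> carrier R - {\<zero>}" using c by simp
    let ?f = "quot_frac R s a"
    have "?e i \<otimes>\<^bsub>?K\<^esub> ?f \<in> ?e ` carrier R" if i: "i \<in> I" for i
    proof -
      obtain r where r: "r \<in> carrier R" "s \<otimes> i = a \<otimes> r" using a(3)[OF i] c by (auto simp: mem_PIdl_iff)
      have "?e i \<otimes>\<^bsub>?K\<^esub> ?f = quot_frac R (i \<otimes> s) a"
        using Ic[OF i] c a' by (simp add: quot_emb_def quot_frac_mult)
      also have "\<dots> = ?e r"
        unfolding quot_emb_def using Ic[OF i] c a' r m_comm[of i s] m_comm[of a r]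
        by (subst quot_frac_eq_iff) auto
      finally show ?thesis using r by simp
    qed
    then have "?f \<in> F" using c a' quot_frac_closed by (simp add: F_def)
    then have "?e a \<otimes>\<^bsub>?K\<^esub> ?f \<in> ?IF" using a by (intro ideal_prod.prod) auto
    moreover have "?e a \<otimes>\<^bsub>?K\<^esub> ?f = ?e s"
    proof -
      have "?e a \<otimes>\<^bsub>?K\<^esub> ?f = quot_frac R (a \<otimes> s) a"
        using c a' by (simp add: quot_emb_def quot_frac_mult)
      also have "\<dots> = ?e s"
        unfolding quot_emb_def using c a' m_comm[of a s] by (subst quot_frac_eq_iff) auto
      finally show ?thesis .
    qed
    ultimately have "s \<in> T" using c by (simp add: T_def)
    then show False using M a by blast
  qed
  then have "?IF = ?e ` carrier R" using IF_sub by (auto simp: T_def)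
  then show ?thesis using I(1) F unfolding invertible_ideal_def by blast
qed

end

text \<open>At each maximal ideal one generator \<open>a\<close> divides the others up to a
  multiplier \<open>s\<close>; the colon ideal of \<open>PIdl a\<close> by \<open>s\<close> then
  contains all of \<open>Idl S\<close>.\<close>

theorem (in isp_domain) isp_pruefer: "pruefer_domain R"
proof (intro pruefer_domain.intro pruefer_domain_axioms.intro domain_axioms)
  fix S assume S: "S \<subseteq> carrier R" "finite S" "Idl S \<noteq> {\<zero>}"
  have "S \<noteq> {}"
  proof
    assume "S = {}"
    then have "Idl S \<subseteq> {\<zero>}" using genideal_minimal[OF zeroideal] by simp
    then show False using S ideal_zero[OF genideal_ideal[OF S(1)]] by blast
  qed
  show "invertible_ideal R (Idl S)"
  proof (rule invertible_ideal_if_locally_principal[OF genideal_ideal[OF S(1)] S(3)])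
    fix M assume M: "maximalideal M R"
    then have P: "primeideal M R" by (rule maximalideal_prime)
    obtain a s where a: "a \<in> S" "s \<in> carrier R - M" "\<And>b. b \<in> S \<Longrightarrow> s \<otimes> b \<in> PIdl a"
      using locally_principal_finite[OF P S(2) \<open>S \<noteq> {}\<close> S(1)] by blast
    have c: "a \<in> carrier R" "s \<in> carrier R" using a S by auto
    have "Idl S \<subseteq> {x \<in> carrier R. s \<otimes> x \<in> PIdl a}"
      using genideal_minimal[OF ideal_colon[OF cgenideal_ideal[OF c(1)] c(2)]] a(3) S(1) by blast
    then show "\<exists>a\<in>Idl S. \<exists>s\<in>carrier R - M. \<forall>x\<in>Idl S. s \<otimes> x \<in> PIdl a"
      using a genideal_self[OF S(1)] by blast
  qed
qed

text \<open>This set is the contraction of the extension of \<open>I\<close> to the localization at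
  \<open>P\<close>.\<close>

lemma (in prime_localization) ideal_saturation:
  assumes I: "ideal I R"
  shows "ideal {x \<in> carrier R. \<exists>s\<in>carrier R - P. s \<otimes> x \<in> I} R" (is "ideal ?T R")
proof (rule ideal_of_closed)
  show "\<zero> \<in> ?T" using S_one ideal_zero[OF I] by (auto intro!: bexI[of _ \<one>])
  fix x assume "x \<in> ?T"
  then obtain s where s: "x \<in> carrier R" "s \<in> carrier R - P" "s \<otimes> x \<in> I" by blast
  {
    fix y assume "y \<in> ?T"
    then obtain t where t: "y \<in> carrier R" "t \<in> carrier R - P" "t \<otimes> y \<in> I" by blast
    have "t \<otimes> (s \<otimes> x) \<oplus> s \<otimes> (t \<otimes> y) \<in> I"
      using s(2) t(2) by (intro ideal_add_closed[OF I] ideal.I_l_closed[OF I] s(3) t(3)) auto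
    moreover have "t \<otimes> (s \<otimes> x) \<oplus> s \<otimes> (t \<otimes> y) = (s \<otimes> t) \<otimes> (x \<oplus> y)"
      using s t by (simp add: r_distr m_ac)
    ultimately show "x \<oplus> y \<in> ?T" using S_mult[OF s(2) t(2)] s(1) t(1) by auto
  next
    fix r assume r: "r \<in> carrier R"
    have "(s \<otimes> x) \<otimes> r \<in> I" using ideal.I_r_closed[OF I s(3) r] .
    then show "x \<otimes> r \<in> ?T" using s r by (auto simp: m_assoc)
  }
qed auto

text \<open>Locally at \<open>P\<close>, the ideal \<open>P\<close> is generated by \<open>q\<close>
  and its square by \<open>q \<otimes> q\<close>. If \<open>P\<close> were idempotent, some
  \<open>s \<otimes> q\<close> with \<open>s \<notin> P\<close> would be a multiple of
  \<open>q \<otimes> q\<close>, and cancelling \<open>q\<close> would put \<open>s\<close> into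
  \<open>P\<close>.\<close>

theorem (in isp_domain) isp_strongly_discrete: "strongly_discrete R"
  unfolding strongly_discrete_def
proof (intro allI impI notI, elim conjE)
  fix P assume P: "primeideal P R" "P \<noteq> {\<zero>}" "P \<cdot> P = P"
  interpret prime_localization P R
    using P domain_axioms by (intro prime_localization.intro)
  obtain q where q: "q \<in> P" "q \<noteq> \<zero>" "\<And>a. a \<in> P \<Longrightarrow> \<exists>s\<in>carrier R - P. s \<otimes> a \<in> PIdl q"
    using local_generator[OF P(1,2)] by blast
  have qc: "q \<in> carrier R" using q Icarr by blast
  let ?T = "{x \<in> carrier R. \<exists>s\<in>carrier R - P. s \<otimes> x \<in> PIdl (q \<otimes> q)}"
  have "ideal ?T R" using qc by (intro ideal_saturation cgenideal_ideal) simp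
  moreover have "a \<otimes> b \<in> ?T" if ab: "a \<in> P" "b \<in> P" for a b
  proof -
    obtain s t where s: "s \<in> carrier R - P" "s \<otimes> a \<in> PIdl q" and t: "t \<in> carrier R - P" "t \<otimes> b \<in> PIdl q"
      using q(3)[OF ab(1)] q(3)[OF ab(2)] by blast
    obtain c d where c: "c \<in> carrier R" "s \<otimes> a = q \<otimes> c" and d: "d \<in> carrier R" "t \<otimes> b = q \<otimes> d"
      using s t qc by (auto simp: mem_PIdl_iff)
    have "(s \<otimes> t) \<otimes> (a \<otimes> b) = (s \<otimes> a) \<otimes> (t \<otimes> b)" using s t ab Icarr by (simp add: m_ac)
    also have "\<dots> = (q \<otimes> q) \<otimes> (c \<otimes> d)" unfolding c(2) d(2) using qc c(1) d(1) by (simp add: m_ac)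
    finally have "(s \<otimes> t) \<otimes> (a \<otimes> b) \<in> PIdl (q \<otimes> q)" using qc c(1) d(1) by (auto simp: mem_PIdl_iff)
    then show ?thesis using S_mult[OF s(1) t(1)] Icarr[OF ab(1)] Icarr[OF ab(2)] by blast
  qed
  ultimately have "P \<cdot> P \<subseteq> ?T" by (rule ideal_prod_minimal)
  then obtain s where s: "s \<in> carrier R - P" "s \<otimes> q \<in> PIdl (q \<otimes> q)" using q(1) unfolding P(3) by blast
  then obtain r where r: "r \<in> carrier R" "s \<otimes> q = q \<otimes> q \<otimes> r" using qc by (auto simp: mem_PIdl_iff)
  then have "q \<otimes> s = q \<otimes> (q \<otimes> r)" using qc s(1) by (simp add: m_ac)
  then have "s = q \<otimes> r" using q(2) qc s r(1) by (simp add: m_lcancel)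
  then show False using s I_r_closed[OF q(1) r(1)] by simp
qed

section \<open>Maximal ideals above a nonzero prime\<close>

lemma (in ring) foldl_ideal_prod_subset_prime:
  assumes P: "primeideal P R" and J: "ideal J R" and Qs: "\<forall>Q\<in>set Qs. ideal Q R"
    and sub: "foldl (ideal_prod R) J Qs \<subseteq> P"
  shows "J \<subseteq> P \<or> (\<exists>Q\<in>set Qs. Q \<subseteq> P)"
  using Qs sub
proof (induction Qs rule: rev_induct)
  case (snoc Q Qs)
  interpret cring R using P by (simp add: primeideal_def)
  have "ideal (foldl (ideal_prod R) J Qs) R"
    using foldl_ideal_prod_ideal[OF J, of Qs] snoc.prems by simp
  then have "foldl (ideal_prod R) J Qs \<subseteq> P \<or> Q \<subseteq> P"
    using primeideal_divides_ideal_prod[OF P] snoc.prems by simp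
  then show ?case using snoc by auto
qed simp

text \<open>A factor \<open>Q\<close> that is locally contained in \<open>tQ\<close> passes this on
  to the whole product, since \<open>t\<close> can be moved out of that factor.\<close>

lemma (in prime_localization) foldl_ideal_prod_locally_divisible:
  assumes t: "t \<in> carrier R" and J: "ideal J R" and Qs: "\<forall>Q\<in>set Qs. ideal Q R" "Q \<in> set Qs"
    and Q: "\<forall>a\<in>Q. \<exists>s\<in>carrier R - P. s \<otimes> a \<in> (\<otimes>) t ` Q"
  shows "foldl (ideal_prod R) J Qs
    \<subseteq> {x \<in> carrier R. \<exists>s\<in>carrier R - P. s \<otimes> x \<in> (\<otimes>) t ` foldl (ideal_prod R) J Qs}"
  using Qs
proof (induction Qs rule: rev_induct)
  case (snoc U Qs)
  let ?V = "foldl (ideal_prod R) J Qs"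
  have U: "ideal U R" and V: "ideal ?V R"
    using snoc.prems foldl_ideal_prod_ideal[OF J, of Qs] by auto
  have VU: "ideal (?V \<cdot> U) R" using V U by (rule ideal_prod_is_ideal)
  have "?V \<cdot> U \<subseteq> {x \<in> carrier R. \<exists>s\<in>carrier R - P. s \<otimes> x \<in> (\<otimes>) t ` (?V \<cdot> U)}"
  proof (rule ideal_prod_minimal[OF ideal_saturation[OF ideal_image_mult[OF VU t]]])
    fix v u assume vu: "v \<in> ?V" "u \<in> U"
    have c: "v \<in> carrier R" "u \<in> carrier R" using vu ideal.Icarr[OF V] ideal.Icarr[OF U] by auto
    have "\<exists>s\<in>carrier R - P. \<exists>w\<in>?V \<cdot> U. s \<otimes> (v \<otimes> u) = t \<otimes> w"
    proof (cases "U = Q")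
      case True
      then obtain s b where s: "s \<in> carrier R - P" "b \<in> U" "s \<otimes> u = t \<otimes> b" using Q vu(2) by blast
      have b: "b \<in> carrier R" using s(2) ideal.Icarr[OF U] by blast
      have "s \<otimes> (v \<otimes> u) = v \<otimes> (s \<otimes> u)" using c s(1) by (simp add: m_lcomm)
      also have "\<dots> = t \<otimes> (v \<otimes> b)" unfolding s(3) using c t b by (simp add: m_lcomm)
      finally show ?thesis using s(1) ideal_prod.prod[OF vu(1) s(2), of R] by blast
    next
      case False
      then have "Q \<in> set Qs" using snoc.prems by auto
      then obtain s w where s: "s \<in> carrier R - P" "w \<in> ?V" "s \<otimes> v = t \<otimes> w"
        using snoc.IH snoc.prems vu(1) by auto
      have w: "w \<in> carrier R" using s(2) ideal.Icarr[OF V] by blast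
      have "s \<otimes> (v \<otimes> u) = (s \<otimes> v) \<otimes> u" using c s(1) by (simp add: m_assoc)
      also have "\<dots> = t \<otimes> (w \<otimes> u)" unfolding s(3) using c t w by (simp add: m_assoc)
      finally show ?thesis using s(1) ideal_prod.prod[OF s(2) vu(2), of R] by blast
    qed
    then show "v \<otimes> u \<in> {x \<in> carrier R. \<exists>s\<in>carrier R - P. s \<otimes> x \<in> (\<otimes>) t ` (?V \<cdot> U)}"
      using c by blast
  qed
  then show ?case by simp
qed simp

context isp_domain begin

text \<open>Local comparability with \<open>t\<close> is used twice: it gives
  \<open>s a = t d\<close> and then \<open>u d = t c\<close>, the reverse divisibilities being
  excluded by primality of \<open>P\<close>. The square of \<open>u d\<close> is a multiple of
  \<open>t d \<in> Q\<close>, so radicality puts \<open>u d\<close> into \<open>Q\<close>, and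
  \<open>u s a = t (u d)\<close>.\<close>

lemma radical_locally_divisible:
  assumes M: "primeideal M R" and P: "primeideal P R" "P \<subseteq> M"
    and Q: "radical_ideal R Q" "Q \<subseteq> P" and t: "t \<in> carrier R - P" and a: "a \<in> Q"
  shows "\<exists>s\<in>carrier R - M. s \<otimes> a \<in> (\<otimes>) t ` Q"
proof -
  have PL: "prime_localization M R" "prime_localization P R"
    using M P domain_axioms by (auto intro: prime_localization.intro)
  note Qi = radical_ideal_ideal[OF Q(1)]
  have ac: "a \<in> carrier R" and tc: "t \<in> carrier R" using a ideal.Icarr[OF Qi] t by auto
  obtain s where s: "s \<in> carrier R - M" "s \<otimes> a \<in> PIdl t \<or> s \<otimes> t \<in> PIdl a"
    using locally_comparable[OF M ac tc] by blast
  have SP: "x \<in> carrier R - P" if "x \<in> carrier R - M" for x using that P(2) by blast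
  have "s \<otimes> t \<notin> PIdl a"
    using cgenideal_minimal[OF Qi a] Q(2) prime_localization.S_mult[OF PL(2) SP[OF s(1)] t] by blast
  then obtain d where d: "d \<in> carrier R" "s \<otimes> a = t \<otimes> d" using s(2) tc by (auto simp: mem_PIdl_iff)
  have td: "t \<otimes> d \<in> Q" using d(2) ideal.I_l_closed[OF Qi a] s(1) by (metis DiffD1)
  obtain u where u: "u \<in> carrier R - M" "u \<otimes> d \<in> PIdl t \<or> u \<otimes> t \<in> PIdl d"
    using locally_comparable[OF M d(1) tc] by blast
  have uc: "u \<in> carrier R" using u by blast
  \<comment> \<open>Multiplying by \<open>t\<close> once more brings in the element
    \<open>t \<otimes> d\<close> of \<open>Q \<subseteq> P\<close>, where primality of
    \<open>P\<close> applies.\<close>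
  have "u \<otimes> t \<notin> PIdl d"
  proof
    assume "u \<otimes> t \<in> PIdl d"
    then obtain c where c: "c \<in> carrier R" "u \<otimes> t = d \<otimes> c" using d by (auto simp: mem_PIdl_iff)
    have "(u \<otimes> t) \<otimes> t = (t \<otimes> d) \<otimes> c" unfolding c(2) using tc d(1) c(1) by (simp add: m_ac)
    then have "(u \<otimes> t) \<otimes> t \<in> P" using ideal.I_r_closed[OF Qi td c(1)] Q(2) by auto
    moreover have "(u \<otimes> t) \<otimes> t \<in> carrier R - P"
      using prime_localization.S_mult[OF PL(2)] SP[OF u(1)] t by blast
    ultimately show False by blast
  qed
  then obtain c where c: "c \<in> carrier R" "u \<otimes> d = t \<otimes> c" using u(2) tc by (auto simp: mem_PIdl_iff)
  have "(u \<otimes> d) \<otimes> (u \<otimes> d) = (t \<otimes> c) \<otimes> (u \<otimes> d)" by (simp only: c(2))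
  also have "\<dots> = (t \<otimes> d) \<otimes> (c \<otimes> u)" using tc c(1) uc d(1) by (simp add: m_ac)
  also have "\<dots> \<in> Q" using ideal.I_r_closed[OF Qi td] c(1) uc by simp
  finally have "u \<otimes> d \<in> Q" using radical_ideal_square[OF Q(1), of "u \<otimes> d"] uc d(1) by simp
  moreover have "(u \<otimes> s) \<otimes> a = t \<otimes> (u \<otimes> d)"
  proof -
    have "(u \<otimes> s) \<otimes> a = u \<otimes> (s \<otimes> a)" using uc s(1) ac by (simp add: m_assoc)
    also have "\<dots> = t \<otimes> (u \<otimes> d)" unfolding d(2) using uc tc d(1) by (simp add: m_lcomm)
    finally show ?thesis .
  qed
  ultimately show ?thesis using prime_localization.S_mult[OF PL(1) u(1) s(1)] by blast
qed

text \<open>\<open>P'\<close> is the contraction of the maximal ideal of the ring generated by the localizations at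
  \<open>M1\<close> and \<open>M2\<close>, which is a valuation ring as it contains one.\<close>

lemma inter_branch_prime:
  assumes M: "primeideal M1 R" "primeideal M2 R"
  defines "S \<equiv> {s1 \<otimes> s2 | s1 s2. s1 \<in> carrier R - M1 \<and> s2 \<in> carrier R - M2}"
  defines "P' \<equiv> {a \<in> carrier R. \<forall>b\<in>carrier R. a \<otimes> b \<notin> S}"
  shows "primeideal P' R" "P' \<subseteq> M1" "P' \<subseteq> M2"
proof -
  have PL: "prime_localization M1 R" "prime_localization M2 R"
    using M domain_axioms by (auto intro: prime_localization.intro)
  note S_one = prime_localization.S_one[OF PL(1)] prime_localization.S_one[OF PL(2)]
  note S_mult = prime_localization.S_mult[OF PL(1)] prime_localization.S_mult[OF PL(2)]
  have S_memI: "s1 \<otimes> s2 \<in> S" if "s1 \<in> carrier R - M1" "s2 \<in> carrier R - M2" for s1 s2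
    using that by (auto simp: S_def)
  have S_prod: "x \<otimes> y \<in> S" if "x \<in> S" "y \<in> S" for x y
  proof -
    obtain s1 s2 t1 t2 where s: "s1 \<in> carrier R - M1" "s2 \<in> carrier R - M2" "x = s1 \<otimes> s2"
      and t: "t1 \<in> carrier R - M1" "t2 \<in> carrier R - M2" "y = t1 \<otimes> t2"
      using \<open>x \<in> S\<close> \<open>y \<in> S\<close> unfolding S_def by blast
    have "x \<otimes> y = (s1 \<otimes> t1) \<otimes> (s2 \<otimes> t2)" using s t by (simp add: m_ac)
    then show ?thesis using S_memI S_mult s t by simp
  qed
  have S1: "s \<in> S" if "s \<in> carrier R - M1" for s
    using S_memI[OF that S_one(2)] that by simp
  have S2: "s \<in> S" if "s \<in> carrier R - M2" for s
    using S_memI[OF S_one(1) that] that by simp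
  have zS: "\<zero> \<notin> S"
  proof
    assume "\<zero> \<in> S"
    then obtain s1 s2 where s: "s1 \<in> carrier R - M1" "s2 \<in> carrier R - M2" "s1 \<otimes> s2 = \<zero>"
      unfolding S_def by auto
    have "s1 \<in> carrier R - {\<zero>}" "s2 \<in> carrier R - {\<zero>}"
      using prime_localization.S_nonzero[OF PL(1) s(1)] prime_localization.S_nonzero[OF PL(2) s(2)] by blast+
    then show False using integral[OF s(3)] by simp
  qed
  \<comment> \<open>Closure of \<open>P'\<close> under sums rests on comparability at
    \<open>M1\<close>: if \<open>a\<close> divides \<open>s \<otimes> b\<close>, then
    \<open>s\<close> times a multiple of \<open>a \<oplus> b\<close> is a multiple of
    \<open>a\<close>, and \<open>S\<close> is closed under multiplication by
    \<open>s\<close>.\<close>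
  have add: "(a \<oplus> b) \<otimes> d \<notin> S"
    if ab: "a \<in> P'" "b \<in> carrier R" "d \<in> carrier R" "s \<in> carrier R - M1" "s \<otimes> b \<in> PIdl a" for a b d s
  proof
    assume "(a \<oplus> b) \<otimes> d \<in> S"
    then have sS: "s \<otimes> ((a \<oplus> b) \<otimes> d) \<in> S" using S_prod[OF S1[OF ab(4)]] by blast
    have ac: "a \<in> carrier R" using ab(1) by (simp add: P'_def)
    obtain c where c: "c \<in> carrier R" "s \<otimes> b = a \<otimes> c" using ab(5) mem_PIdl_iff[OF ac] by blast
    have "s \<otimes> ((a \<oplus> b) \<otimes> d) = a \<otimes> (s \<otimes> d) \<oplus> (s \<otimes> b) \<otimes> d"
      using ac ab(2-4) by (simp add: l_distr r_distr m_ac)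
    also have "\<dots> = a \<otimes> (s \<otimes> d \<oplus> c \<otimes> d)"
      unfolding c(2) using ac ab(3,4) c(1) by (simp add: r_distr m_assoc)
    finally show False using sS ab(1,3,4) c(1) by (simp add: P'_def)
  qed
  have "ideal P' R"
  proof (rule ideal_of_closed)
    show "\<zero> \<in> P'" using zS by (simp add: P'_def)
    show "x \<otimes> r \<in> P'" if "x \<in> P'" "r \<in> carrier R" for x r
      using that by (simp add: P'_def m_assoc)
    show "x \<oplus> y \<in> P'" if xy: "x \<in> P'" "y \<in> P'" for x y
    proof -
      have c: "x \<in> carrier R" "y \<in> carrier R" using xy by (simp_all add: P'_def)
      obtain s where s: "s \<in> carrier R - M1" "s \<otimes> x \<in> PIdl y \<or> s \<otimes> y \<in> PIdl x"
        using locally_comparable[OF M(1) c] by blast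
      then have "(x \<oplus> y) \<otimes> d \<notin> S" if "d \<in> carrier R" for d
        using add[OF xy(1) c(2) that s(1)] add[OF xy(2) c(1) that s(1)] a_comm[OF c] by auto
      then show ?thesis using c by (simp add: P'_def)
    qed
  qed (auto simp: P'_def)
  then show "primeideal P' R"
  proof (rule primeidealI[OF _ is_cring])
    have "\<one> \<notin> P'" using S1[OF S_one(1)] by (auto simp: P'_def)
    then show "carrier R \<noteq> P'" by blast
    fix a b assume ab: "a \<in> carrier R" "b \<in> carrier R" "a \<otimes> b \<in> P'"
    show "a \<in> P' \<or> b \<in> P'"
    proof (rule ccontr)
      assume "\<not> ?thesis"
      then obtain c d where c: "c \<in> carrier R" "a \<otimes> c \<in> S" and d: "d \<in> carrier R" "b \<otimes> d \<in> S"
        using ab by (auto simp: P'_def)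
      have "(a \<otimes> c) \<otimes> (b \<otimes> d) = (a \<otimes> b) \<otimes> (c \<otimes> d)" using ab c d by (simp add: m_ac)
      then show False using S_prod[OF c(2) d(2)] ab(3) c(1) d(1) by (simp add: P'_def)
    qed
  qed
  have "a \<notin> S" if "a \<in> P'" for a
  proof -
    have "a \<otimes> \<one> \<notin> S" "a \<in> carrier R" using that one_closed unfolding P'_def by blast+
    then show ?thesis by simp
  qed
  then show "P' \<subseteq> M1" "P' \<subseteq> M2" using S1 S2 by (auto simp: P'_def)
qed

text \<open>The ideal \<open>I\<close> below lies in the prime \<open>P'\<close>, hence so does its
  invertible factor or one of its radical factors. The first is refuted at \<open>M2\<close> by an
  element of \<open>M2\<close> outside \<open>P'\<close>, the second at \<open>M1\<close> by an
  element of \<open>M1\<close> outside \<open>P'\<close>.\<close>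

theorem isp_prime_subset_unique_maximal:
  assumes P: "primeideal P R" "P \<noteq> {\<zero>}"
    and M: "maximalideal M1 R" "P \<subseteq> M1" "maximalideal M2 R" "P \<subseteq> M2"
  shows "M1 = M2"
proof (rule ccontr)
  assume neq: "M1 \<noteq> M2"
  have pM: "primeideal M1 R" "primeideal M2 R" using M maximalideal_prime by blast+
  define S where "S = {s1 \<otimes> s2 | s1 s2. s1 \<in> carrier R - M1 \<and> s2 \<in> carrier R - M2}"
  define P' where "P' = {a \<in> carrier R. \<forall>b\<in>carrier R. a \<otimes> b \<notin> S}"
  have P': "primeideal P' R" "P' \<subseteq> M1" "P' \<subseteq> M2"
    unfolding P'_def S_def by (rule inter_branch_prime[OF pM])+
  have PL: "prime_localization M1 R" "prime_localization M2 R" "prime_localization P' R"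
    using pM P'(1) domain_axioms by (auto intro: prime_localization.intro)
  note P'i = primeideal.axioms(1)[OF P'(1)]
  note P'_Icarr = ideal.Icarr[OF P'i]
  note P'_mult = prime_localization.S_mult[OF PL(3)]
  \<comment> \<open>If a multiple of an element of \<open>P\<close> were
    \<open>s1 \<otimes> s2\<close> in \<open>S\<close>, then \<open>s1\<close> or \<open>s2\<close>
    would lie in \<open>P\<close>, which is contained in both maximal ideals.\<close>
  have "P \<subseteq> P'"
  proof
    fix a assume a: "a \<in> P"
    note Pi = primeideal.axioms(1)[OF P(1)]
    have "a \<otimes> b \<notin> S" if "b \<in> carrier R" for b
    proof
      assume "a \<otimes> b \<in> S"
      then obtain s1 s2 where s: "s1 \<in> carrier R - M1" "s2 \<in> carrier R - M2" "a \<otimes> b = s1 \<otimes> s2"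
        unfolding S_def by blast
      have "s1 \<otimes> s2 \<in> P" using ideal.I_r_closed[OF Pi a that] s(3) by simp
      then have "s1 \<in> P \<or> s2 \<in> P" using primeideal.I_prime[OF P(1), of s1 s2] s(1,2) by blast
      then show False using s(1,2) M(2,4) by blast
    qed
    then show "a \<in> P'" using ideal.Icarr[OF Pi a] by (simp add: P'_def)
  qed
  then have P'0: "P' \<noteq> {\<zero>}" using P(2) ideal_zero[OF primeideal.axioms(1)[OF P(1)]] by blast
  have max: "M = N" if "maximalideal M R" "maximalideal N R" "M \<subseteq> N" for M N
  proof -
    interpret N: maximalideal N R by (rule that(2))
    show ?thesis
      using maximalideal.I_maximal[OF that(1) N.is_ideal that(3)] N.I_notcarr N.a_subset by blast
  qed
  \<comment> \<open>Distinct maximal ideals are incomparable, and \<open>P'\<close> lies in both;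
    this provides the elements \<open>t1\<close> and \<open>t2\<close>.\<close>
  have "\<not> M1 \<subseteq> P'" using max[OF M(1,3)] neq P'(3) by blast
  moreover have "\<not> M2 \<subseteq> P'" using max[OF M(3,1)] neq P'(2) by blast
  ultimately obtain t1 t2 where t: "t1 \<in> M1" "t1 \<notin> P'" "t2 \<in> M2" "t2 \<notin> P'" by blast
  have tc: "t1 \<in> carrier R - P'" "t2 \<in> carrier R - P'"
    using t ideal.Icarr[OF primeideal.axioms(1)[OF pM(1)]] ideal.Icarr[OF primeideal.axioms(1)[OF pM(2)]] by auto
  obtain q where q: "q \<in> P'" "q \<noteq> \<zero>" "\<And>a. a \<in> P' \<Longrightarrow> \<exists>s\<in>carrier R - P'. s \<otimes> a \<in> PIdl q"
    using local_generator[OF P'(1) P'0] by blast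
  have qc: "q \<in> carrier R" using q(1) by (rule P'_Icarr)
  \<comment> \<open>Locally at \<open>M1\<close> this ideal is generated by \<open>q\<close>, but
    locally at \<open>M2\<close> it is all of \<open>P'\<close>, because every element outside
    \<open>P'\<close> has a multiple in \<open>S\<close>.\<close>
  define I where "I = {x \<in> carrier R. \<exists>s\<in>carrier R - M1. s \<otimes> x \<in> PIdl q}"
  have Ii: "ideal I R"
    unfolding I_def by (rule prime_localization.ideal_saturation[OF PL(1) cgenideal_ideal[OF qc]])
  have qI: "q \<in> I"
    using qc cgenideal_self[OF qc] prime_localization.S_one[OF PL(1)]
    by (auto simp: I_def intro!: bexI[of _ \<one>])
  have IP': "I \<subseteq> P'"
  proof
    fix x assume "x \<in> I"
    then obtain s where s: "x \<in> carrier R" "s \<in> carrier R - M1" "s \<otimes> x \<in> PIdl q" by (auto simp: I_def)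
    then have "s \<otimes> x \<in> P'" using cgenideal_minimal[OF P'i q(1)] by blast
    then show "x \<in> P'" using P'_mult[of s x] s P'(2) by blast
  qed
  have "saturated M1 I"
    unfolding saturated_def
  proof (intro ballI impI)
    fix s a assume s: "s \<in> carrier R - M1" "a \<in> carrier R" "s \<otimes> a \<in> I"
    then obtain u where u: "u \<in> carrier R - M1" "u \<otimes> (s \<otimes> a) \<in> PIdl q" by (auto simp: I_def)
    then have "(u \<otimes> s) \<otimes> a \<in> PIdl q" using s by (simp add: m_assoc)
    then show "a \<in> I" using prime_localization.S_mult[OF PL(1) u(1) s(1)] s(2) by (auto simp: I_def)
  qed
  moreover have "I \<noteq> {\<zero>}" using qI q(2) by blast
  moreover have "I \<subseteq> M1" using IP' P'(2) by blast
  ultimately obtain J Qs where J: "invertible_ideal R J" and Qs: "\<forall>Q\<in>set Qs. radical_ideal R Q \<and> Q \<subseteq> M1"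
    and e: "I = foldl (ideal_prod R) J Qs"
    using saturated_factorization[OF pM(1) Ii] by blast
  note Ji = invertible_ideal_ideal[OF J]
  have Qi: "\<forall>Q\<in>set Qs. ideal Q R" using Qs radical_ideal_ideal by blast
  have IJ: "I \<subseteq> J" unfolding e by (rule foldl_ideal_prod_subset[OF Ji Qi])
  from foldl_ideal_prod_subset_prime[OF P'(1) Ji Qi] IP' e
  consider "J \<subseteq> P'" | Q where "Q \<in> set Qs" "Q \<subseteq> P'" by blast
  then show False
  proof cases
    \<comment> \<open>At \<open>M2\<close>, \<open>J\<close> is generated by \<open>j\<close>. Since
      \<open>t2 \<notin> P'\<close> divides \<open>j\<close> there with a quotient
      \<open>d \<in> P'\<close>, and \<open>P'\<close> is locally contained in \<open>I\<close> and
      hence in \<open>J\<close>, \<open>j\<close> in turn divides \<open>d\<close>. Thus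
      \<open>t2\<close> would be a unit at \<open>M2\<close>, although it lies in
      \<open>M2\<close>.\<close>
    case 1
    obtain j s where j: "j \<in> J" "s \<in> carrier R - M2" "\<And>x. x \<in> J \<Longrightarrow> s \<otimes> x \<in> PIdl j"
      using invertible_ideal_locally_principal[OF J pM(2)] by blast
    have jc: "j \<in> carrier R" using j(1) ideal.Icarr[OF Ji] by blast
    have sc: "s \<in> carrier R" "s \<noteq> \<zero>"
      using j(2) prime_localization.S_nonzero[OF PL(2)] by blast+
    have "j \<noteq> \<zero>"
    proof
      assume "j = \<zero>"
      then have "s \<otimes> q = \<zero>" using j(3)[of q] qI IJ by (auto simp: PIdl_zero)
      then show False using integral[OF _ sc(1) qc] sc(2) q(2) by blast
    qed
    obtain u where u: "u \<in> carrier R - M2" "u \<otimes> j \<in> PIdl t2 \<or> u \<otimes> t2 \<in> PIdl j"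
      using locally_comparable[OF pM(2) jc, of t2] tc by blast
    have "u \<otimes> t2 \<notin> PIdl j"
      using cgenideal_minimal[OF P'i, of j] 1 j(1) P'_mult[of u t2] u(1) tc(2) P'(3) by blast
    then obtain d where d: "d \<in> carrier R" "u \<otimes> j = t2 \<otimes> d" using u(2) tc by (auto simp: mem_PIdl_iff)
    have "t2 \<otimes> d \<in> P'"
      unfolding d(2)[symmetric] using 1 j(1) u(1) by (intro ideal.I_l_closed[OF P'i]) auto
    then have "d \<in> P'" using P'_mult[OF tc(2), of d] d(1) by blast
    then obtain c where c: "c \<in> carrier R - P'" "c \<otimes> d \<in> PIdl q" using q(3) by blast
    \<comment> \<open>The multiplier \<open>c\<close> is enlarged to \<open>s1 \<otimes> s2\<close>
      in \<open>S\<close>: the saturation in \<open>I\<close> absorbs \<open>s1\<close>, and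
      \<open>s2\<close> is an admissible multiplier at \<open>M2\<close>.\<close>
    then obtain b where b: "b \<in> carrier R" "c \<otimes> b \<in> S" by (auto simp: P'_def)
    then obtain s1 s2 where s12: "s1 \<in> carrier R - M1" "s2 \<in> carrier R - M2" "c \<otimes> b = s1 \<otimes> s2"
      unfolding S_def by blast
    have "s1 \<otimes> (s2 \<otimes> d) = (s1 \<otimes> s2) \<otimes> d" using s12(1,2) d(1) by (simp add: m_assoc)
    also have "\<dots> = b \<otimes> (c \<otimes> d)" unfolding s12(3)[symmetric] using b(1) c(1) d(1) by (simp add: m_ac)
    also have "\<dots> \<in> PIdl q" using ideal.I_l_closed[OF cgenideal_ideal[OF qc] c(2) b(1)] .
    finally have "s2 \<otimes> d \<in> I" using s12(1,2) d(1) by (auto simp: I_def)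
    then have "s \<otimes> (s2 \<otimes> d) \<in> PIdl j" using j(3) IJ by blast
    then obtain f where f: "f \<in> carrier R" "s \<otimes> (s2 \<otimes> d) = j \<otimes> f" using jc by (auto simp: mem_PIdl_iff)
    have "j \<otimes> (u \<otimes> (s \<otimes> s2)) = (u \<otimes> j) \<otimes> (s \<otimes> s2)" using jc u(1) sc(1) s12(2) by (simp add: m_ac)
    also have "\<dots> = t2 \<otimes> (s \<otimes> (s2 \<otimes> d))" unfolding d(2) using tc d(1) sc(1) s12(2) by (simp add: m_ac)
    also have "\<dots> = j \<otimes> (t2 \<otimes> f)" unfolding f(2) using tc jc f(1) by (simp add: m_lcomm)
    finally have "u \<otimes> (s \<otimes> s2) = t2 \<otimes> f"
      using \<open>j \<noteq> \<zero>\<close> jc u(1) sc(1) s12(2) tc f(1) by (simp add: m_lcancel)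
    moreover have "t2 \<otimes> f \<in> M2" using ideal.I_r_closed[OF primeideal.axioms(1)[OF pM(2)] t(3) f(1)] .
    moreover have "u \<otimes> (s \<otimes> s2) \<in> carrier R - M2"
      using prime_localization.S_mult[OF PL(2)] u(1) j(2) s12(2) by blast
    ultimately show False by simp
  next
    \<comment> \<open>Locally at \<open>M1\<close>, the factor \<open>Q\<close>, and with it
      \<open>I\<close>, is divisible by \<open>t1\<close>. As \<open>q\<close> generates
      \<open>I\<close> there, \<open>q\<close> would be a multiple of \<open>t1 \<otimes> q\<close>,
      making \<open>t1 \<in> M1\<close> a unit at \<open>M1\<close>.\<close>
    case 2
    have "\<forall>a\<in>Q. \<exists>s\<in>carrier R - M1. s \<otimes> a \<in> (\<otimes>) t1 ` Q"
      using radical_locally_divisible[OF pM(1) P'(1,2) _ 2(2) tc(1)] Qs 2(1) by blast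
    then have "I \<subseteq> {x \<in> carrier R. \<exists>s\<in>carrier R - M1. s \<otimes> x \<in> (\<otimes>) t1 ` I}"
      unfolding e using prime_localization.foldl_ideal_prod_locally_divisible[OF PL(1) _ Ji Qi 2(1)] tc(1) by blast
    then obtain s i where s: "s \<in> carrier R - M1" "i \<in> I" "s \<otimes> q = t1 \<otimes> i" using qI by blast
    then obtain u where u: "i \<in> carrier R" "u \<in> carrier R - M1" "u \<otimes> i \<in> PIdl q" by (auto simp: I_def)
    then obtain r where r: "r \<in> carrier R" "u \<otimes> i = q \<otimes> r" using qc by (auto simp: mem_PIdl_iff)
    have "q \<otimes> (u \<otimes> s) = u \<otimes> (s \<otimes> q)" using qc u(2) s(1) by (simp add: m_ac)
    also have "\<dots> = t1 \<otimes> (u \<otimes> i)" unfolding s(3) using tc u(1,2) by (simp add: m_lcomm)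
    also have "\<dots> = q \<otimes> (t1 \<otimes> r)" unfolding r(2) using tc qc r(1) by (simp add: m_lcomm)
    finally have "u \<otimes> s = t1 \<otimes> r" using q(2) qc u(2) s(1) tc r(1) by (simp add: m_lcancel)
    moreover have "t1 \<otimes> r \<in> M1" using ideal.I_r_closed[OF primeideal.axioms(1)[OF pM(1)] t(1) r(1)] .
    moreover have "u \<otimes> s \<in> carrier R - M1" using prime_localization.S_mult[OF PL(1) u(2) s(1)] .
    ultimately show False by simp
  qed
qed

text \<open>All multipliers outside the only maximal ideal are units, so numerator and denominator
  of a fraction are comparable in the ring itself.\<close>

theorem isp_local_valuation:
  assumes "local_domain R"
  shows "valuation_domain R"
proof (intro valuation_domain.intro valuation_domain_axioms.intro domain_axioms)
  let ?K = "quot_field R"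
  interpret K: field ?K by (rule field_quot_field)
  obtain M where M: "maximalideal M R" "\<And>N. maximalideal N R \<Longrightarrow> N = M"
    using local_domain.unique_maximal[OF assms] by blast
  have unit: "s \<in> Units R" if s: "s \<in> carrier R - M" for s
  proof -
    have sc: "s \<in> carrier R" using s by blast
    have "PIdl s = carrier R"
    proof (rule ccontr)
      assume "PIdl s \<noteq> carrier R"
      then have "PIdl s \<subseteq> M" using ex_maximalideal[OF cgenideal_ideal[OF sc]] M(2) by blast
      then show False using cgenideal_self[OF sc] s by blast
    qed
    then obtain r where "r \<in> carrier R" "\<one> = s \<otimes> r" using mem_PIdl_iff[OF sc, of \<one>] by auto
    then show ?thesis using unit_factor[of s r] sc Units_one_closed by simp
  qed
  have dvd: "x \<in> PIdl y" if "s \<in> carrier R - M" "x \<in> carrier R" "y \<in> carrier R" "s \<otimes> x \<in> PIdl y" for s x y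
  proof -
    have "inv s \<otimes> (s \<otimes> x) \<in> PIdl y"
      using that unit ideal.I_l_closed[OF cgenideal_ideal[OF that(3)]] by simp
    then show ?thesis using that unit by (simp flip: m_assoc)
  qed
  fix x assume x: "x \<in> carrier ?K" "x \<noteq> \<zero>\<^bsub>?K\<^esub>"
  then obtain a b where ab: "a \<in> carrier R" "b \<in> carrier R - {\<zero>}" "x = quot_frac R a b"
    using carrier_quot_field by blast
  have bc: "b \<in> carrier R" using ab by blast
  obtain s where "s \<in> carrier R - M" "s \<otimes> a \<in> PIdl b \<or> s \<otimes> b \<in> PIdl a"
    using locally_comparable[OF maximalideal_prime[OF M(1)] ab(1) bc] by blast
  then consider "a \<in> PIdl b" | "b \<in> PIdl a" using dvd ab(1) bc by blast
  then show "x \<in> quot_emb R ` carrier R \<or> inv\<^bsub>?K\<^esub> x \<in> quot_emb R ` carrier R"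
  proof cases
    case 1
    then obtain c where c: "c \<in> carrier R" "a = b \<otimes> c" using bc by (auto simp: mem_PIdl_iff)
    have "x = quot_emb R c"
      unfolding ab(3) quot_emb_def using ab(1,2) c m_comm[OF bc c(1)] by (subst quot_frac_eq_iff) auto
    then show ?thesis using c(1) by blast
  next
    case 2
    then obtain c where c: "c \<in> carrier R" "b = a \<otimes> c" using ab(1) by (auto simp: mem_PIdl_iff)
    have "x \<otimes>\<^bsub>?K\<^esub> quot_emb R c = quot_frac R (a \<otimes> c) b"
      unfolding ab(3) quot_emb_def using ab(1,2) c(1) by (simp add: quot_frac_mult)
    also have "\<dots> = \<one>\<^bsub>?K\<^esub>"
      unfolding quot_field_one c(2)[symmetric] using ab(2) by (subst quot_frac_eq_iff) auto
    finally have "inv\<^bsub>?K\<^esub> x = quot_emb R c"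
      using x(1) c(1) quot_emb_closed by (intro K.comm_inv_char) auto
    then show ?thesis using c(1) by blast
  qed
qed

end

section \<open>Factorization of ideals in a strongly discrete valuation domain\<close>

lemma (in valuation_domain) comparable:
  assumes x: "x \<in> carrier R" "y \<in> carrier R"
  shows "x \<in> PIdl y \<or> y \<in> PIdl x"
proof (cases "x = \<zero> \<or> y = \<zero>")
  case True
  then show ?thesis using ideal_zero[OF cgenideal_ideal] x by blast
next
  case False
  let ?K = "quot_field R"
  interpret K: field ?K by (rule field_quot_field)
  have nz: "x \<in> carrier R - {\<zero>}" "y \<in> carrier R - {\<zero>}" using x False by auto
  let ?z = "quot_frac R x y"
  have zc: "?z \<in> carrier ?K" "quot_frac R y x \<in> carrier ?K" using x nz quot_frac_closed by auto
  have "?z \<noteq> \<zero>\<^bsub>?K\<^esub>" unfolding quot_field_zero using x nz quot_frac_eq_iff[of x y \<zero> \<one>] by auto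
  then consider "?z \<in> quot_emb R ` carrier R" | "inv\<^bsub>?K\<^esub> ?z \<in> quot_emb R ` carrier R"
    using valuation zc(1) by blast
  then show ?thesis
  proof cases
    case 1
    then obtain c where c: "c \<in> carrier R" "?z = quot_frac R c \<one>" by (auto simp: quot_emb_def)
    then have "x = y \<otimes> c" using quot_frac_eq_iff[of x y c \<one>] x nz m_comm[of c y] by simp
    then show ?thesis using c(1) mem_PIdl_iff[OF x(2)] by blast
  next
    case 2
    have "?z \<otimes>\<^bsub>?K\<^esub> quot_frac R y x = quot_frac R (x \<otimes> y) (y \<otimes> x)"
      using x nz by (simp add: quot_frac_mult)
    also have "\<dots> = \<one>\<^bsub>?K\<^esub>"
      unfolding quot_field_one using x nz m_comm[OF x] integral[OF _ x(2,1)] by (subst quot_frac_eq_iff) auto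
    finally have "inv\<^bsub>?K\<^esub> ?z = quot_frac R y x" using zc by (intro K.comm_inv_char) auto
    then obtain c where c: "c \<in> carrier R" "quot_frac R y x = quot_frac R c \<one>"
      using 2 by (auto simp: quot_emb_def)
    then have "y = x \<otimes> c" using quot_frac_eq_iff[of y x c \<one>] x nz m_comm[of c x] by simp
    then show ?thesis using c(1) mem_PIdl_iff[OF x(1)] by blast
  qed
qed

lemma (in cring) primeideal_radical:
  assumes P: "primeideal P R"
  shows "radical_ideal R P"
proof -
  interpret P: primeideal P R by (rule P)
  have pow: "x \<in> P" if "x \<in> carrier R" "x [^] (n::nat) \<in> P" for x n
    using that
  proof (induction n)
    case 0
    then show ?case using P.one_imp_carrier P.I_notcarr by simp
  next
    case (Suc n)
    then show ?case using P.I_prime[of "x [^] n" x] by auto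
  qed
  have "ideal_radical R P \<subseteq> P" using pow unfolding ideal_radical_def by blast
  moreover have "P \<subseteq> ideal_radical R P"
    using P.Icarr unfolding ideal_radical_def by (auto intro!: exI[of _ "1::nat"])
  ultimately show ?thesis using P.is_ideal by (simp add: radical_ideal_def)
qed

text \<open>\<open>P\<close> is the set of zero divisors modulo \<open>I\<close>; it is an ideal
  since divisibility is total, and it is prime. Strong discreteness provides an element outside the
  square of \<open>P\<close>, and this leads to a factorization with one radical factor.\<close>

theorem (in valuation_domain) strongly_discrete_isp:
  assumes sd: "strongly_discrete R"
  shows "isp_domain R"
proof (intro isp_domain.intro isp_domain_axioms.intro domain_axioms)
  fix I assume I: "ideal I R" "I \<noteq> {\<zero>}" "I \<noteq> carrier R"
  note Ic = ideal.Icarr[OF I(1)] and Ir = ideal.I_r_closed[OF I(1)] and Il = ideal.I_l_closed[OF I(1)]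
  \<comment> \<open>\<open>I\<close> will be \<open>bP\<close>, with \<open>b\<close> a witness that some element of \<open>P - P\<^sup>2\<close> lies in \<open>P\<close>.\<close>
  define P where "P = {a \<in> carrier R. \<exists>b\<in>carrier R - I. a \<otimes> b \<in> I}"
  have "\<one> \<notin> I" using I ideal.one_imp_carrier by blast
  have IP: "I \<subseteq> P" using \<open>\<one> \<notin> I\<close> Ic by (auto simp: P_def intro!: bexI[of _ \<one>])
  \<comment> \<open>Of two witnesses, the one divisible by the other works for both
    summands.\<close>
  have add: "x \<oplus> y \<in> P"
    if x: "x \<in> carrier R" "b \<in> carrier R - I" "x \<otimes> b \<in> I" and y: "y \<in> carrier R" "d \<in> carrier R - I" "y \<otimes> d \<in> I"
      and bd: "d \<in> PIdl b" for x y b d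
  proof -
    obtain c where c: "c \<in> carrier R" "d = b \<otimes> c" using bd x(2) mem_PIdl_iff by blast
    have "x \<otimes> d = (x \<otimes> b) \<otimes> c" unfolding c(2) using x(1,2) c(1) by (simp add: m_assoc)
    then have "x \<otimes> d \<in> I" using Ir[OF x(3) c(1)] by simp
    then have "(x \<oplus> y) \<otimes> d \<in> I" using ideal_add_closed[OF I(1)] y x(1) by (simp add: l_distr)
    then show ?thesis using x(1) y(1,2) by (auto simp: P_def)
  qed
  have Pi: "ideal P R"
  proof (rule ideal_of_closed)
    show "\<zero> \<in> P" using IP ideal_zero[OF I(1)] by blast
    fix x assume "x \<in> P"
    then obtain b where x: "x \<in> carrier R" "b \<in> carrier R - I" "x \<otimes> b \<in> I" by (auto simp: P_def)
    {
      fix y assume "y \<in> P"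
      then obtain d where y: "y \<in> carrier R" "d \<in> carrier R - I" "y \<otimes> d \<in> I" by (auto simp: P_def)
      show "x \<oplus> y \<in> P"
        using comparable[of b d] add[OF x y] add[OF y x] x(1,2) y(1,2) a_comm[OF x(1) y(1)] by auto
    next
      fix r assume r: "r \<in> carrier R"
      have "(x \<otimes> r) \<otimes> b = (x \<otimes> b) \<otimes> r" using x r by (simp add: m_ac)
      then have "(x \<otimes> r) \<otimes> b \<in> I" using Ir[OF x(3) r] by simp
      then show "x \<otimes> r \<in> P" using x r by (auto simp: P_def)
    }
  qed (auto simp: P_def)
  have P: "primeideal P R"
  proof (rule primeidealI[OF Pi is_cring])
    have "\<one> \<notin> P" by (auto simp: P_def)
    then show "carrier R \<noteq> P" by blast
    fix a b assume ab: "a \<in> carrier R" "b \<in> carrier R" "a \<otimes> b \<in> P"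
    then obtain d where d: "d \<in> carrier R - I" "a \<otimes> b \<otimes> d \<in> I" by (auto simp: P_def)
    then have "a \<otimes> (b \<otimes> d) \<in> I" using ab by (simp add: m_assoc)
    then show "a \<in> P \<or> b \<in> P" using ab d(1) by (cases "b \<otimes> d \<in> I") (auto simp: P_def)
  qed
  have "P \<noteq> {\<zero>}" using IP I(2) ideal_zero[OF I(1)] by blast
  then have "P \<cdot> P \<noteq> P" using sd P by (simp add: strongly_discrete_def)
  then obtain q where q: "q \<in> P" "q \<notin> P \<cdot> P" using ideal_prod_inter[OF Pi Pi] by blast
  then obtain b where b: "q \<in> carrier R" "b \<in> carrier R" "b \<notin> I" "q \<otimes> b \<in> I" by (auto simp: P_def)
  have bP: "p \<otimes> b \<in> I" if p: "p \<in> P" for p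
  proof -
    have pc: "p \<in> carrier R" using p by (simp add: P_def)
    from comparable[OF pc b(1)] show ?thesis
    proof
      assume "p \<in> PIdl q"
      then obtain r where r: "r \<in> carrier R" "p = q \<otimes> r" using mem_PIdl_iff[OF b(1)] by blast
      have "p \<otimes> b = (q \<otimes> b) \<otimes> r" unfolding r(2) using b(1,2) r(1) by (simp add: m_ac)
      then show ?thesis using Ir[OF b(4) r(1)] by simp
    next
      assume "q \<in> PIdl p"
      then obtain r where r: "r \<in> carrier R" "q = p \<otimes> r" using mem_PIdl_iff[OF pc] by blast
      \<comment> \<open>\<open>r \<in> P\<close> would give \<open>q \<in> P \<cdot> P\<close>.
        Hence \<open>r\<close> is not a zero divisor modulo \<open>I\<close> and can be cancelled
        from \<open>r \<otimes> (p \<otimes> b) \<in> I\<close>.\<close>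
      have "r \<notin> P" using q(2) p unfolding r(2) by (auto intro: ideal_prod.prod)
      moreover have "r \<otimes> (p \<otimes> b) \<in> I" using b(4) r(1) b(2) pc unfolding r(2) by (simp add: m_ac)
      ultimately show ?thesis using r(1) pc b(2) by (auto simp: P_def)
    qed
  qed
  have "(PIdl b) \<cdot> P = I"
  proof (rule subset_antisym)
    show "(PIdl b) \<cdot> P \<subseteq> I"
    proof (rule ideal_prod_minimal[OF I(1)])
      fix x p assume "x \<in> PIdl b" and p: "p \<in> P"
      then obtain r where r: "r \<in> carrier R" "x = b \<otimes> r" using mem_PIdl_iff[OF b(2)] by blast
      have "p \<in> carrier R" using p by (simp add: P_def)
      then have "x \<otimes> p = (p \<otimes> b) \<otimes> r" unfolding r(2) using r(1) b(2) by (simp add: m_ac)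
      then show "x \<otimes> p \<in> I" using Ir[OF bP[OF p] r(1)] by simp
    qed
    show "I \<subseteq> (PIdl b) \<cdot> P"
    proof
      fix a assume a: "a \<in> I"
      \<comment> \<open>Every element of \<open>I\<close> is a multiple of \<open>b\<close>, since
        \<open>b\<close> lies outside \<open>I\<close> and divisibility is total.\<close>
      have "b \<notin> PIdl a" using cgenideal_minimal[OF I(1) a] b(3) by blast
      then obtain p where p: "p \<in> carrier R" "a = b \<otimes> p"
        using comparable[OF Ic[OF a] b(2)] mem_PIdl_iff[OF b(2)] by blast
      have "p \<otimes> b \<in> I" using a p b(2) by (simp add: m_comm)
      then have "p \<in> P" using p(1) b(2,3) by (auto simp: P_def)
      then show "a \<in> (PIdl b) \<cdot> P" unfolding p(2) using cgenideal_self[OF b(2)] by (rule_tac ideal_prod.prod)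
    qed
  qed
  moreover have "invertible_ideal R (PIdl b)"
  proof (rule invertible_ideal_if_locally_principal[OF cgenideal_ideal[OF b(2)]])
    show "PIdl b \<noteq> {\<zero>}" using cgenideal_self[OF b(2)] b(3) ideal_zero[OF I(1)] by auto
    fix M assume M: "maximalideal M R"
    have "\<one> \<notin> M" using M ideal.one_imp_carrier maximalideal.I_notcarr maximalideal.axioms(1) by blast
    moreover have "\<one> \<otimes> x \<in> PIdl b" if "x \<in> PIdl b" for x
      using that ideal.Icarr[OF cgenideal_ideal[OF b(2)] that] by simp
    ultimately show "\<exists>a\<in>PIdl b. \<exists>s\<in>carrier R - M. \<forall>x\<in>PIdl b. s \<otimes> x \<in> PIdl a"
      using cgenideal_self[OF b(2)] one_closed by blast
  qed
  moreover have "radical_ideal R P" "P \<noteq> carrier R"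
    using primeideal_radical[OF P] primeideal.I_notcarr[OF P] by auto
  ultimately show "\<exists>J Qs. invertible_ideal R J \<and> Qs \<noteq> []
      \<and> (\<forall>Q\<in>set Qs. radical_ideal R Q \<and> Q \<noteq> carrier R) \<and> I = foldl (ideal_prod R) J Qs"
    by (intro exI[of _ "PIdl b"] exI[of _ "[P]"]) auto
qed

theorem theorem5:
  fixes A :: "('a, 'm) ring_scheme"
  shows "(isp_domain A \<longrightarrow>
            (pruefer_domain A \<and> strongly_discrete A)
          \<and> (\<forall>P. primeideal P A \<and> P \<noteq> {\<zero>\<^bsub>A\<^esub>} \<longrightarrow> (\<exists>!M. maximalideal M A \<and> P \<subseteq> M)))
       \<and> (local_domain A \<longrightarrow>
            (isp_domain A \<longleftrightarrow> valuation_domain A \<and> strongly_discrete A))"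
proof (intro conjI impI)
  assume "isp_domain A"
  then interpret isp_domain A .
  show "pruefer_domain A" by (rule isp_pruefer)
  show "strongly_discrete A" by (rule isp_strongly_discrete)
  show "\<forall>P. primeideal P A \<and> P \<noteq> {\<zero>\<^bsub>A\<^esub>} \<longrightarrow> (\<exists>!M. maximalideal M A \<and> P \<subseteq> M)"
  proof (intro allI impI, elim conjE)
    fix P assume P: "primeideal P A" "P \<noteq> {\<zero>\<^bsub>A\<^esub>}"
    obtain M where "maximalideal M A" "P \<subseteq> M"
      using ex_maximalideal[OF primeideal.axioms(1)[OF P(1)]] primeideal.I_notcarr[OF P(1)] by auto
    then show "\<exists>!M. maximalideal M A \<and> P \<subseteq> M"
      using isp_prime_subset_unique_maximal[OF P] by blast
  qed
next
  assume "local_domain A"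
  then show "isp_domain A \<longleftrightarrow> valuation_domain A \<and> strongly_discrete A"
    using isp_domain.isp_local_valuation isp_domain.isp_strongly_discrete
      valuation_domain.strongly_discrete_isp by blast
qed

end
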